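(* Let $a,b>0$, let $I=[0,1]$ or $I=\mathbb{S}^1=\mathbb{R}/\mathbb{Z}$, and let $\gamma\colon(-\delta,\delta)\times[0,T]\times I\to\mathbb{R}^2$, $(\varepsilon,t,s)\mapsto\gamma(\varepsilon,t,s)$, be a variation (with fixed endpoints, i.e. $\gamma(\varepsilon,0,\cdot)$ and $\gamma(\varepsilon,T,\cdot)$ independent of $\varepsilon$ modulo translations) of a smooth path in $\mathcal{A}_1(I)$, with $\gamma_s(\varepsilon,t,s)=(\cos\theta(\varepsilon,t,s),\sin\theta(\varepsilon,t,s))$ for some smooth angle function $\theta$. Put $\mathrm{n}=(-\sin\theta,\cos\theta)$. At $\varepsilon=0$ let $m(t,\cdot)$ be, for each $t$, the unique solution of $$-\tfrac{a}{b}m_{ss}+\theta_s^2m=\theta_s\theta_t,$$ with $m(t,0)=m(t,1)=0$ if $I=[0,1]$ and periodic in $s$ if $I=\mathbb{S}^1$, and let $$\tfrac1b\,\xi=-\theta_{tt}+\partial_t(\theta_sm)+\partial_s(\theta_tm)-\partial_s(\theta_sm^2).$$ Then the gradient $\nabla E$ of the energy functional, determined by the formula $$\frac{dE}{d\varepsilon}(0)=\int_0^T\widetilde G^{a,b}(\gamma_\varepsilon,\nabla E(\gamma))\,dt ,$$ satisfies $(\nabla E)_s(0,t,s)=\beta(t,s)\,\mathrm{n}(t,s)$ with $$\beta(t,s)=\frac1b\xi(t,s)-\frac1a\theta_s(t,s)\int_0^s\Big(\int_0^x\theta_s(t,y)\xi(t,y)\,dy\Big)dx+\frac1a\,s\,\theta_s(t,s)\int_0^1\Big(\int_0^x\theta_s(t,y)\xi(t,y)\,dy\Big)dx,$$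 or equivalently $$\beta(t,s)=\frac1b\xi(t,s)-\theta_s(t,s)m_t(t,s)-\frac{b}{2a}C(t)\,s\,\theta_s(t,s)+\frac12\theta_s(t,s)\int_0^s\Big(m_x(t,x)^2+\frac ba\theta_x(t,x)^2m(t,x)^2-\frac ba\theta_t(t,x)^2\Big)dx,$$ where $$C(t)=\int_0^1\theta_s(t,s)\theta_t(t,s)m(t,s)\,ds-\int_0^1\theta_t(t,s)^2\,ds.$$ (For $I=\mathbb{S}^1$, $\nabla E$ is only defined modulo the vector fields $c(t)\gamma_s$, i.e. $\beta$ is defined modulo functions of the form $c(t)\theta_s(t,s)$, and the equivalence of the two formulas is understood in this sense.)
   Context: Subscripts denote partial derivatives. $\mathcal{A}_1(I)$ is the space of smooth arc-length parameterized curves $\gamma\colon I\to\mathbb{R}^2$ ($|\gamma'|\equiv1$) modulo translations. For $\gamma\in\mathcal{A}_1(I)$ put $\mathrm{v}=\gamma'$, $\mathrm{n}=\mathrm{v}^\perp$ (rotation of $\mathrm{v}$ by $+\pi/2$), and let $\kappa$ be the curvature, $\mathrm{v}'=\kappa\mathrm{n}$ (so $\kappa=\theta_s$ when $\mathrm{v}=(\cos\theta,\sin\theta)$). A tangent vector $w$ to $\mathcal{A}_1(I)$ at $\gamma$ satisfies $w'=\Phi\,\mathrm{n}$ with $\Phi\in C^\infty(I,\mathbb{R})$. The quotient elastic metric is, for $w'=\Phi\mathrm{n}$ and $z'=\Psi\mathrm{n}$, $$\widetilde G^{a,b}(w,z)=\int_0^1b\,\Phi\,(\Psi-\kappa p)\,ds,\qquad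 -ap''+b\kappa^2p=b\kappa\Psi,$$ with $p(0)=p(1)=0$ if $I=[0,1]$ and $p$ periodic if $I=\mathbb{S}^1$. For $I=\mathbb{S}^1$ it is degenerate exactly along vectors $c\,\mathrm{v}$, $c\in\mathbb{R}$ (translation of the base point), and descends to the quotient by $\mathbb{S}^1$. The energy of the path $t\mapsto\gamma(\varepsilon,t,\cdot)$ is $E(\varepsilon)=\frac12\int_0^T\widetilde G^{a,b}(\gamma_t,\gamma_t)\,dt$. Its derivative is $\frac{dE}{d\varepsilon}(0)=\int_0^T\int_0^1\theta_\varepsilon\,\xi\,ds\,dt$ with $\xi$ as in the claim, where $\gamma_{\varepsilon s}=\theta_\varepsilon\mathrm{n}$. Convention on the gradient: $\nabla E$ is considered modulo translations, so it is given by $(\nabla E)_s=\beta\mathrm{n}$, and it is the vector field representing this $1$-form with respect to $\widetilde G^{a,b}$: for each $t$, $$\int_0^1f\,\xi\,ds=\int_0^1b\,f\,(\beta-\theta_sh)\,ds\quad\text{for all } f\in C^\infty(I,\mathbb{R}),\qquad -ah_{ss}+b\theta_s^2h=b\theta_s\beta,$$ with $h(t,0)=h(t,1)=0$ if $I=[0,1]$ and $h$ periodic in $s$ if $I=\mathbb{S}^1$. In the closed case the closure constraint $\int_0^1\beta\,\mathrm{n}\,ds=0$ is not imposed on $\nabla E$. *)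

theory Defs
  imports "HOL-Analysis.Analysis"
begin

(* The plane is identified with the complex numbers: (cos x, sin x) is "cis x" and the
   rotation by pi/2 is multiplication by the imaginary unit.  Functions on the circle R/Z are
   1-periodic functions on the real line; an angle function of a closed curve is a function on
   the real line that need not be periodic. *)

datatype curve_domain = Interval | Circle

primrec pts :: "curve_domain \<Rightarrow> real set" where
  "pts Interval = {0..1}"
| "pts Circle = UNIV"

primrec descends :: "curve_domain \<Rightarrow> (real \<Rightarrow> 'a) \<Rightarrow> bool" where
  "descends Interval f \<longleftrightarrow> True"
| "descends Circle f \<longleftrightarrow> (\<forall>s. f (s + 1) = f s)"

(* Derivatives are taken within S, hence one-sided at boundary points.  All the sets used below
   are nondegenerate boxes (possibly unbounded or half-open), where they are unique. *)
primrec C_k_on :: "nat \<Rightarrow> 'a::real_normed_vector set \<Rightarrow> ('a \<Rightarrow> 'b::real_normed_vector) \<Rightarrow> bool" where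
  "C_k_on 0 S f \<longleftrightarrow> continuous_on S f"
| "C_k_on (Suc k) S f \<longleftrightarrow>
     (\<exists>f'. (\<forall>x\<in>S. (f has_derivative f' x) (at x within S)) \<and> (\<forall>v. C_k_on k S (\<lambda>x. f' x v)))"

definition smooth_on :: "'a::real_normed_vector set \<Rightarrow> ('a \<Rightarrow> 'b::real_normed_vector) \<Rightarrow> bool" where
  "smooth_on S f \<longleftrightarrow> (\<forall>k. C_k_on k S f)"

definition smooth_fun :: "curve_domain \<Rightarrow> (real \<Rightarrow> 'b::real_normed_vector) \<Rightarrow> bool" where
  "smooth_fun I f \<longleftrightarrow> smooth_on (pts I) f \<and> descends I f"

definition D :: "curve_domain \<Rightarrow> (real \<Rightarrow> 'b::real_normed_vector) \<Rightarrow> real \<Rightarrow> 'b" where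
  "D I f s = vector_derivative f (at s within pts I)"

definition pd_s :: "curve_domain \<Rightarrow> (real \<Rightarrow> real \<Rightarrow> 'b::real_normed_vector) \<Rightarrow> real \<Rightarrow> real \<Rightarrow> 'b" where
  "pd_s I f t s = D I (f t) s"

definition pd_t :: "real \<Rightarrow> (real \<Rightarrow> real \<Rightarrow> 'b::real_normed_vector) \<Rightarrow> real \<Rightarrow> real \<Rightarrow> 'b" where
  "pd_t T f t s = vector_derivative (\<lambda>\<tau>. f \<tau> s) (at t within {0..T})"

definition pd_eps0 :: "(real \<Rightarrow> real \<Rightarrow> real \<Rightarrow> 'b::real_normed_vector) \<Rightarrow> real \<Rightarrow> real \<Rightarrow> 'b" where
  "pd_eps0 f t s = vector_derivative (\<lambda>\<epsilon>. f \<epsilon> t s) (at 0)"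

(* Curves are not quotiented by translations; everything below depends on a curve and on
   vector fields along it only through their derivatives in s. *)
definition arclength_curves :: "curve_domain \<Rightarrow> (real \<Rightarrow> complex) set" where
  "arclength_curves I = {c. smooth_fun I c \<and> (\<forall>s\<in>pts I. norm (D I c s) = 1)}"

definition normal :: "curve_domain \<Rightarrow> (real \<Rightarrow> complex) \<Rightarrow> real \<Rightarrow> complex" where
  "normal I c s = \<i> * D I c s"

definition curvature :: "curve_domain \<Rightarrow> (real \<Rightarrow> complex) \<Rightarrow> real \<Rightarrow> real" where
  "curvature I c s = D I (D I c) s \<bullet> normal I c s"

(* w' = Phi n.  On the circle, Phi is periodic, but w itself is not required to be:
   the closure constraint on w is not imposed. *)
definition tangent_field :: "curve_domain \<Rightarrow> (real \<Rightarrow> complex) \<Rightarrow> (real \<Rightarrow> real) \<Rightarrow> (real \<Rightarrow> complex) \<Rightarrow> bool" where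
  "tangent_field I c \<Phi> w \<longleftrightarrow> smooth_fun I \<Phi> \<and>
     (\<forall>s\<in>pts I. (w has_vector_derivative \<Phi> s *\<^sub>R normal I c s) (at s within pts I))"

(* - a p'' + b k^2 p = b k Psi, with Dirichlet or periodic boundary conditions *)
definition solves_bvp ::
    "curve_domain \<Rightarrow> real \<Rightarrow> real \<Rightarrow> (real \<Rightarrow> real) \<Rightarrow> (real \<Rightarrow> real) \<Rightarrow> (real \<Rightarrow> real) \<Rightarrow> bool" where
  "solves_bvp I a b k \<Psi> p \<longleftrightarrow> smooth_fun I p \<and> (I = Interval \<longrightarrow> p 0 = 0 \<and> p 1 = 0) \<and>
     (\<forall>s\<in>pts I. - a * D I (D I p) s + b * (k s)\<^sup>2 * p s = b * k s * \<Psi> s)"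

(* SOME rather than THE: p is determined only on "pts I", its other values play no role. *)
definition elastic_metric ::
    "curve_domain \<Rightarrow> real \<Rightarrow> real \<Rightarrow> (real \<Rightarrow> complex) \<Rightarrow> (real \<Rightarrow> complex) \<Rightarrow> (real \<Rightarrow> complex) \<Rightarrow> real" where
  "elastic_metric I a b c w z =
     (let k = curvature I c;
          \<Phi> = (\<lambda>s. D I w s \<bullet> normal I c s);
          \<Psi> = (\<lambda>s. D I z s \<bullet> normal I c s);
          p = (SOME p. solves_bvp I a b k \<Psi> p)
      in integral {0..1} (\<lambda>s. b * \<Phi> s * (\<Psi> s - k s * p s)))"

definition energy :: "curve_domain \<Rightarrow> real \<Rightarrow> real \<Rightarrow> real \<Rightarrow> (real \<Rightarrow> real \<Rightarrow> complex) \<Rightarrow> real" where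
  "energy I T a b c =
     1/2 * integral {0..T} (\<lambda>t. elastic_metric I a b (c t) (pd_t T c t) (pd_t T c t))"

(* A variation of a path in the space of arc length parameterized curves, with angle function th;
   at both ends of [0,T] the curve is independent of epsilon modulo translations. *)
definition variation ::
    "curve_domain \<Rightarrow> real \<Rightarrow> real \<Rightarrow> (real \<Rightarrow> real \<Rightarrow> real \<Rightarrow> complex) \<Rightarrow> (real \<Rightarrow> real \<Rightarrow> real \<Rightarrow> real) \<Rightarrow> bool" where
  "variation I T \<delta> \<gamma> \<theta> \<longleftrightarrow>
     smooth_on ({-\<delta><..<\<delta>} \<times> {0..T} \<times> pts I) (\<lambda>(\<epsilon>, t, s). \<gamma> \<epsilon> t s) \<and>
     smooth_on ({-\<delta><..<\<delta>} \<times> {0..T} \<times> pts I) (\<lambda>(\<epsilon>, t, s). \<theta> \<epsilon> t s) \<and>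
     (\<forall>\<epsilon>\<in>{-\<delta><..<\<delta>}. \<forall>t\<in>{0..T}. \<gamma> \<epsilon> t \<in> arclength_curves I \<and>
        (\<forall>s\<in>pts I. pd_s I (\<gamma> \<epsilon>) t s = cis (\<theta> \<epsilon> t s))) \<and>
     (\<forall>t\<in>{0, T}. \<forall>\<epsilon>\<in>{-\<delta><..<\<delta>}. \<exists>z. \<forall>s\<in>pts I. \<gamma> \<epsilon> t s = \<gamma> 0 t s + z)"

(* From here on, th is the angle function at epsilon = 0 as a function of (t, s). *)

definition is_m :: "curve_domain \<Rightarrow> real \<Rightarrow> real \<Rightarrow> real \<Rightarrow> (real \<Rightarrow> real \<Rightarrow> real) \<Rightarrow> (real \<Rightarrow> real \<Rightarrow> real) \<Rightarrow> bool" where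
  "is_m I T a b th m \<longleftrightarrow> (\<forall>t\<in>{0..T}. solves_bvp I (a/b) 1 (pd_s I th t) (pd_t T th t) (m t))"

definition xi :: "curve_domain \<Rightarrow> real \<Rightarrow> real \<Rightarrow> (real \<Rightarrow> real \<Rightarrow> real) \<Rightarrow> (real \<Rightarrow> real \<Rightarrow> real) \<Rightarrow> real \<Rightarrow> real \<Rightarrow> real" where
  "xi I T b th m t s = b * (- pd_t T (pd_t T th) t s
      + pd_t T (\<lambda>t s. pd_s I th t s * m t s) t s
      + pd_s I (\<lambda>t s. pd_t T th t s * m t s) t s
      - pd_s I (\<lambda>t s. pd_s I th t s * (m t s)\<^sup>2) t s)"

(* W represents, at each time t, the 1-form given by f |-> integral of f * x t over [0,1],
   where z' = f n, with respect to the metric along the path c. *)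
definition is_gradient ::
    "curve_domain \<Rightarrow> real \<Rightarrow> real \<Rightarrow> real \<Rightarrow> (real \<Rightarrow> real \<Rightarrow> complex) \<Rightarrow> (real \<Rightarrow> real \<Rightarrow> real) \<Rightarrow> (real \<Rightarrow> real \<Rightarrow> complex) \<Rightarrow> bool" where
  "is_gradient I T a b c x W \<longleftrightarrow> (\<forall>t\<in>{0..T}.
     (\<exists>\<beta>. tangent_field I (c t) \<beta> (W t)) \<and>
     (\<forall>f z. tangent_field I (c t) f z \<longrightarrow>
        integral {0..1} (\<lambda>s. f s * x t s) = elastic_metric I a b (c t) z (W t)))"

(* The parameter s ranges over the whole real line on the circle, hence the oriented integrals. *)
definition double_int :: "(real \<Rightarrow> real) \<Rightarrow> real \<Rightarrow> real" where
  "double_int g s = (LBINT x=ereal 0..ereal s. (LBINT y=ereal 0..ereal x. g y))"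

definition beta_xi :: "curve_domain \<Rightarrow> real \<Rightarrow> real \<Rightarrow> real \<Rightarrow> (real \<Rightarrow> real \<Rightarrow> real) \<Rightarrow> (real \<Rightarrow> real \<Rightarrow> real) \<Rightarrow> real \<Rightarrow> real \<Rightarrow> real" where
  "beta_xi I T a b th m t s =
     1/b * xi I T b th m t s
     - 1/a * pd_s I th t s * double_int (\<lambda>y. pd_s I th t y * xi I T b th m t y) s
     + 1/a * s * pd_s I th t s * double_int (\<lambda>y. pd_s I th t y * xi I T b th m t y) 1"

definition C_fun :: "curve_domain \<Rightarrow> real \<Rightarrow> (real \<Rightarrow> real \<Rightarrow> real) \<Rightarrow> (real \<Rightarrow> real \<Rightarrow> real) \<Rightarrow> real \<Rightarrow> real" where
  "C_fun I T th m t =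
     integral {0..1} (\<lambda>s. pd_s I th t s * pd_t T th t s * m t s)
     - integral {0..1} (\<lambda>s. (pd_t T th t s)\<^sup>2)"

definition beta_m :: "curve_domain \<Rightarrow> real \<Rightarrow> real \<Rightarrow> real \<Rightarrow> (real \<Rightarrow> real \<Rightarrow> real) \<Rightarrow> (real \<Rightarrow> real \<Rightarrow> real) \<Rightarrow> real \<Rightarrow> real \<Rightarrow> real" where
  "beta_m I T a b th m t s =
     1/b * xi I T b th m t s - pd_s I th t s * pd_t T m t s
     - b / (2*a) * C_fun I T th m t * s * pd_s I th t s
     + 1/2 * pd_s I th t s * (LBINT x=ereal 0..ereal s.
         (pd_s I m t x)\<^sup>2 + b/a * (pd_s I th t x)\<^sup>2 * (m t x)\<^sup>2 - b/a * (pd_t T th t x)\<^sup>2)"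

(* Equality on the interval; on the circle, equality modulo c(t) th_s(t,s). *)
definition same_field ::
    "curve_domain \<Rightarrow> real \<Rightarrow> (real \<Rightarrow> real \<Rightarrow> real) \<Rightarrow> (real \<Rightarrow> real \<Rightarrow> real) \<Rightarrow> (real \<Rightarrow> real \<Rightarrow> real) \<Rightarrow> bool" where
  "same_field I T th \<beta> \<beta>' \<longleftrightarrow> (\<forall>t\<in>{0..T}. \<exists>c. (I = Interval \<longrightarrow> c = 0) \<and>
     (\<forall>s\<in>pts I. \<beta> t s = \<beta>' t s + c * pd_s I th t s))"

end

theory Submission
  imports Defs
begin

text \<open>
  The energy estimate for \<open>- a u'' + q u = f\<close> bounds \<open>sup \<bar>u\<bar>\<close> by
  \<open>sup \<bar>f\<bar>\<close> with a constant that depends only on \<open>a\<close> and, for periodic data, on a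
  lower bound for the integral of \<open>q\<close>. Applied to differences and difference quotients of
  solutions it shows that \<open>m\<close> is differentiable in \<open>t\<close> and \<open>\<epsilon>\<close>, so that the energy
  can be differentiated under the integral sign. The symmetry of the operator removes
  \<open>m\<^sub>\<epsilon>\<close> from the result, and integration by parts in \<open>t\<close> and \<open>s\<close> gives \<open>\<xi>\<close>.

  If \<open>h\<close> belongs to \<open>\<beta>\<close>, then \<open>\<beta>\<close> represents \<open>\<xi>\<close> iff
  \<open>\<xi> = b (\<beta> - \<theta>\<^sub>s h)\<close>, which turns the equation for \<open>h\<close> into
  \<open>- a h'' = \<theta>\<^sub>s \<xi>\<close>, solved by integrating twice. The identity
  \<open>\<theta>\<^sub>s \<xi> = \<partial>\<^sub>s (a m\<^sub>s\<^sub>t + b/2 (\<theta>\<^sub>t\<^sup>2 - \<theta>\<^sub>s\<^sup>2 m\<^sup>2) - a/2 m\<^sub>s\<^sup>2)\<close>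
  shows that the periodic problem is solvable and yields the second formula for \<open>\<beta>\<close>.
\<close>

section \<open>Smooth functions on boxes\<close>

text \<open>\<open>m\<close> is given by a separate boundary value problem at each time, so nothing
  is known beforehand about its dependence on \<open>t\<close> or \<open>\<epsilon>\<close>. Hence
  an explicit bound that is uniform in the parameters carries the proof. On the circle this
  uniformity is geometric: the coefficient \<open>b \<theta>_s^2\<close> may vanish at some points,
  but a closed curve cannot be nearly straight. A derivative of \<open>m\<close> in a parameter is
  found by solving the formally differentiated problem first and comparing its solution with
  difference quotients afterwards; first derivatives are enough.

  That \<open>\<theta>_s \<xi>\<close> is the derivative of a periodic function reflects that the
  energy of closed curves does not see time dependent shifts of the base point. The equation
  \<open>- a h'' = \<theta>_s \<xi>\<close> has lost its zero order term, so its periodic solutions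
  are determined up to constants only. These constants are the freedom
  \<open>c(t) \<theta>_s\<close> in \<open>\<beta>\<close>.

  The angle of a closed curve need not be periodic, but its first derivatives are, because they are
  determined by the tangent \<open>cis \<theta>\<close>.\<close>

lemma C_k_on_cong:
  "(\<And>x. x \<in> S \<Longrightarrow> f x = g x) \<Longrightarrow> C_k_on k S f \<Longrightarrow> C_k_on k S g"
proof (induction k arbitrary: f g)
  case 0
  then show ?case by (simp cong: continuous_on_cong)
next
  case (Suc k)
  then obtain f' where f': "\<forall>x\<in>S. (f has_derivative f' x) (at x within S)"
    "\<forall>v. C_k_on k S (\<lambda>x. f' x v)" by auto
  have "\<forall>x\<in>S. (g has_derivative f' x) (at x within S)"
    using f' Suc.prems by (metis has_derivative_transform)
  with f'(2) show ?case by auto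
qed

lemma C_k_on_imp_continuous: "C_k_on k S f \<Longrightarrow> continuous_on S f"
proof (cases k)
  case (Suc n)
  assume "C_k_on k S f"
  with Suc obtain f' where "\<forall>x\<in>S. (f has_derivative f' x) (at x within S)" by auto
  then show ?thesis using has_derivative_continuous_on by blast
qed simp

lemma C_k_on_SucD: "C_k_on (Suc k) S f \<Longrightarrow> C_k_on k S f"
proof (induction k arbitrary: f)
  case 0
  from C_k_on_imp_continuous[OF this] show ?case by simp
next
  case (Suc k)
  from Suc.prems obtain f' where f': "\<forall>x\<in>S. (f has_derivative f' x) (at x within S)"
    "\<And>v. C_k_on (Suc k) S (\<lambda>x. f' x v)" by (subst (asm) C_k_on.simps(2)) auto
  show ?case
    unfolding C_k_on.simps(2)[of k] using f'(1) Suc.IH[OF f'(2)] by blast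
qed

lemma C_k_on_const: "C_k_on k S (\<lambda>x. c)"
proof (induction k arbitrary: c)
  case (Suc k)
  then show ?case by (auto intro!: exI[of _ "\<lambda>x v. 0"])
qed simp

lemma C_k_on_add: "C_k_on k S f \<Longrightarrow> C_k_on k S g \<Longrightarrow> C_k_on k S (\<lambda>x. f x + g x)"
proof (induction k arbitrary: f g)
  case (Suc k)
  from Suc.prems obtain f' g' where
    *: "\<forall>x\<in>S. (f has_derivative f' x) (at x within S)" "\<forall>v. C_k_on k S (\<lambda>x. f' x v)"
       "\<forall>x\<in>S. (g has_derivative g' x) (at x within S)" "\<forall>v. C_k_on k S (\<lambda>x. g' x v)"
    by auto
  then show ?case
    by (auto intro!: exI[of _ "\<lambda>x v. f' x v + g' x v"] has_derivative_add Suc.IH)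
qed (auto intro: continuous_intros)

lemma C_k_on_mult:
  fixes f g :: "'a::real_normed_vector \<Rightarrow> real"
  shows "C_k_on k S f \<Longrightarrow> C_k_on k S g \<Longrightarrow> C_k_on k S (\<lambda>x. f x * g x)"
proof (induction k arbitrary: f g)
  case (Suc k)
  from Suc.prems obtain f' g' where
    *: "\<forall>x\<in>S. (f has_derivative f' x) (at x within S)" "\<forall>v. C_k_on k S (\<lambda>x. f' x v)"
       "\<forall>x\<in>S. (g has_derivative g' x) (at x within S)" "\<forall>v. C_k_on k S (\<lambda>x. g' x v)"
    by auto
  then show ?case
    using C_k_on_SucD[OF Suc.prems(1)] C_k_on_SucD[OF Suc.prems(2)]
    by (auto intro!: exI[of _ "\<lambda>x v. f x * g' x v + f' x v * g x"] has_derivative_mult Suc.IH C_k_on_add)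
qed (auto intro: continuous_intros)

text \<open>The derivative of the composite in direction \<open>v\<close> is that of
  \<open>f\<close> in the fixed direction \<open>L v\<close>, composed with the same affine map, so
  the induction hypothesis applies again. Slices of a function of \<open>(e, t, s)\<close> are of
  this form.\<close>

lemma C_k_on_affine:
  assumes L: "bounded_linear L" and into: "\<And>y. y \<in> S' \<Longrightarrow> p + L y \<in> S"
  shows "C_k_on k S f \<Longrightarrow> C_k_on k S' (\<lambda>y. f (p + L y))"
proof (induction k arbitrary: f)
  case 0
  have "continuous_on S' (\<lambda>y. p + L y)"
    by (intro continuous_intros linear_continuous_on L)
  with 0 show ?case
    using into by (auto intro: continuous_on_compose2)
next
  case (Suc k)
  then obtain f' where f': "\<forall>x\<in>S. (f has_derivative f' x) (at x within S)"
    "\<forall>v. C_k_on k S (\<lambda>x. f' x v)" by auto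
  have "((\<lambda>y. f (p + L y)) has_derivative (\<lambda>v. f' (p + L y) (L v))) (at y within S')"
    if "y \<in> S'" for y
  proof -
    have 1: "((\<lambda>y. p + L y) has_derivative L) (at y within S')"
      using L by (auto intro!: derivative_eq_intros bounded_linear_imp_has_derivative)
    have "(\<lambda>y. p + L y) ` S' \<subseteq> S" using into by auto
    with f'(1) into that have 2: "(f has_derivative f' (p + L y)) (at (p + L y) within (\<lambda>y. p + L y) ` S')"
      by (meson has_derivative_subset)
    show ?thesis using has_derivative_in_compose[OF 1 2] .
  qed
  moreover have "C_k_on k S' (\<lambda>y. f' (p + L y) (L v))" for v
    using Suc.IH f'(2) by blast
  ultimately show ?case
    by (auto intro!: exI[of _ "\<lambda>y v. f' (p + L y) (L v)"])
qed

text \<open>The condition of the library for uniqueness of the Frechet derivative within a set.\<close>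

definition thick :: "'a::euclidean_space set \<Rightarrow> bool" where
  "thick S \<longleftrightarrow> (\<forall>x\<in>S. \<forall>i\<in>Basis. \<forall>e>0. \<exists>d. 0 < \<bar>d\<bar> \<and> \<bar>d\<bar> < e \<and> x + d *\<^sub>R i \<in> S)"

lemma thick_Times:
  assumes "thick A" "thick B"
  shows "thick (A \<times> B)"
  unfolding thick_def
proof (intro ballI allI impI)
  fix x i :: "'a \<times> 'b" and e :: real
  assume x: "x \<in> A \<times> B" and i: "i \<in> Basis" and e: "e > 0"
  from i consider u where "u \<in> Basis" "i = (u, 0)" | v where "v \<in> Basis" "i = (0, v)"
    by (auto simp: Basis_prod_def)
  then show "\<exists>d. 0 < \<bar>d\<bar> \<and> \<bar>d\<bar> < e \<and> x + d *\<^sub>R i \<in> A \<times> B"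
  proof cases
    case (1 u)
    with assms x e obtain d where "0 < \<bar>d\<bar>" "\<bar>d\<bar> < e" "fst x + d *\<^sub>R u \<in> A"
      unfolding thick_def by (metis mem_Times_iff)
    with 1 x show ?thesis by (intro exI[of _ d]) (auto simp: mem_Times_iff)
  next
    case (2 v)
    with assms x e obtain d where "0 < \<bar>d\<bar>" "\<bar>d\<bar> < e" "snd x + d *\<^sub>R v \<in> B"
      unfolding thick_def by (metis mem_Times_iff)
    with 2 x show ?thesis by (intro exI[of _ d]) (auto simp: mem_Times_iff)
  qed
qed

lemma thick_Icc:
  fixes l u :: real
  assumes "l < u"
  shows "thick {l..u}"
  unfolding thick_def
proof (intro ballI allI impI)
  fix x i e :: real
  assume x: "x \<in> {l..u}" and i: "i \<in> Basis" and e: "e > 0"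
  show "\<exists>d. 0 < \<bar>d\<bar> \<and> \<bar>d\<bar> < e \<and> x + d *\<^sub>R i \<in> {l..u}"
  proof (cases "x = u")
    case True
    with x i e assms show ?thesis
      by (intro exI[of _ "- (min (e/2) (u - l))"]) (auto simp: min_def)
  next
    case False
    with x i e assms show ?thesis
      by (intro exI[of _ "min (e/2) (u - x)"]) (auto simp: min_def)
  qed
qed

lemma thick_open:
  fixes S :: "real set"
  assumes "open S"
  shows "thick S"
  unfolding thick_def
proof (intro ballI allI impI)
  fix x i e :: real
  assume x: "x \<in> S" and i: "i \<in> Basis" and e: "e > 0"
  from assms x obtain r where r: "r > 0" "ball x r \<subseteq> S"
    using openE by blast
  have "x + min r e / 2 \<in> ball x r"
    using r e by (auto simp: dist_real_def min_def)
  with r have "x + min r e / 2 \<in> S" by blast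
  with r i e show "\<exists>d. 0 < \<bar>d\<bar> \<and> \<bar>d\<bar> < e \<and> x + d *\<^sub>R i \<in> S"
    by (intro exI[of _ "min r e / 2"]) (auto simp: min_def)
qed

lemma thick_pts: "thick (pts I)"
  by (cases I) (auto intro: thick_Icc thick_open)

text \<open>Each order \<open>k\<close> in \<open>smooth_on\<close> comes with its own derivative
  \<open>g k\<close>. On a thick set the Frechet derivative is unique, so \<open>g 0\<close>
  inherits the regularity of all of them.\<close>

lemma smooth_on_has_derivative:
  fixes f :: "'a::euclidean_space \<Rightarrow> 'b::real_normed_vector"
  assumes "thick S" "smooth_on S f"
  obtains f' where "\<And>x. x \<in> S \<Longrightarrow> (f has_derivative f' x) (at x within S)"
    "\<And>v. smooth_on S (\<lambda>x. f' x v)"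
proof -
  have "\<forall>k. \<exists>f'. (\<forall>x\<in>S. (f has_derivative f' x) (at x within S)) \<and> (\<forall>v. C_k_on k S (\<lambda>x. f' x v))"
    using assms(2) unfolding smooth_on_def by (metis C_k_on.simps(2))
  then obtain g where g: "\<And>k x. x \<in> S \<Longrightarrow> (f has_derivative g k x) (at x within S)"
    "\<And>k v. C_k_on k S (\<lambda>x. g k x v)" by metis
  have eq: "g k x = g 0 x" if "x \<in> S" for k x
    by (rule frechet_derivative_unique_within[OF g(1)[OF that] g(1)[OF that]])
      (use assms(1) that in \<open>auto simp: thick_def\<close>)
  have "smooth_on S (\<lambda>x. g 0 x v)" for v
    unfolding smooth_on_def
  proof
    fix k
    show "C_k_on k S (\<lambda>x. g 0 x v)"
      by (rule C_k_on_cong[OF _ g(2)[of k v]]) (simp only: eq[of _ k])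
  qed
  with g(1) show thesis by (rule that)
qed

lemma smooth_on_imp_continuous: "smooth_on S f \<Longrightarrow> continuous_on S f"
  unfolding smooth_on_def using C_k_on_imp_continuous by blast

lemma smooth_on_cong: "(\<And>x. x \<in> S \<Longrightarrow> f x = g x) \<Longrightarrow> smooth_on S f \<Longrightarrow> smooth_on S g"
  unfolding smooth_on_def using C_k_on_cong by metis

lemma smooth_on_const: "smooth_on S (\<lambda>x. c)"
  by (simp add: smooth_on_def C_k_on_const)

lemma smooth_on_add: "smooth_on S f \<Longrightarrow> smooth_on S g \<Longrightarrow> smooth_on S (\<lambda>x. f x + g x)"
  by (simp add: smooth_on_def C_k_on_add)

lemma smooth_on_mult:
  fixes f g :: "'a::real_normed_vector \<Rightarrow> real"
  shows "smooth_on S f \<Longrightarrow> smooth_on S g \<Longrightarrow> smooth_on S (\<lambda>x. f x * g x)"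
  by (simp add: smooth_on_def C_k_on_mult)

lemma smooth_on_affine:
  assumes "bounded_linear L" "\<And>y. y \<in> S' \<Longrightarrow> p + L y \<in> S" "smooth_on S f"
  shows "smooth_on S' (\<lambda>y. f (p + L y))"
  unfolding smooth_on_def
proof
  fix k
  have "C_k_on k S f" using assms(3) by (simp add: smooth_on_def)
  from C_k_on_affine[OF assms(1,2) this] show "C_k_on k S' (\<lambda>y. f (p + L y))" .
qed

lemma C_k_on_Suc_real:
  fixes f :: "real \<Rightarrow> real"
  assumes "\<And>x. x \<in> S \<Longrightarrow> (f has_real_derivative f' x) (at x within S)" "C_k_on k S f'"
  shows "C_k_on (Suc k) S f"
  using assms unfolding C_k_on.simps
  by (intro exI[of _ "\<lambda>x v. f' x * v"])
    (auto simp: has_field_derivative_def intro!: C_k_on_mult C_k_on_const)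

lemma smooth_on_antiderivative:
  fixes f :: "real \<Rightarrow> real"
  assumes "\<And>x. x \<in> S \<Longrightarrow> (f has_real_derivative f' x) (at x within S)" "smooth_on S f'"
  shows "smooth_on S f"
  unfolding smooth_on_def
proof
  fix k
  show "C_k_on k S f"
    using C_k_on_Suc_real[OF assms(1)] assms(2) C_k_on_SucD unfolding smooth_on_def by blast
qed

section \<open>Derivatives and periodicity on the interval and the circle\<close>

lemma has_vector_derivative_unique_pts:
  assumes "s \<in> pts I" "(f has_vector_derivative d) (at s within pts I)"
  shows "vector_derivative f (at s within pts I) = d"
proof (cases I)
  case Interval
  with assms show ?thesis
    using vector_derivative_within_cbox[where a=0 and b=1 and f=f and x=s and f'=d] by auto
next
  case Circle
  with assms show ?thesis by (auto intro: vector_derivative_at)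
qed

lemma D_eqI:
  assumes "s \<in> pts I" "(f has_vector_derivative d) (at s within pts I)"
  shows "D I f s = d"
  using has_vector_derivative_unique_pts[OF assms] by (simp add: D_def)

lemma D_cong:
  assumes "s \<in> pts I" "\<And>x. x \<in> pts I \<Longrightarrow> f x = g x"
  shows "D I f s = D I g s"
proof -
  have "(f has_vector_derivative d) (at s within pts I) = (g has_vector_derivative d) (at s within pts I)" for d
    using assms by (metis has_vector_derivative_transform)
  then show ?thesis by (simp add: D_def vector_derivative_def)
qed

text \<open>For a periodic function \<open>has_vector_derivative\<close> holds for the same values
  at \<open>s + 1\<close> and at \<open>s\<close>, so \<open>vector_derivative\<close> selects the
  same one.\<close>

lemma descends_D:
  assumes "descends I f"
  shows "descends I (D I f)"
proof (cases I)
  case Circle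
  have per: "f (x + 1) = f x" for x using assms Circle by simp
  have "f (s + 1 + h) = f (s + h)" for s h using per[of "s + h"] by (simp add: algebra_simps)
  then have "(f has_vector_derivative d) (at (s + 1)) = (f has_vector_derivative d) (at s)" for s d
    by (simp add: has_vector_derivative_def has_derivative_at per)
  with Circle show ?thesis by (simp add: D_def vector_derivative_def)
qed simp

lemma smooth_fun_D:
  assumes "smooth_fun I f"
  shows "smooth_fun I (D I f)"
    and "s \<in> pts I \<Longrightarrow> (f has_vector_derivative D I f s) (at s within pts I)"
proof -
  from assms have f: "smooth_on (pts I) f" "descends I f" by (auto simp: smooth_fun_def)
  from smooth_on_has_derivative[OF thick_pts f(1)] obtain f' where
    f': "\<And>x. x \<in> pts I \<Longrightarrow> (f has_derivative f' x) (at x within pts I)"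
    "\<And>v. smooth_on (pts I) (\<lambda>x. f' x v)" by blast
  have d: "(f has_vector_derivative f' x 1) (at x within pts I)" if "x \<in> pts I" for x
  proof -
    interpret bounded_linear "f' x" using has_derivative_bounded_linear[OF f'(1)[OF that]] .
    have "f' x h = h *\<^sub>R f' x 1" for h
      using scaleR[of h 1] by simp
    then have "f' x = (\<lambda>h. h *\<^sub>R f' x 1)" by blast
    with f'(1)[OF that] show ?thesis unfolding has_vector_derivative_def by metis
  qed
  then have eq: "D I f x = f' x 1" if "x \<in> pts I" for x using D_eqI that by metis
  show "s \<in> pts I \<Longrightarrow> (f has_vector_derivative D I f s) (at s within pts I)"
    using d eq by metis
  have "smooth_on (pts I) (D I f)"
    by (rule smooth_on_cong[OF _ f'(2)[of 1]]) (simp add: eq)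
  then show "smooth_fun I (D I f)" using descends_D f(2) by (simp add: smooth_fun_def)
qed

lemma smooth_fun_add: "smooth_fun I f \<Longrightarrow> smooth_fun I g \<Longrightarrow> smooth_fun I (\<lambda>x. f x + g x)"
  by (cases I) (auto simp: smooth_fun_def smooth_on_add)

lemma smooth_fun_mult:
  fixes f g :: "real \<Rightarrow> real"
  shows "smooth_fun I f \<Longrightarrow> smooth_fun I g \<Longrightarrow> smooth_fun I (\<lambda>x. f x * g x)"
  by (cases I) (auto simp: smooth_fun_def smooth_on_mult)

lemma smooth_fun_const: "smooth_fun I (\<lambda>x. c)"
  by (cases I) (auto simp: smooth_fun_def smooth_on_const)

lemma smooth_fun_cmult:
  fixes f :: "real \<Rightarrow> real"
  shows "smooth_fun I f \<Longrightarrow> smooth_fun I (\<lambda>x. c * f x)"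
  by (simp add: smooth_fun_mult smooth_fun_const)

lemma smooth_fun_minus:
  fixes f :: "real \<Rightarrow> real"
  shows "smooth_fun I f \<Longrightarrow> smooth_fun I (\<lambda>x. - f x)"
  using smooth_fun_cmult[of I f "-1"] by simp

lemma smooth_fun_diff:
  fixes f g :: "real \<Rightarrow> real"
  shows "smooth_fun I f \<Longrightarrow> smooth_fun I g \<Longrightarrow> smooth_fun I (\<lambda>x. f x - g x)"
  using smooth_fun_add[OF _ smooth_fun_minus[of I g], of f] by simp

lemma smooth_fun_power2:
  fixes f :: "real \<Rightarrow> real"
  shows "smooth_fun I f \<Longrightarrow> smooth_fun I (\<lambda>x. (f x)\<^sup>2)"
  by (simp add: power2_eq_square smooth_fun_mult)

lemmas smooth_fun_intros = smooth_fun_add smooth_fun_mult smooth_fun_const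
  smooth_fun_minus smooth_fun_diff smooth_fun_power2

lemma smooth_fun_cong:
  assumes "smooth_fun I f" "\<And>s. s \<in> pts I \<Longrightarrow> f s = g s"
  shows "smooth_fun I g"
  using assms smooth_on_cong[of "pts I" f g] by (cases I) (auto simp: smooth_fun_def)

text \<open>The representative \<open>r\<close> is independent of \<open>f\<close>, so one choice
  serves several functions, or one function at all times.\<close>

lemma pts_reduce:
  assumes "s \<in> pts I"
  obtains r where "r \<in> {0..1}" "\<And>f :: real \<Rightarrow> 'a. descends I f \<Longrightarrow> f s = f r"
proof (cases I)
  case Interval
  with assms that show thesis by auto
next
  case Circle
  have nat: "f (x + of_nat n) = f x" if "\<And>x. f (x + 1) = f x" for f :: "real \<Rightarrow> 'a" and x n
    by (induction n) (auto simp: that add.assoc[symmetric] add.commute[of 1])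
  have "f s = f (frac s)" if "descends I f" for f :: "real \<Rightarrow> 'a"
  proof -
    have per: "\<And>x. f (x + 1) = f x" using that Circle by simp
    show ?thesis
    proof (cases "\<lfloor>s\<rfloor> \<ge> 0")
      case True
      then have "s = frac s + of_nat (nat \<lfloor>s\<rfloor>)" by (simp add: frac_def)
      then show ?thesis using nat[of f, OF per] by metis
    next
      case False
      then have "frac s = s + of_nat (nat (- \<lfloor>s\<rfloor>))" by (simp add: frac_def)
      then show ?thesis using nat[of f, OF per] by metis
    qed
  qed
  then show thesis using that[of "frac s"] frac_ge_0[of s] frac_lt_1[of s] by (auto simp: less_imp_le)
qed

lemma Icc_subset_pts: "{0..1} \<subseteq> pts I"
  by (cases I) auto

lemma smooth_fun_continuous_on: "smooth_fun I f \<Longrightarrow> continuous_on {0..1} f"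
  using smooth_on_imp_continuous continuous_on_subset Icc_subset_pts unfolding smooth_fun_def by blast

section \<open>The linear boundary value problem and its parameters\<close>

lemma has_integral_of_deriv:
  fixes F f :: "real \<Rightarrow> real"
  assumes "\<And>s. s \<in> {0..1} \<Longrightarrow> (F has_real_derivative f s) (at s within {0..1})"
  shows "(f has_integral (F 1 - F 0)) {0..1}"
  by (rule fundamental_theorem_of_calculus)
    (use assms in \<open>auto simp: has_real_derivative_iff_has_vector_derivative\<close>)

lemma has_real_derivative_transform:
  fixes f g :: "real \<Rightarrow> real"
  assumes "x \<in> S" "\<And>y. y \<in> S \<Longrightarrow> g y = f y" "(f has_real_derivative d) (at x within S)"
  shows "(g has_real_derivative d) (at x within S)"
  using assms has_derivative_transform unfolding has_field_derivative_def by blast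

lemma continuous_on_of_deriv:
  fixes F f :: "real \<Rightarrow> real"
  assumes "\<And>s. s \<in> S \<Longrightarrow> (F has_real_derivative f s) (at s within S)"
  shows "continuous_on S F"
  using assms by (meson DERIV_continuous_on)

text \<open>The problem \<open>- a u'' + q u = f\<close> on the unit interval as a first order
  system. Keeping \<open>u'\<close> as a separate function makes solutions with different data easy
  to subtract, and equality of \<open>u\<close> and \<open>u'\<close> at both ends stands for
  periodicity, so that the estimates need no extension beyond the interval.\<close>

definition bvp ::
  "curve_domain \<Rightarrow> real \<Rightarrow> (real \<Rightarrow> real) \<Rightarrow> (real \<Rightarrow> real) \<Rightarrow> (real \<Rightarrow> real) \<Rightarrow> (real \<Rightarrow> real) \<Rightarrow> bool" where
  "bvp I a q f u u' \<longleftrightarrow>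
     (\<forall>s\<in>{0..1}. (u has_real_derivative u' s) (at s within {0..1}) \<and>
        (u' has_real_derivative (q s * u s - f s) / a) (at s within {0..1})) \<and>
     (if I = Interval then u 0 = 0 \<and> u 1 = 0 else u 0 = u 1 \<and> u' 0 = u' 1)"

lemma bvp_continuous:
  assumes "bvp I a q f u u'"
  shows "continuous_on {0..1} u" "continuous_on {0..1} u'"
  using assms by (auto simp: bvp_def intro!: continuous_on_of_deriv)

lemma bvp_diff:
  assumes "bvp I a q f u u'" "bvp I a q g w w'"
  shows "bvp I a q (\<lambda>s. f s - g s) (\<lambda>s. u s - w s) (\<lambda>s. u' s - w' s)"
  using assms unfolding bvp_def
  by (auto intro!: derivative_eq_intros simp: add_divide_distrib diff_divide_distrib algebra_simps)

lemma bvp_scale: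
  assumes "bvp I a q f u u'"
  shows "bvp I a q (\<lambda>s. c * f s) (\<lambda>s. c * u s) (\<lambda>s. c * u' s)"
  using assms unfolding bvp_def
  by (auto intro!: derivative_eq_intros simp: add_divide_distrib diff_divide_distrib algebra_simps)

text \<open>Only \<open>q u - f\<close> enters the equation, so a change of potential can be moved
  into the source: a solution for \<open>q\<close> and \<open>f\<close> is one for \<open>q'\<close>
  and \<open>f - (q - q') u\<close>. This makes solutions for different potentials
  comparable.\<close>

lemma bvp_cong:
  assumes "bvp I a q f u u'" "\<And>s. s \<in> {0..1} \<Longrightarrow> q s * u s - f s = q' s * u s - f' s"
  shows "bvp I a q' f' u u'"
  using assms unfolding bvp_def by auto

text \<open>The weak form of the equation for \<open>u\<close> with test function \<open>w\<close>.
  The boundary term \<open>a u' w\<close> vanishes at both ends in the Dirichlet case and has equal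
  values there in the periodic case.\<close>

lemma bvp_green:
  assumes "bvp I a q f u u'" "bvp I a r g w w'" "a \<noteq> 0"
  shows "((\<lambda>s. a * (u' s * w' s) + (q s * u s - f s) * w s) has_integral 0) {0..1}"
proof -
  have "((\<lambda>s. a * (u' s * w' s) + (q s * u s - f s) * w s) has_integral
      (a * u' 1 * w 1 - a * u' 0 * w 0)) {0..1}"
    by (rule has_integral_of_deriv)
      (use assms in \<open>auto simp: bvp_def intro!: derivative_eq_intros simp: field_simps\<close>)
  moreover have "a * u' 1 * w 1 - a * u' 0 * w 0 = 0"
    using assms by (auto simp: bvp_def split: if_splits)
  ultimately show ?thesis by simp
qed

text \<open>In the two Green identities the terms \<open>a u' w'\<close> and \<open>q u w\<close>
  coincide and cancel.\<close>

lemma bvp_symmetric: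
  assumes "bvp I a q f u u'" "bvp I a q g w w'" "a \<noteq> 0"
  shows "((\<lambda>s. f s * w s - g s * u s) has_integral 0) {0..1}"
proof -
  from has_integral_diff[OF bvp_green[OF assms(2,1,3)] bvp_green[OF assms]]
  show ?thesis by (simp add: algebra_simps)
qed

text \<open>Cauchy-Schwarz on an interval of length at most 1, obtained by integrating
  \<open>0 <= (u' - c)^2\<close> where \<open>c\<close> is the increment of
  \<open>u\<close>.\<close>

lemma sq_diff_le_integral_deriv:
  fixes u u' :: "real \<Rightarrow> real"
  assumes u: "\<And>s. s \<in> {0..1} \<Longrightarrow> (u has_real_derivative u' s) (at s within {0..1})"
    and cont: "continuous_on {0..1} u'" and x: "x \<in> {0..1}" and y: "y \<in> {0..1}"
  shows "(u x - u y)\<^sup>2 \<le> integral {0..1} (\<lambda>s. (u' s)\<^sup>2)"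
proof -
  have *: "(u x - u y)\<^sup>2 \<le> integral {0..1} (\<lambda>s. (u' s)\<^sup>2)"
    if xy: "x \<in> {0..1}" "y \<in> {0..1}" "y \<le> x" for x y
  proof -
    define c where "c = u x - u y"
    have sub: "{y..x} \<subseteq> {0..1}" using xy by auto
    have 1: "(u' has_integral c) {y..x}"
      unfolding c_def
      by (rule fundamental_theorem_of_calculus[OF \<open>y \<le> x\<close>])
        (use DERIV_subset[OF u sub] sub in \<open>auto simp: has_real_derivative_iff_has_vector_derivative[symmetric]\<close>)
    have int: "(\<lambda>s. (u' s)\<^sup>2) integrable_on {0..1}" "(\<lambda>s. (u' s)\<^sup>2) integrable_on {y..x}"
      using cont sub by (auto intro!: integrable_continuous_interval continuous_intros
          intro: continuous_on_subset)
    have 2: "((\<lambda>s. 2 * c * u' s - c\<^sup>2) has_integral (2 * c * c - c\<^sup>2 * (x - y))) {y..x}"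
      using has_integral_diff[OF has_integral_mult_right[OF 1, of "2 * c"]
          has_integral_const_real[of "c\<^sup>2" y x]] xy by (simp add: algebra_simps)
    have "2 * c * c - c\<^sup>2 * (x - y) \<le> integral {y..x} (\<lambda>s. (u' s)\<^sup>2)"
    proof (rule has_integral_le[OF 2 integrable_integral[OF int(2)]])
      fix s
      have "0 \<le> (u' s - c)\<^sup>2" by simp
      then show "2 * c * u' s - c\<^sup>2 \<le> (u' s)\<^sup>2" by (simp add: power2_diff algebra_simps)
    qed
    moreover have "c\<^sup>2 * (x - y) \<le> c\<^sup>2 * 1" by (rule mult_left_mono) (use xy in auto)
    moreover have "integral {y..x} (\<lambda>s. (u' s)\<^sup>2) \<le> integral {0..1} (\<lambda>s. (u' s)\<^sup>2)"
      by (rule integral_subset_le[OF sub int(2,1)]) auto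
    ultimately have "c\<^sup>2 \<le> integral {0..1} (\<lambda>s. (u' s)\<^sup>2)" by (simp add: power2_eq_square)
    then show ?thesis unfolding c_def .
  qed
  show ?thesis
  proof (cases "y \<le> x")
    case True
    then show ?thesis using *[OF x y] by simp
  next
    case False
    then show ?thesis using *[OF y x] by (simp add: power2_commute)
  qed
qed

lemma le_divide_of_quadratic:
  fixes c F M :: real
  assumes "c > 0" "c * M\<^sup>2 \<le> F * M" "F \<ge> 0" "M \<ge> 0"
  shows "M \<le> F / c"
proof (cases "M = 0")
  case False
  with assms have "(c * M) * M \<le> F * M" by (simp add: power2_eq_square algebra_simps)
  with False assms have "c * M \<le> F" by (simp add: mult_le_cancel_right)
  with assms show ?thesis by (simp add: field_simps)
qed (use assms in auto)

text \<open>If the oscillation of \<open>u\<close> is small compared to its maximum, the integral of \<open>q u\<^sup>2\<close>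
  controls the maximum, otherwise the integral of \<open>u'\<^sup>2\<close> does.\<close>

lemma bvp_bound:
  assumes sol: "bvp I a q f u u'" and a: "a > 0"
    and q: "continuous_on {0..1} q" "\<And>s. s \<in> {0..1} \<Longrightarrow> 0 \<le> q s"
    and Q: "Q > 0" "I = Circle \<Longrightarrow> Q \<le> integral {0..1} q"
    and f: "\<And>s. s \<in> {0..1} \<Longrightarrow> \<bar>f s\<bar> \<le> F"
    and s: "s \<in> {0..1}"
  shows "\<bar>u s\<bar> \<le> (4 / a + 4 / Q) * F"
proof -
  note cont = bvp_continuous[OF sol]
  obtain x where x: "x \<in> {0..1}" "\<And>y. y \<in> {0..1} \<Longrightarrow> \<bar>u y\<bar> \<le> \<bar>u x\<bar>"
    using continuous_attains_sup[of "{0..1::real}" "\<lambda>s. \<bar>u s\<bar>"] continuous_on_rabs[OF cont(1)]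
    by auto
  define M where "M = \<bar>u x\<bar>"
  define R where "R = integral {0..1} (\<lambda>s. (u' s)\<^sup>2)"
  have F: "F \<ge> 0" using f[of 0] by auto
  have M: "M \<ge> 0" by (simp add: M_def)
  have osc: "(u y - u z)\<^sup>2 \<le> R" if "y \<in> {0..1}" "z \<in> {0..1}" for y z
    unfolding R_def
    by (rule sq_diff_le_integral_deriv) (use sol cont that in \<open>auto simp: bvp_def\<close>)
  have i1: "((\<lambda>s. (u' s)\<^sup>2) has_integral R) {0..1}"
    unfolding R_def using cont
    by (intro integrable_integral integrable_continuous_interval continuous_intros)
  define S where "S = integral {0..1} (\<lambda>s. q s * (u s)\<^sup>2)"
  have i2: "((\<lambda>s. q s * (u s)\<^sup>2) has_integral S) {0..1}"
    unfolding S_def using cont q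
    by (intro integrable_integral integrable_continuous_interval continuous_intros)
  have S: "S \<ge> 0" by (rule has_integral_nonneg[OF i2]) (use q in auto)
  have "((\<lambda>s. a * (u' s)\<^sup>2 + q s * (u s)\<^sup>2) has_integral (a * R + S)) {0..1}"
    by (intro has_integral_add has_integral_mult_right i1 i2)
  then have "((\<lambda>s. (a * (u' s)\<^sup>2 + q s * (u s)\<^sup>2)
      - (a * (u' s * u' s) + (q s * u s - f s) * u s)) has_integral (a * R + S - 0)) {0..1}"
    by (intro has_integral_diff bvp_green[OF sol sol]) (use a in auto)
  then have e: "((\<lambda>s. f s * u s) has_integral (a * R + S)) {0..1}"
    by (simp add: power2_eq_square algebra_simps)
  have "a * R + S \<le> F * M * (1 - 0)"
  proof (rule has_integral_le[OF e])
    show "((\<lambda>s::real. F * M) has_integral F * M * (1 - 0)) {0..1}"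
      using has_integral_const_real[of "F * M" 0 1] by simp
    fix s :: real assume s: "s \<in> {0..1}"
    have "f s * u s \<le> \<bar>f s\<bar> * \<bar>u s\<bar>" by (simp add: abs_mult[symmetric])
    also have "\<dots> \<le> F * M" using f[OF s] x(2)[OF s] F by (intro mult_mono) (auto simp: M_def)
    finally show "f s * u s \<le> F * M" .
  qed
  then have energy: "a * R + S \<le> F * M" by simp
  \<comment> \<open>Both cases below lead to a quadratic inequality for the maximum
    \<open>M\<close>, with \<open>c = a / 4\<close> or \<open>c = Q / 4\<close>. The constant of the
    lemma is the sum of the two resulting ones.\<close>
  have bound: "M \<le> (4 / a + 4 / Q) * F" if "c * M\<^sup>2 \<le> F * M" "c = a / 4 \<or> c = Q / 4" for c
  proof -
    have "M \<le> F / c" using that a Q F M by (intro le_divide_of_quadratic) auto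
    also have "\<dots> \<le> 4 / a * F + 4 / Q * F"
      using that(2) a Q F by (auto simp: field_simps)
    finally show ?thesis by (simp add: algebra_simps)
  qed
  have "M \<le> (4 / a + 4 / Q) * F"
  proof (cases "M\<^sup>2 / 4 \<le> R")
    case True
    then have "a * (M\<^sup>2 / 4) \<le> a * R" using a by (intro mult_left_mono) auto
    with energy S have "(a / 4) * M\<^sup>2 \<le> F * M" by simp
    then show ?thesis by (rule bound) simp
  next
    case False
    have lower: "M\<^sup>2 / 4 \<le> (u y)\<^sup>2" if "y \<in> {0..1}" for y
    proof -
      have "\<bar>u x - u y\<bar>\<^sup>2 \<le> (M / 2)\<^sup>2"
        using osc[OF x(1) that] False by (simp add: power_divide)
      then have "\<bar>u x - u y\<bar> \<le> M / 2" by (rule power2_le_imp_le) (use M in simp)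
      then have "M / 2 \<le> \<bar>u y\<bar>" unfolding M_def by linarith
      then have "(M / 2)\<^sup>2 \<le> \<bar>u y\<bar>\<^sup>2" using M by (intro power_mono) auto
      then show ?thesis by (simp add: power_divide)
    qed
    show ?thesis
    proof (cases I)
      case Interval
      with sol have "u 0 = 0" by (simp add: bvp_def)
      with lower[of 0] have "M = 0" by simp
      with F a Q show ?thesis by simp
    next
      case Circle
      have qi: "(q has_integral integral {0..1} q) {0..1}"
        using q(1) by (intro integrable_integral integrable_continuous_interval)
      have "M\<^sup>2 / 4 * integral {0..1} q \<le> S"
        by (rule has_integral_le[OF has_integral_mult_right[OF qi] i2])
          (use mult_right_mono[OF lower q(2)] in \<open>simp add: mult.commute\<close>)
      moreover have "M\<^sup>2 / 4 * Q \<le> M\<^sup>2 / 4 * integral {0..1} q"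
        using Q(2)[OF Circle] by (intro mult_left_mono) auto
      moreover have "0 \<le> a * R" using a has_integral_nonneg[OF i1] by simp
      ultimately have "(Q / 4) * M\<^sup>2 \<le> F * M" using energy by (simp add: algebra_simps)
      then show ?thesis by (rule bound) simp
    qed
  qed
  with x(2)[OF s] show ?thesis by (simp add: M_def)
qed

lemma bvp_unique_zero:
  assumes sol: "bvp I a q (\<lambda>s. 0) u u'" and a: "a > 0"
    and q: "continuous_on {0..1} q" "\<And>s. s \<in> {0..1} \<Longrightarrow> 0 \<le> q s"
    and Q: "I = Circle \<Longrightarrow> 0 < integral {0..1} q" and s: "s \<in> {0..1}"
  shows "u s = 0" "u' s = 0"
proof -
  have u0: "u s = 0" if "s \<in> {0..1}" for s
  proof -
    \<comment> \<open>On the interval the bound holds for every positive \<open>Q\<close>; the value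
      1 is an arbitrary choice.\<close>
    have "\<bar>u s\<bar> \<le> (4 / a + 4 / (if I = Circle then integral {0..1} q else 1)) * 0"
      by (rule bvp_bound[OF sol a q]) (use Q that in auto)
    then show ?thesis by simp
  qed
  from u0 s show "u s = 0" by simp
  have 1: "(u has_real_derivative u' s) (at s within {0..1})" using sol s by (simp add: bvp_def)
  have 2: "(u has_real_derivative 0) (at s within {0..1})"
    by (rule has_real_derivative_transform[OF s, of _ "\<lambda>_. 0"]) (use u0 in auto)
  have "at s within {0..1} \<noteq> bot" using s by (auto simp: trivial_limit_within islimpt_Icc)
  with 1 2 show "u' s = 0" by (rule has_field_derivative_unique)
qed

lemma bvp_unique:
  assumes "bvp I a q f u u'" "bvp I a q f w w'" "a > 0"
    and q: "continuous_on {0..1} q" "\<And>s. s \<in> {0..1} \<Longrightarrow> 0 \<le> q s"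
    and Q: "I = Circle \<Longrightarrow> 0 < integral {0..1} q" and s: "s \<in> {0..1}"
  shows "u s = w s" "u' s = w' s"
proof -
  have "bvp I a q (\<lambda>s. 0) (\<lambda>s. u s - w s) (\<lambda>s. u' s - w' s)"
    using bvp_diff[OF assms(1,2)] by simp
  from bvp_unique_zero[OF this assms(3) q Q s] show "u s = w s" "u' s = w' s" by simp_all
qed

section \<open>Existence of solutions by Picard iteration and shooting\<close>

lemma integral_abs_le:
  fixes f :: "real \<Rightarrow> real"
  assumes "continuous_on {0..1} f" "x \<in> {0..1}" "\<And>y. y \<in> {0..x} \<Longrightarrow> \<bar>f y\<bar> \<le> B"
  shows "\<bar>integral {0..x} f\<bar> \<le> B * x"
  using integral_bound[of 0 x f B] assms continuous_on_subset[OF assms(1), of "{0..x}"] by auto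

text \<open>Picard iteration; the iterates are bounded by the terms of an exponential series.\<close>

lemma volterra_solution:
  fixes q g :: "real \<Rightarrow> real"
  assumes q: "continuous_on {0..1} q" and g: "continuous_on {0..1} g"
  obtains u where "continuous_on {0..1} u"
    "\<And>s. s \<in> {0..1} \<Longrightarrow> u s = g s + integral {0..s} (\<lambda>x. integral {0..x} (\<lambda>y. q y * u y))"
proof -
  define V where "V d = (\<lambda>s. integral {0..s} (\<lambda>x. integral {0..x} (\<lambda>y. q y * d y)))" for d
  define d where "d n = (V ^^ n) g" for n
  have d0: "d 0 = g" and dS: "\<And>n. d (Suc n) = V (d n)" by (simp_all add: d_def)
  have cont_int: "continuous_on {0..1} (\<lambda>x. integral {0..x} f)"
    if "continuous_on {0..1} f" for f :: "real \<Rightarrow> real"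
    using integral_has_real_derivative[OF that] by (rule continuous_on_of_deriv)
  have cq: "continuous_on {0..1} (\<lambda>x. integral {0..x} (\<lambda>y. q y * h y))"
    if "continuous_on {0..1} h" for h
    by (intro cont_int continuous_intros q that)
  have cV: "continuous_on {0..1} (V h)" if "continuous_on {0..1} h" for h
    unfolding V_def by (intro cont_int cq that)
  have cd: "continuous_on {0..1} (d n)" for n
    by (induction n) (auto simp: d0 dS g cV)
  have bdd: "\<exists>B\<ge>0. \<forall>s\<in>{0..1}. \<bar>f s\<bar> \<le> B" if "continuous_on {0..1} f" for f :: "real \<Rightarrow> real"
  proof -
    have "bounded (f ` {0..1})" by (intro compact_imp_bounded compact_continuous_image that) simp
    then show ?thesis by (auto simp: bounded_pos intro: less_imp_le)
  qed
  from bdd[OF q] obtain K where K: "K \<ge> 0" "\<And>s. s \<in> {0..1} \<Longrightarrow> \<bar>q s\<bar> \<le> K" by auto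
  from bdd[OF g] obtain C where C: "C \<ge> 0" "\<And>s. s \<in> {0..1} \<Longrightarrow> \<bar>g s\<bar> \<le> C" by auto
  have bound: "\<bar>d n s\<bar> \<le> C * K ^ n * s ^ n / fact n" if "s \<in> {0..1}" for n s
    using that
  proof (induction n arbitrary: s)
    case 0
    then show ?case by (simp add: d0 C)
  next
    case (Suc n)
    define B where "B = C * K ^ Suc n / fact n"
    have B: "B \<ge> 0" using C K by (simp add: B_def)
    have inner: "\<bar>integral {0..x} (\<lambda>y. q y * d n y)\<bar> \<le> B * x ^ Suc n / Suc n" if x: "x \<in> {0..1}" for x
    proof -
      have hi: "((\<lambda>y. B * y ^ n) has_integral B * x ^ Suc n / Suc n - B * 0 ^ Suc n / Suc n) {0..x}"
        by (rule fundamental_theorem_of_calculus)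
          (use x in \<open>auto simp: has_real_derivative_iff_has_vector_derivative[symmetric]
            intro!: derivative_eq_intros simp del: power_Suc of_nat_Suc\<close>)
      have "norm (integral {0..x} (\<lambda>y. q y * d n y)) \<le> integral {0..x} (\<lambda>y. B * y ^ n)"
      proof (rule integral_norm_bound_integral)
        show "(\<lambda>y. q y * d n y) integrable_on {0..x}"
          using x by (intro integrable_continuous_interval continuous_intros
              continuous_on_subset[OF q] continuous_on_subset[OF cd]) auto
        show "(\<lambda>y. B * y ^ n) integrable_on {0..x}"
          by (intro integrable_continuous_interval continuous_intros)
        fix y assume y: "y \<in> {0..x}"
        with x have y1: "y \<in> {0..1}" by auto
        have "\<bar>q y\<bar> * \<bar>d n y\<bar> \<le> K * (C * K ^ n * y ^ n / fact n)"
          using K(2)[OF y1] Suc.IH[OF y1] K(1) by (intro mult_mono) auto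
        then show "norm (q y * d n y) \<le> B * y ^ n" by (simp add: B_def abs_mult algebra_simps)
      qed
      with integral_unique[OF hi] show ?thesis by simp
    qed
    have "\<bar>d (Suc n) s\<bar> \<le> (B * s ^ Suc n / Suc n) * s"
      unfolding dS V_def
    proof (rule integral_abs_le[OF cq[OF cd] Suc.prems])
      fix y assume y: "y \<in> {0..s}"
      with Suc.prems have "\<bar>integral {0..y} (\<lambda>y. q y * d n y)\<bar> \<le> B * y ^ Suc n / Suc n"
        by (intro inner) auto
      also have "\<dots> \<le> B * s ^ Suc n / Suc n"
        using y B by (intro divide_right_mono mult_left_mono power_mono) auto
      finally show "\<bar>integral {0..y} (\<lambda>y. q y * d n y)\<bar> \<le> B * s ^ Suc n / Suc n" .
    qed
    \<comment> \<open>The second integration contributes a further factor \<open>s\<close>, which is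
      dropped; one power of \<open>s\<close> per step already yields the factorial.\<close>
    also have "\<dots> \<le> (B * s ^ Suc n / Suc n) * 1"
      using Suc.prems B by (intro mult_left_mono) auto
    also have "\<dots> = C * K ^ Suc n * s ^ Suc n / fact (Suc n)"
      by (simp add: B_def field_simps)
    finally show ?case .
  qed
  define u where "u s = (\<Sum>n. d n s)" for s
  define S where "S N s = (\<Sum>n<N. d n s)" for N s
  have ul: "uniform_limit {0..1} S u sequentially"
    unfolding S_def u_def
  proof (rule Weierstrass_m_test)
    fix n :: nat and s :: real assume s: "s \<in> {0..1}"
    have "C * K ^ n * s ^ n / fact n \<le> C * K ^ n * 1 / fact n"
      using s C K by (intro divide_right_mono mult_left_mono power_le_one) auto
    with bound[OF s, of n] show "norm (d n s) \<le> C * (inverse (fact n) * K ^ n)"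
      by (simp add: field_simps)
  next
    show "summable (\<lambda>n. C * (inverse (fact n) * K ^ n))"
      using summable_exp[of K] by (intro summable_mult) simp
  qed
  have cS: "continuous_on {0..1} (S N)" for N
    unfolding S_def by (intro continuous_intros cd)
  have cu: "continuous_on {0..1} u"
    by (rule uniform_limit_theorem[OF _ ul]) (auto simp: cS)
  \<comment> \<open>Integration from 0 preserves uniform convergence on the unit interval. It is
    applied twice, once for each integral in \<open>V\<close>.\<close>
  have ulI: "uniform_limit {0..1} (\<lambda>N x. integral {0..x} (h N)) (\<lambda>x. integral {0..x} h') sequentially"
    if "uniform_limit {0..1} h h' sequentially" "\<And>N. continuous_on {0..1} (h N)" "continuous_on {0..1} h'"
    for h and h' :: "real \<Rightarrow> real"
  proof (rule uniform_limitI)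
    fix e :: real assume e: "e > 0"
    then have "\<forall>\<^sub>F N in sequentially. \<forall>x\<in>{0..1}. dist (h N x) (h' x) < e / 2"
      using that(1) by (intro uniform_limitD) auto
    then show "\<forall>\<^sub>F N in sequentially. \<forall>x\<in>{0..1}. dist (integral {0..x} (h N)) (integral {0..x} h') < e"
    proof eventually_elim
      case (elim N)
      show ?case
      proof
        fix x :: real assume x: "x \<in> {0..1}"
        have i: "h N integrable_on {0..x}" "h' integrable_on {0..x}"
          using that(2)[of N] that(3) x
          by (auto intro!: integrable_continuous_interval intro: continuous_on_subset)
        have "\<bar>integral {0..x} (\<lambda>y. h N y - h' y)\<bar> \<le> e / 2 * x"
          by (rule integral_abs_le)
            (use x elim that in \<open>auto intro!: continuous_intros simp: dist_real_def less_imp_le\<close>)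
        also have "\<dots> \<le> e / 2 * 1" using x e by (intro mult_left_mono) auto
        finally show "dist (integral {0..x} (h N)) (integral {0..x} h') < e"
          using e i by (simp add: dist_real_def integral_diff)
      qed
    qed
  qed
  have ulq: "uniform_limit {0..1} (\<lambda>N y. q y * S N y) (\<lambda>y. q y * u y) sequentially"
    by (intro uniform_limit_intros ul)
      (auto intro!: compact_imp_bounded compact_continuous_image q cu)
  have ulV: "uniform_limit {0..1} (\<lambda>N. V (S N)) (V u) sequentially"
    unfolding V_def by (intro ulI ulq cq continuous_intros q cS cu)
  have Vadd: "V (\<lambda>y. h1 y + h2 y) s = V h1 s + V h2 s"
    if "continuous_on {0..1} h1" "continuous_on {0..1} h2" "s \<in> {0..1}" for h1 h2 s
  proof -
    have "integral {0..x} (\<lambda>y. q y * (h1 y + h2 y)) =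
        integral {0..x} (\<lambda>y. q y * h1 y) + integral {0..x} (\<lambda>y. q y * h2 y)" if "x \<in> {0..1}" for x
    proof -
      have "{0..x} \<subseteq> {0..1}" using that by auto
      then have "(\<lambda>y. q y * h1 y) integrable_on {0..x}" "(\<lambda>y. q y * h2 y) integrable_on {0..x}"
        using \<open>continuous_on {0..1} h1\<close> \<open>continuous_on {0..1} h2\<close> q
        by (auto intro!: integrable_continuous_interval continuous_intros intro: continuous_on_subset)
      then show ?thesis by (simp add: distrib_left integral_add)
    qed
    then have "V (\<lambda>y. h1 y + h2 y) s = integral {0..s} (\<lambda>x. integral {0..x} (\<lambda>y. q y * h1 y) +
        integral {0..x} (\<lambda>y. q y * h2 y))"
      unfolding V_def using that(3) by (intro integral_cong) auto
    also have "\<dots> = V h1 s + V h2 s"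
      unfolding V_def using that
      by (intro integral_add integrable_continuous_interval continuous_on_subset[OF cq]) auto
    finally show ?thesis .
  qed
  \<comment> \<open>The partial sums are the Picard iterates, so the limit of this recursion is the
    integral equation.\<close>
  have Srec: "S (Suc N) s = g s + V (S N) s" if "s \<in> {0..1}" for N s
  proof (induction N)
    case 0
    then show ?case by (simp add: S_def d0 V_def)
  next
    case (Suc N)
    have "S (Suc (Suc N)) s = S (Suc N) s + V (d N) s"
      by (simp add: S_def dS)
    also have "\<dots> = g s + (V (S N) s + V (d N) s)" using Suc by simp
    also have "V (S N) s + V (d N) s = V (\<lambda>y. S N y + d N y) s"
      using Vadd[OF cS cd that] by simp
    also have "(\<lambda>y. S N y + d N y) = S (Suc N)" by (simp add: S_def fun_eq_iff)
    finally show ?case .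
  qed
  have "u s = g s + V u s" if s: "s \<in> {0..1}" for s
  proof -
    have "(\<lambda>N. S (Suc N) s) \<longlonglongrightarrow> u s"
      using tendsto_uniform_limitI[OF ul s] by (rule LIMSEQ_Suc)
    moreover have "(\<lambda>N. g s + V (S N) s) \<longlonglongrightarrow> g s + V u s"
      by (intro tendsto_intros tendsto_uniform_limitI[OF ulV s])
    ultimately show ?thesis using Srec[OF s] LIMSEQ_unique by simp
  qed
  with cu show thesis by (intro that) (auto simp: V_def)
qed

text \<open>Integrating \<open>u'' = q u - g\<close> twice from 0 turns the initial value problem
  into a Volterra equation, whose inhomogeneity \<open>w\<close> collects the initial data and the
  double integral of \<open>g\<close>.\<close>

lemma linear_ivp:
  fixes q g :: "real \<Rightarrow> real"
  assumes q: "continuous_on {0..1} q" and g: "continuous_on {0..1} g"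
  obtains u u' where "u 0 = \<alpha>" "u' 0 = \<beta>"
    "\<And>s. s \<in> {0..1} \<Longrightarrow> (u has_real_derivative u' s) (at s within {0..1})"
    "\<And>s. s \<in> {0..1} \<Longrightarrow> (u' has_real_derivative q s * u s - g s) (at s within {0..1})"
proof -
  define w where "w s = \<alpha> + \<beta> * s - integral {0..s} (\<lambda>x. integral {0..x} g)" for s
  have ci: "continuous_on {0..1} (\<lambda>x. integral {0..x} f)"
    if "continuous_on {0..1} f" for f :: "real \<Rightarrow> real"
    using integral_has_real_derivative[OF that] by (rule continuous_on_of_deriv)
  have "continuous_on {0..1} w"
    unfolding w_def by (intro continuous_intros ci g)
  from volterra_solution[OF q this] obtain u where u: "continuous_on {0..1} u"
    "\<And>s. s \<in> {0..1} \<Longrightarrow> u s = w s + integral {0..s} (\<lambda>x. integral {0..x} (\<lambda>y. q y * u y))"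
    by blast
  define u' where "u' s = \<beta> - integral {0..s} g + integral {0..s} (\<lambda>y. q y * u y)" for s
  have qu: "continuous_on {0..1} (\<lambda>y. q y * u y)" by (intro continuous_intros q u)
  show thesis
  proof (rule that[of u u'])
    show "u 0 = \<alpha>" by (simp add: u w_def)
    show "u' 0 = \<beta>" by (simp add: u'_def)
    fix s :: real assume s: "s \<in> {0..1}"
    have "((\<lambda>s. \<alpha> + \<beta> * s - integral {0..s} (\<lambda>x. integral {0..x} g) +
        integral {0..s} (\<lambda>x. integral {0..x} (\<lambda>y. q y * u y))) has_real_derivative u' s) (at s within {0..1})"
      unfolding u'_def
      by (rule derivative_eq_intros integral_has_real_derivative[OF ci[OF g] s]
          integral_has_real_derivative[OF ci[OF qu] s] | simp)+
    then show "(u has_real_derivative u' s) (at s within {0..1})"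
      by (rule has_real_derivative_transform[OF s, rotated]) (simp add: u w_def)
    show "(u' has_real_derivative q s * u s - g s) (at s within {0..1})"
      unfolding u'_def
      by (rule derivative_eq_intros integral_has_real_derivative[OF g s]
          integral_has_real_derivative[OF qu s] | simp)+
  qed
qed

text \<open>Shooting: the boundary conditions are linear equations for the coefficients of two
  fundamental solutions \<open>y\<close> and \<open>z\<close>, added to the solution
  \<open>p\<close> with zero initial data. Uniqueness for the homogeneous problem makes these
  equations solvable.\<close>

lemma bvp_exists:
  assumes a: "a > 0" and f: "continuous_on {0..1} f"
    and q: "continuous_on {0..1} q" "\<And>s. s \<in> {0..1} \<Longrightarrow> 0 \<le> q s"
    and Q: "I = Circle \<Longrightarrow> 0 < integral {0..1} q"
  obtains u u' where "bvp I a q f u u'"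
proof -
  have qa: "continuous_on {0..1} (\<lambda>s. q s / a)" and fa: "continuous_on {0..1} (\<lambda>s. f s / a)"
    using a by (auto intro!: continuous_intros f q)
  obtain y y' where y: "y 0 = 1" "y' 0 = 0"
    "\<And>s. s \<in> {0..1} \<Longrightarrow> (y has_real_derivative y' s) (at s within {0..1})"
    "\<And>s. s \<in> {0..1} \<Longrightarrow> (y' has_real_derivative q s / a * y s - 0) (at s within {0..1})"
    by (rule linear_ivp[OF qa continuous_on_const[of _ 0], of 1 0]) blast
  obtain z z' where z: "z 0 = 0" "z' 0 = 1"
    "\<And>s. s \<in> {0..1} \<Longrightarrow> (z has_real_derivative z' s) (at s within {0..1})"
    "\<And>s. s \<in> {0..1} \<Longrightarrow> (z' has_real_derivative q s / a * z s - 0) (at s within {0..1})"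
    by (rule linear_ivp[OF qa continuous_on_const[of _ 0], of 0 1]) blast
  obtain p p' where p: "p 0 = 0" "p' 0 = 0"
    "\<And>s. s \<in> {0..1} \<Longrightarrow> (p has_real_derivative p' s) (at s within {0..1})"
    "\<And>s. s \<in> {0..1} \<Longrightarrow> (p' has_real_derivative q s / a * p s - f s / a) (at s within {0..1})"
    by (rule linear_ivp[OF qa fa, of 0 0]) blast
  define hom where "hom c d s = c * y s + d * z s" for c d s
  define hom' where "hom' c d s = c * y' s + d * z' s" for c d s
  have hom_deriv: "(hom c d has_real_derivative hom' c d s) (at s within {0..1})"
    "(hom' c d has_real_derivative (q s * hom c d s) / a) (at s within {0..1})"
    if "s \<in> {0..1}" for c d s
    unfolding hom_def[abs_def] hom'_def[abs_def]
    using y(3,4)[OF that] z(3,4)[OF that]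
    by (auto intro!: derivative_eq_intros simp: add_divide_distrib algebra_simps)
  have hom0: "c = 0 \<and> d = 0"
    if "if I = Interval then hom c d 0 = 0 \<and> hom c d 1 = 0
        else hom c d 0 = hom c d 1 \<and> hom' c d 0 = hom' c d 1" for c d
  proof -
    have "bvp I a q (\<lambda>s. 0) (hom c d) (hom' c d)"
      using hom_deriv that by (simp add: bvp_def)
    from bvp_unique_zero[OF this a q Q, of 0] show ?thesis
      by (simp add: hom_def hom'_def y z)
  qed
  have sum_deriv: "((\<lambda>s. p s + hom c d s) has_real_derivative p' s + hom' c d s) (at s within {0..1})"
    "((\<lambda>s. p' s + hom' c d s) has_real_derivative (q s * (p s + hom c d s) - f s) / a) (at s within {0..1})"
    if "s \<in> {0..1}" for c d s
    using p(3,4)[OF that] hom_deriv[OF that, of c d]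
    by (auto intro!: derivative_eq_intros simp: add_divide_distrib diff_divide_distrib algebra_simps)
  show thesis
  proof (cases "I = Interval")
    case True
    have "z 1 \<noteq> 0" using hom0[of 0 1] True by (auto simp: hom_def z)
    then have "p 0 + hom 0 (- p 1 / z 1) 0 = 0" "p 1 + hom 0 (- p 1 / z 1) 1 = 0"
      by (simp_all add: hom_def z p)
    with True have "bvp I a q f (\<lambda>s. p s + hom 0 (- p 1 / z 1) s) (\<lambda>s. p' s + hom' 0 (- p 1 / z 1) s)"
      unfolding bvp_def by (simp add: sum_deriv)
    then show thesis by (rule that)
  next
    case False
    define A B C E where "A = y 1 - 1" "B = z 1" "C = y' 1" "E = z' 1 - 1"
    have ker: "c = 0 \<and> d = 0" if "A * c + B * d = 0" "C * c + E * d = 0" for c d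
      using hom0[of c d] that False
      by (simp add: hom_def hom'_def y z A_B_C_E_def algebra_simps)
    define \<Delta> where "\<Delta> = A * E - B * C"
    have "\<Delta> \<noteq> 0"
    proof
      assume "\<Delta> = 0"
      then have "A * E = B * C" by (simp add: \<Delta>_def)
      \<comment> \<open>If the determinant vanishes, \<open>(B, - A)\<close> and
        \<open>(E, - C)\<close> lie in the kernel. Then all four entries are 0 and the kernel also
        contains \<open>(1, 0)\<close>.\<close>
      then have "B = 0 \<and> - A = 0" "E = 0 \<and> - C = 0"
        by (intro ker; simp add: algebra_simps)+
      then show False using ker[of 1 0] by simp
    qed
    \<comment> \<open>Cramer's rule for the right hand side \<open>(- p 1, - p' 1)\<close>.\<close>
    define c d where "c = (B * p' 1 - E * p 1) / \<Delta>" "d = (C * p 1 - A * p' 1) / \<Delta>"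
    have "A * c + B * d = (A * (B * p' 1 - E * p 1) + B * (C * p 1 - A * p' 1)) / \<Delta>"
      "C * c + E * d = (C * (B * p' 1 - E * p 1) + E * (C * p 1 - A * p' 1)) / \<Delta>"
      by (simp_all add: c_d_def add_divide_distrib)
    then have "A * c + B * d = (- \<Delta> * p 1) / \<Delta>" "C * c + E * d = (- \<Delta> * p' 1) / \<Delta>"
      by (simp_all add: \<Delta>_def algebra_simps)
    with \<open>\<Delta> \<noteq> 0\<close> have cd: "A * c + B * d = - p 1" "C * c + E * d = - p' 1" by simp_all
    have "p 0 + hom c d 0 = p 1 + hom c d 1" "p' 0 + hom' c d 0 = p' 1 + hom' c d 1"
      using cd by (simp_all add: hom_def hom'_def y z p A_B_C_E_def algebra_simps)
    with False have "bvp I a q f (\<lambda>s. p s + hom c d s) (\<lambda>s. p' s + hom' c d s)"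
      unfolding bvp_def by (simp add: sum_deriv)
    then show thesis by (rule that)
  qed
qed

section \<open>Continuous and differentiable dependence of solutions on parameters\<close>

lemma unif_continuous_slices:
  fixes g :: "'p::metric_space \<Rightarrow> real \<Rightarrow> real"
  assumes "compact P" "continuous_on (P \<times> {0..1}) (\<lambda>(p, s). g p s)" "e > 0"
  obtains d where "d > 0"
    "\<And>p p' s. p \<in> P \<Longrightarrow> p' \<in> P \<Longrightarrow> dist p' p < d \<Longrightarrow> s \<in> {0..1} \<Longrightarrow> \<bar>g p' s - g p s\<bar> < e"
proof -
  have "uniformly_continuous_on (P \<times> {0..1}) (\<lambda>(p, s). g p s)"
    using assms by (intro compact_uniformly_continuous compact_Times) auto
  with assms(3) obtain d where d: "d > 0"
    "\<And>x x'. x \<in> P \<times> {0..1} \<Longrightarrow> x' \<in> P \<times> {0..1} \<Longrightarrow> dist x' x < d \<Longrightarrow>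
      dist ((\<lambda>(p, s). g p s) x') ((\<lambda>(p, s). g p s) x) < e"
    unfolding uniformly_continuous_on_def by metis
  show thesis
  proof (rule that[OF d(1)])
    fix p p' s assume "p \<in> P" "p' \<in> P" "dist p' p < d" "s \<in> {0..1::real}"
    then show "\<bar>g p' s - g p s\<bar> < e"
      using d(2)[of "(p, s)" "(p', s)"] by (simp add: dist_Pair_Pair dist_real_def)
  qed
qed

lemma bounded_slices:
  fixes g :: "'p::metric_space \<Rightarrow> real \<Rightarrow> real"
  assumes "compact P" "continuous_on (P \<times> {0..1}) (\<lambda>(p, s). g p s)"
  obtains B where "B > 0" "\<And>p s. p \<in> P \<Longrightarrow> s \<in> {0..1} \<Longrightarrow> \<bar>g p s\<bar> \<le> B"
proof -
  have "bounded ((\<lambda>(p, s). g p s) ` (P \<times> {0..1}))"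
    using assms by (intro compact_imp_bounded compact_continuous_image compact_Times) auto
  then obtain B where "B > 0" "\<forall>x\<in>P \<times> {0..1}. norm ((\<lambda>(p, s). g p s) x) \<le> B"
    by (auto simp: bounded_pos)
  then show thesis by (intro that[of B]) auto
qed

lemma continuous_on_slice:
  assumes "continuous_on (P \<times> S) (\<lambda>(p, s). g p s)" "p \<in> P"
  shows "continuous_on S (g p)"
proof -
  have "continuous_on S (\<lambda>s. (p, s))" by (intro continuous_intros)
  from continuous_on_compose2[OF assms(1) this] assms(2) show ?thesis by auto
qed

text \<open>The difference \<open>u p' - u p\<close> solves the problem with potential
  \<open>q p'\<close> and source \<open>f p' - f p + (q p - q p') u p\<close>. By compactness this
  source is uniformly small, and the constant in the bound is the same for all parameters.
  Parameters in a metric space allow pairs \<open>(e, t)\<close> later on.\<close>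

lemma bvp_continuous_param:
  fixes q f u u' :: "'p::metric_space \<Rightarrow> real \<Rightarrow> real"
  assumes a: "a > 0" and P: "compact P"
    and q: "continuous_on (P \<times> {0..1}) (\<lambda>(p, s). q p s)" "\<And>p s. p \<in> P \<Longrightarrow> s \<in> {0..1} \<Longrightarrow> 0 \<le> q p s"
    and f: "continuous_on (P \<times> {0..1}) (\<lambda>(p, s). f p s)"
    and Q: "Q > 0" "\<And>p. p \<in> P \<Longrightarrow> I = Circle \<Longrightarrow> Q \<le> integral {0..1} (q p)"
    and sol: "\<And>p. p \<in> P \<Longrightarrow> bvp I a (q p) (f p) (u p) (u' p)"
  shows "continuous_on (P \<times> {0..1}) (\<lambda>(p, s). u p s)"
proof -
  define C where "C = 4 / a + 4 / Q"
  have C: "C > 0" using a Q by (simp add: C_def add_pos_pos)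
  obtain F where F: "F > 0" "\<And>p s. p \<in> P \<Longrightarrow> s \<in> {0..1} \<Longrightarrow> \<bar>f p s\<bar> \<le> F"
    by (rule bounded_slices[OF P f]) blast
  have U: "\<bar>u p s\<bar> \<le> C * F" if "p \<in> P" "s \<in> {0..1}" for p s
    unfolding C_def
    by (rule bvp_bound[OF sol[OF that(1)] a]) (use that q Q F continuous_on_slice[OF q(1)] in auto)
  have "\<exists>d>0. \<forall>x'\<in>P \<times> {0..1}. dist x' (p, s) < d \<longrightarrow> dist ((\<lambda>(p, s). u p s) x') (u p s) < e"
    if p: "p \<in> P" and s: "s \<in> {0..1}" and e: "e > 0" for p s e
  proof -
    \<comment> \<open>\<open>C * F\<close> bounds all solutions. This choice makes the change in the
      parameter cost \<open>e / 2\<close>; the other half is spent on continuity in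
      \<open>s\<close>.\<close>
    define \<eta> where "\<eta> = e / 2 / (C * (1 + C * F))"
    have \<eta>: "\<eta> > 0" using e C F by (simp add: \<eta>_def add_pos_pos)
    obtain d1 where d1: "d1 > 0" "\<And>p p' s. p \<in> P \<Longrightarrow> p' \<in> P \<Longrightarrow> dist p' p < d1 \<Longrightarrow> s \<in> {0..1} \<Longrightarrow>
        \<bar>q p' s - q p s\<bar> < \<eta>" by (rule unif_continuous_slices[OF P q(1) \<eta>]) blast
    obtain d2 where d2: "d2 > 0" "\<And>p p' s. p \<in> P \<Longrightarrow> p' \<in> P \<Longrightarrow> dist p' p < d2 \<Longrightarrow> s \<in> {0..1} \<Longrightarrow>
        \<bar>f p' s - f p s\<bar> < \<eta>" by (rule unif_continuous_slices[OF P f \<eta>]) blast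
    from bvp_continuous(1)[OF sol[OF p]] s e obtain d3 where d3: "d3 > 0"
      "\<And>s'. s' \<in> {0..1} \<Longrightarrow> dist s' s < d3 \<Longrightarrow> dist (u p s') (u p s) < e / 2"
      unfolding continuous_on_iff by (meson half_gt_zero)
    have "dist (u p' s') (u p s) < e"
      if p': "p' \<in> P" "s' \<in> {0..1}" and dist: "dist (p', s') (p, s) < min d1 (min d2 d3)" for p' s'
    proof -
      have dp: "dist p' p < d1" "dist p' p < d2" "dist s' s < d3"
        using dist dist_fst_le[of "(p', s')" "(p, s)"] dist_snd_le[of "(p', s')" "(p, s)"] by auto
      have "bvp I a (q p') (\<lambda>s. f p s - (q p s - q p' s) * u p s) (u p) (u' p)"
        by (rule bvp_cong[OF sol[OF p]]) (simp add: algebra_simps)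
      from bvp_diff[OF sol[OF p'(1)] this]
      have "\<bar>u p' s' - u p s'\<bar> \<le> (4 / a + 4 / Q) * (\<eta> * (1 + C * F))"
      proof (rule bvp_bound)
        fix x :: real assume x: "x \<in> {0..1}"
        have "\<bar>(q p x - q p' x) * u p x\<bar> \<le> \<eta> * (C * F)"
          unfolding abs_mult using d1(2)[OF p'(1) p _ x] dp(1) U[OF p x] \<eta>
          by (intro mult_mono) (auto simp: dist_commute)
        moreover have "\<bar>f p' x - f p x\<bar> \<le> \<eta>" using d2(2)[OF p p'(1) _ x] dp by auto
        ultimately show "\<bar>f p' x - (f p x - (q p x - q p' x) * u p x)\<bar> \<le> \<eta> * (1 + C * F)"
          by (simp add: algebra_simps)
      qed (use a p' q Q continuous_on_slice[OF q(1)] in auto)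
      also have "\<dots> = e / 2"
        unfolding C_def[symmetric] \<eta>_def using C F by (simp add: add_pos_pos less_imp_neq[symmetric])
      finally show ?thesis using d3(2)[OF p'(2) dp(3)] unfolding dist_real_def by linarith
    qed
    with d1(1) d2(1) d3(1) show ?thesis
      by (intro exI[of _ "min d1 (min d2 d3)"]) auto
  qed
  then show ?thesis unfolding continuous_on_iff by auto
qed

text \<open>The mean value inequality for \<open>g x s - x * g' p s\<close>, whose derivative in
  \<open>x\<close> is small near \<open>p\<close> by uniform continuity of
  \<open>g'\<close>.\<close>

lemma unif_difference_quotient:
  fixes g g' :: "real \<Rightarrow> real \<Rightarrow> real"
  assumes "continuous_on ({l..r} \<times> {0..1}) (\<lambda>(p, s). g' p s)" "e > 0"
    and g: "\<And>p s. p \<in> {l..r} \<Longrightarrow> s \<in> {0..1} \<Longrightarrow> ((\<lambda>p. g p s) has_real_derivative g' p s) (at p within {l..r})"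
  obtains d where "d > 0"
    "\<And>p p' s. p \<in> {l..r} \<Longrightarrow> p' \<in> {l..r} \<Longrightarrow> p' \<noteq> p \<Longrightarrow> dist p' p < d \<Longrightarrow> s \<in> {0..1} \<Longrightarrow>
      \<bar>(g p' s - g p s) / (p' - p) - g' p s\<bar> \<le> e"
proof -
  obtain d where d: "d > 0" "\<And>p p' s. p \<in> {l..r} \<Longrightarrow> p' \<in> {l..r} \<Longrightarrow> dist p' p < d \<Longrightarrow> s \<in> {0..1} \<Longrightarrow>
      \<bar>g' p' s - g' p s\<bar> < e" by (rule unif_continuous_slices[OF compact_Icc assms(1,2)]) blast
  show thesis
  proof (rule that[OF d(1)])
    fix p p' s assume p: "p \<in> {l..r}" "p' \<in> {l..r}" "p' \<noteq> p" "dist p' p < d" and s: "s \<in> {0..1::real}"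
    define X where "X = {l..r} \<inter> ball p d"
    have "norm ((g p' s - p' * g' p s) - (g p s - p * g' p s)) \<le> e * norm (p' - p)"
    proof (rule field_differentiable_bound[where f = "\<lambda>x. g x s - x * g' p s" and f' = "\<lambda>x. g' x s - g' p s" and S = X])
      show "convex X" unfolding X_def by (intro convex_Int convex_ball) simp
      fix x assume x: "x \<in> X"
      then have "((\<lambda>p. g p s) has_real_derivative g' x s) (at x within X)"
        using g[of x s] s by (auto simp: X_def intro: DERIV_subset)
      then show "((\<lambda>x. g x s - x * g' p s) has_real_derivative g' x s - g' p s) (at x within X)"
        by (auto intro!: derivative_eq_intros)
      show "norm (g' x s - g' p s) \<le> e"
        using x d(2)[OF p(1) _ _ s, of x] by (auto simp: X_def dist_commute less_imp_le)
    qed (use p d in \<open>auto simp: X_def dist_commute\<close>)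
    moreover have "(g p' s - g p s) / (p' - p) - g' p s =
        ((g p' s - p' * g' p s) - (g p s - p * g' p s)) / (p' - p)"
      using p(3) by (simp add: field_simps)
    ultimately show "\<bar>(g p' s - g p s) / (p' - p) - g' p s\<bar> \<le> e"
      using p(3) by (simp add: pos_divide_le_eq)
  qed
qed

text \<open>\<open>v\<close> solves the formally differentiated problem. The difference quotient of
  \<open>u\<close> minus \<open>v p\<close> solves the problem with potential \<open>q p\<close> and
  a source that tends to 0 uniformly, so \<open>bvp_bound\<close> gives convergence.\<close>

lemma bvp_differentiable_param:
  fixes q f u u' v v' :: "real \<Rightarrow> real \<Rightarrow> real"
  assumes a: "a > 0"
    and q: "continuous_on ({l..r} \<times> {0..1}) (\<lambda>(p, s). q p s)"
      "\<And>p s. p \<in> {l..r} \<Longrightarrow> s \<in> {0..1} \<Longrightarrow> 0 \<le> q p s"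
    and f: "continuous_on ({l..r} \<times> {0..1}) (\<lambda>(p, s). f p s)"
    and qd: "continuous_on ({l..r} \<times> {0..1}) (\<lambda>(p, s). qd p s)"
      "\<And>p s. p \<in> {l..r} \<Longrightarrow> s \<in> {0..1} \<Longrightarrow> ((\<lambda>p. q p s) has_real_derivative qd p s) (at p within {l..r})"
    and fd: "continuous_on ({l..r} \<times> {0..1}) (\<lambda>(p, s). fd p s)"
      "\<And>p s. p \<in> {l..r} \<Longrightarrow> s \<in> {0..1} \<Longrightarrow> ((\<lambda>p. f p s) has_real_derivative fd p s) (at p within {l..r})"
    and Q: "Q > 0" "\<And>p. p \<in> {l..r} \<Longrightarrow> I = Circle \<Longrightarrow> Q \<le> integral {0..1} (q p)"
    and u: "\<And>p. p \<in> {l..r} \<Longrightarrow> bvp I a (q p) (f p) (u p) (u' p)"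
    and v: "\<And>p. p \<in> {l..r} \<Longrightarrow> bvp I a (q p) (\<lambda>s. fd p s - qd p s * u p s) (v p) (v' p)"
    and p: "p \<in> {l..r}" and s: "s \<in> {0..1}"
  shows "((\<lambda>p. u p s) has_real_derivative v p s) (at p within {l..r})"
proof -
  have cu: "continuous_on ({l..r} \<times> {0..1}) (\<lambda>(p, s). u p s)"
    by (rule bvp_continuous_param[OF a compact_Icc q f Q u])
  define C where "C = 4 / a + 4 / Q"
  have C: "C > 0" using a Q by (simp add: C_def add_pos_pos)
  obtain U where U: "U > 0" "\<And>p s. p \<in> {l..r} \<Longrightarrow> s \<in> {0..1} \<Longrightarrow> \<bar>u p s\<bar> \<le> U"
    by (rule bounded_slices[OF compact_Icc cu]) blast
  obtain K where K: "K > 0" "\<And>p s. p \<in> {l..r} \<Longrightarrow> s \<in> {0..1} \<Longrightarrow> \<bar>qd p s\<bar> \<le> K"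
    by (rule bounded_slices[OF compact_Icc qd(1)]) blast
  have "\<forall>\<^sub>F p' in at p within {l..r}. dist ((u p' s - u p s) / (p' - p)) (v p s) < e" if e: "e > 0" for e
  proof -
    define \<eta> where "\<eta> = e / 2 / (C * (1 + U + K))"
    have pos: "1 + U + K > 0" using U K by simp
    have \<eta>: "\<eta> > 0" using e C pos by (simp add: \<eta>_def)
    obtain d1 where d1: "d1 > 0" "\<And>p p' s. p \<in> {l..r} \<Longrightarrow> p' \<in> {l..r} \<Longrightarrow> p' \<noteq> p \<Longrightarrow> dist p' p < d1 \<Longrightarrow>
        s \<in> {0..1} \<Longrightarrow> \<bar>(q p' s - q p s) / (p' - p) - qd p s\<bar> \<le> \<eta>"
      by (rule unif_difference_quotient[OF qd(1) \<eta> qd(2)]) blast+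
    obtain d2 where d2: "d2 > 0" "\<And>p p' s. p \<in> {l..r} \<Longrightarrow> p' \<in> {l..r} \<Longrightarrow> p' \<noteq> p \<Longrightarrow> dist p' p < d2 \<Longrightarrow>
        s \<in> {0..1} \<Longrightarrow> \<bar>(f p' s - f p s) / (p' - p) - fd p s\<bar> \<le> \<eta>"
      by (rule unif_difference_quotient[OF fd(1) \<eta> fd(2)]) blast+
    obtain d3 where d3: "d3 > 0" "\<And>p p' s. p \<in> {l..r} \<Longrightarrow> p' \<in> {l..r} \<Longrightarrow> dist p' p < d3 \<Longrightarrow> s \<in> {0..1} \<Longrightarrow>
        \<bar>u p' s - u p s\<bar> < \<eta>" by (rule unif_continuous_slices[OF compact_Icc cu \<eta>]) blast
    have "dist ((u p' s - u p s) / (p' - p)) (v p s) < e"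
      if p': "p' \<in> {l..r}" "p' \<noteq> p" "dist p' p < min d1 (min d2 d3)" for p'
    proof -
      define h where "h = p' - p"
      have h: "h \<noteq> 0" using p' by (simp add: h_def)
      have "bvp I a (q p) (\<lambda>s. f p' s - (q p' s - q p s) * u p' s) (u p') (u' p')"
        by (rule bvp_cong[OF u[OF p'(1)]]) (simp add: algebra_simps)
      from bvp_diff[OF bvp_scale[OF bvp_diff[OF this u[OF p]], of "1 / h"] v[OF p]]
      have "\<bar>1 / h * (u p' s - u p s) - v p s\<bar> \<le> (4 / a + 4 / Q) * (\<eta> * (1 + U + K))"
      proof (rule bvp_bound)
        fix x :: real assume x: "x \<in> {0..1}"
        have 1: "\<bar>(f p' x - f p x) / h - fd p x\<bar> \<le> \<eta>"
          unfolding h_def using d2(2)[OF p p'(1,2) _ x] p'(3) by simp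
        have 2: "\<bar>((q p' x - q p x) / h - qd p x) * u p' x\<bar> \<le> \<eta> * U"
          unfolding abs_mult h_def using d1(2)[OF p p'(1,2) _ x] p'(3) U(2)[OF p'(1) x] \<eta>
          by (intro mult_mono) auto
        have 3: "\<bar>qd p x * (u p' x - u p x)\<bar> \<le> K * \<eta>"
          unfolding abs_mult using K(2)[OF p x] d3(2)[OF p p'(1) _ x] p'(3) K(1)
          by (intro mult_mono) auto
        \<comment> \<open>Three errors: the difference quotient of \<open>f\<close>, that of
          \<open>q\<close>, and the replacement of \<open>u p\<close> by \<open>u p'\<close>. The
          last one is where the continuity in the parameter enters.\<close>
        have "1 / h * (f p' x - (q p' x - q p x) * u p' x - f p x) - (fd p x - qd p x * u p x) =
          ((f p' x - f p x) / h - fd p x) - ((q p' x - q p x) / h - qd p x) * u p' x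
            - qd p x * (u p' x - u p x)"
          using h by (simp add: field_simps)
        also have "\<bar>\<dots>\<bar> \<le> \<eta> + \<eta> * U + K * \<eta>" using 1 2 3 by linarith
        finally show "\<bar>1 / h * (f p' x - (q p' x - q p x) * u p' x - f p x) - (fd p x - qd p x * u p x)\<bar>
            \<le> \<eta> * (1 + U + K)" by (simp add: algebra_simps)
      qed (use a p q Q s continuous_on_slice[OF q(1)] in auto)
      also have "\<dots> = e / 2"
        unfolding C_def[symmetric] \<eta>_def using C pos by simp
      finally show ?thesis using e by (simp add: dist_real_def h_def)
    qed
    with d1(1) d2(1) d3(1) show ?thesis
      unfolding eventually_at by (intro exI[of _ "min d1 (min d2 d3)"]) auto
  qed
  then show ?thesis
    unfolding has_field_derivative_iff by (intro tendstoI)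
qed

section \<open>Smooth and periodic extension of solutions\<close>

lemma deriv_from_unit_intervals:
  fixes p :: "real \<Rightarrow> real"
  assumes "\<And>(n::int) x. x \<in> {of_int n..of_int n + 1} \<Longrightarrow>
    (p has_real_derivative p' x) (at x within {of_int n..of_int n + 1})"
  shows "(p has_real_derivative p' x) (at x)"
proof -
  define n where "n = \<lfloor>x\<rfloor>"
  have n: "of_int n \<le> x" "x < of_int n + 1" by (auto simp: n_def)
  have "(p has_real_derivative p' x) (at x within {of_int n - 1..of_int n} \<union> {of_int n..of_int n + 1})"
  proof (cases "x = of_int n")
    \<comment> \<open>At an integer the one-sided derivatives from the two adjacent unit intervals
      agree and glue to a two-sided one.\<close>
    case True
    have 1: "(p has_real_derivative p' x) (at x within {of_int (n - 1)..of_int (n - 1) + 1})"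
      by (rule assms) (use True in simp)
    have "(p has_real_derivative p' x) (at x within {of_int n..of_int n + 1})"
      by (rule assms) (use n in simp)
    with 1 show ?thesis
      unfolding has_field_derivative_iff by (intro Lim_Un) simp_all
  next
    case False
    have "(p has_real_derivative p' x) (at x within {of_int n..of_int n + 1})"
      by (rule assms) (use n in simp)
    moreover have "at x within {of_int n..of_int n + 1} = at x"
      by (rule at_within_Icc_at) (use n False in auto)
    ultimately show ?thesis by (simp add: has_field_derivative_at_within)
  qed
  moreover have "{of_int n - 1..of_int n} \<union> {of_int n..of_int n + 1} = {of_int n - 1..of_int n + (1::real)}"
    by auto
  moreover have "at x within {of_int n - 1..of_int n + 1} = at x"
    by (rule at_within_Icc_at) (use n in auto)
  ultimately show ?thesis by simp
qed

text \<open>On the circle the extension is \<open>u (frac s)\<close>. The boundary conditions match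
  \<open>u\<close> and \<open>u'\<close> at the integers, and the equation with periodic
  coefficients then matches the second derivative.\<close>

lemma bvp_extend:
  assumes sol: "bvp I a q f u u'" and q: "smooth_fun I q" and f: "smooth_fun I f"
  obtains p p' where "\<And>s. s \<in> {0..1} \<Longrightarrow> p s = u s" "\<And>s. s \<in> {0..1} \<Longrightarrow> p' s = u' s"
    "smooth_fun I p" "smooth_fun I p'"
    "\<And>s. s \<in> pts I \<Longrightarrow> (p has_real_derivative p' s) (at s within pts I)"
    "\<And>s. s \<in> pts I \<Longrightarrow> (p' has_real_derivative (q s * p s - f s) / a) (at s within pts I)"
proof -
  have "\<exists>p p'. (\<forall>s\<in>{0..1}. p s = u s) \<and> (\<forall>s\<in>{0..1}. p' s = u' s) \<and> descends I p \<and> descends I p' \<and>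
    (\<forall>s\<in>pts I. (p has_real_derivative p' s) (at s within pts I)) \<and>
    (\<forall>s\<in>pts I. (p' has_real_derivative (q s * p s - f s) / a) (at s within pts I))"
  proof (cases I)
    case Interval
    with sol show ?thesis by (intro exI[of _ u] exI[of _ u']) (auto simp: bvp_def)
  next
    case Circle
    have bc: "u 0 = u 1" "u' 0 = u' 1" using sol Circle by (auto simp: bvp_def)
    have per: "(\<lambda>s. g (frac s)) x = g (x - of_int n)"
      if "g 0 = g 1" "x \<in> {of_int n..of_int n + 1}" for g :: "real \<Rightarrow> real" and n x
    proof (cases "x = of_int n + 1")
      case True
      then have "frac x = 0" by simp
      with True that show ?thesis by simp
    next
      case False
      with that have "\<lfloor>x\<rfloor> = n" by (intro floor_unique) auto
      then show ?thesis by (simp add: frac_def)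
    qed
    have deriv: "((\<lambda>s. g (frac s)) has_real_derivative g' (frac x)) (at x)"
      if g: "\<And>s. s \<in> {0..1} \<Longrightarrow> (g has_real_derivative g' s) (at s within {0..1})"
        and bd: "g 0 = g 1" "g' 0 = g' 1" for g g' :: "real \<Rightarrow> real" and x
    proof (rule deriv_from_unit_intervals)
      fix n :: int and x :: real assume x: "x \<in> {of_int n..of_int n + 1}"
      have "(g has_real_derivative g' (x - of_int n)) (at (x - of_int n) within (\<lambda>x. x - of_int n) ` {of_int n..of_int n + 1})"
        using g[of "x - of_int n"] x by (auto elim!: DERIV_subset)
      then have "((\<lambda>x. g (x - of_int n)) has_real_derivative g' (x - of_int n) * 1) (at x within {of_int n..of_int n + 1})"
        by (rule DERIV_image_chain[where g = "\<lambda>x. x - of_int n", unfolded o_def]) (auto intro!: derivative_eq_intros)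
      then have "((\<lambda>x. g (x - of_int n)) has_real_derivative g' (frac x)) (at x within {of_int n..of_int n + 1})"
        using per[OF bd(2) x] by simp
      then show "((\<lambda>s. g (frac s)) has_real_derivative g' (frac x)) (at x within {of_int n..of_int n + 1})"
        by (rule has_real_derivative_transform[OF x, rotated]) (use per[OF bd(1)] in simp)
    qed
    have qf: "g (frac x) = g x" if "smooth_fun I g" for g :: "real \<Rightarrow> real" and x
    proof -
      have "g (y + 1) = g y" for y using that Circle by (simp add: smooth_fun_def)
      then have "g (y + of_nat n) = g y" for y n
        by (induction n) (auto simp: add.assoc[symmetric] add.commute[of 1])
      moreover have "x = frac x + of_nat (nat \<lfloor>x\<rfloor>) \<or> frac x = x + of_nat (nat (- \<lfloor>x\<rfloor>))"
        by (auto simp: frac_def)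
      ultimately show ?thesis by metis
    qed
    \<comment> \<open>The second derivative has equal values at 0 and 1, because \<open>q\<close>,
      \<open>f\<close> and \<open>u\<close> do.\<close>
    have "((\<lambda>s. u' (frac s)) has_real_derivative (q (frac x) * u (frac x) - f (frac x)) / a) (at x)" for x
      by (rule deriv[where g = u' and g' = "\<lambda>s. (q s * u s - f s) / a"])
        (use sol bc qf[OF q, of 1] qf[OF f, of 1] in \<open>auto simp: bvp_def\<close>)
    then have 2: "((\<lambda>s. u' (frac s)) has_real_derivative (q x * u (frac x) - f x) / a) (at x)" for x
      using qf[OF q] qf[OF f] by simp
    have 1: "((\<lambda>s. u (frac s)) has_real_derivative u' (frac x)) (at x)" for x
      by (rule deriv) (use sol bc in \<open>auto simp: bvp_def\<close>)
    have 3: "g (frac x) = g x" if "g 0 = g 1" "x \<in> {0..1}" for g :: "real \<Rightarrow> real" and x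
      using per[of g x 0] that by simp
    show ?thesis
      by (intro exI[of _ "\<lambda>s. u (frac s)"] exI[of _ "\<lambda>s. u' (frac s)"])
        (use 1 2 3 bc Circle in \<open>auto simp: frac_1_eq\<close>)
  qed
  then obtain p p' where p: "\<forall>s\<in>{0..1}. p s = u s" "\<forall>s\<in>{0..1}. p' s = u' s" "descends I p" "descends I p'"
    "\<And>s. s\<in>pts I \<Longrightarrow> (p has_real_derivative p' s) (at s within pts I)"
    "\<And>s. s\<in>pts I \<Longrightarrow> (p' has_real_derivative (q s * p s - f s) / a) (at s within pts I)" by blast
  \<comment> \<open>Bootstrapping: the equation expresses the derivative of \<open>p'\<close>
    through \<open>p\<close> and smooth data, so both functions gain one order per step.\<close>
  have "C_k_on k (pts I) p \<and> C_k_on k (pts I) p'" for k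
  proof (induction k)
    case 0
    show ?case using continuous_on_of_deriv[OF p(5)] continuous_on_of_deriv[OF p(6)] by simp
  next
    case (Suc k)
    have qf: "C_k_on k (pts I) q" "C_k_on k (pts I) f"
      using q f by (auto simp: smooth_fun_def smooth_on_def)
    have "C_k_on k (pts I) (\<lambda>s. (1 / a) * (q s * p s + (-1) * f s))"
      by (intro C_k_on_mult C_k_on_add C_k_on_const) (use Suc qf in auto)
    then have "C_k_on k (pts I) (\<lambda>s. (q s * p s - f s) / a)" by simp
    from C_k_on_Suc_real[OF p(6) this] C_k_on_Suc_real[OF p(5)] Suc show ?case by blast
  qed
  then have "smooth_fun I p" "smooth_fun I p'" using p by (auto simp: smooth_fun_def smooth_on_def)
  with p show thesis by (intro that[of p p']) auto
qed

lemma solves_bvp_imp_bvp: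
  assumes sol: "solves_bvp I a b k \<psi> p" and a: "a > 0"
  shows "bvp I a (\<lambda>s. b * (k s)\<^sup>2) (\<lambda>s. b * k s * \<psi> s) p (D I p)"
proof -
  from sol have p: "smooth_fun I p" "I = Interval \<longrightarrow> p 0 = 0 \<and> p 1 = 0"
    "\<And>s. s \<in> pts I \<Longrightarrow> - a * D I (D I p) s + b * (k s)\<^sup>2 * p s = b * k s * \<psi> s"
    by (auto simp: solves_bvp_def)
  note p1 = smooth_fun_D[OF p(1)]
  note p2 = smooth_fun_D(2)[OF p1(1)]
  have per: "g 0 = g 1" if "smooth_fun I g" "I \<noteq> Interval" for g :: "real \<Rightarrow> real"
    using that by (cases I) (auto simp: smooth_fun_def dest: spec[of _ 0])
  have sub: "(g has_real_derivative g') (at s within {0..1})"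
    if "(g has_vector_derivative g') (at s within pts I)" for g g' s
    using that DERIV_subset[OF _ Icc_subset_pts] by (auto simp: has_real_derivative_iff_has_vector_derivative)
  have eq: "D I (D I p) s = (b * (k s)\<^sup>2 * p s - b * k s * \<psi> s) / a" if "s \<in> pts I" for s
    using p(3)[OF that] a by (simp add: field_simps)
  show ?thesis
    unfolding bvp_def
  proof (intro conjI ballI)
    fix s :: real assume "s \<in> {0..1}"
    then have s: "s \<in> pts I" using Icc_subset_pts by blast
    show "(p has_real_derivative D I p s) (at s within {0..1})" by (rule sub[OF p1(2)[OF s]])
    show "(D I p has_real_derivative (b * (k s)\<^sup>2 * p s - b * k s * \<psi> s) / a) (at s within {0..1})"
      using sub[OF p2[OF s]] eq[OF s] by simp
  qed (use p(2) per[OF p(1)] per[OF p1(1)] in auto)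
qed

text \<open>The way back from the unit interval: \<open>bvp_extend\<close> supplies the smooth, and
  on the circle periodic, function that \<open>solves_bvp\<close> asks for.\<close>

lemma solves_bvp_of_bvp:
  assumes sol: "bvp I a (\<lambda>s. b * (k s)\<^sup>2) (\<lambda>s. b * k s * \<psi> s) u u'"
    and a: "a > 0" and k: "smooth_fun I k" and \<psi>: "smooth_fun I \<psi>"
  obtains p where "solves_bvp I a b k \<psi> p" "\<And>s. s \<in> {0..1} \<Longrightarrow> p s = u s"
proof -
  have "smooth_fun I (\<lambda>s. b * (k s)\<^sup>2)" "smooth_fun I (\<lambda>s. b * k s * \<psi> s)"
    by (intro smooth_fun_intros k \<psi>)+
  from bvp_extend[OF sol this] obtain p p' where p: "\<And>s. s \<in> {0..1} \<Longrightarrow> p s = u s"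
    "smooth_fun I p" "smooth_fun I p'"
    "\<And>s. s \<in> pts I \<Longrightarrow> (p has_real_derivative p' s) (at s within pts I)"
    "\<And>s. s \<in> pts I \<Longrightarrow> (p' has_real_derivative (b * (k s)\<^sup>2 * p s - b * k s * \<psi> s) / a) (at s within pts I)"
    by metis
  have D1: "D I p s = p' s" if "s \<in> pts I" for s
    by (rule D_eqI[OF that]) (use p(4)[OF that] in \<open>simp add: has_real_derivative_iff_has_vector_derivative\<close>)
  have D2: "D I (D I p) s = (b * (k s)\<^sup>2 * p s - b * k s * \<psi> s) / a" if "s \<in> pts I" for s
  proof -
    have "D I (D I p) s = D I p' s" by (rule D_cong[OF that D1])
    also have "\<dots> = (b * (k s)\<^sup>2 * p s - b * k s * \<psi> s) / a"
      by (rule D_eqI[OF that]) (use p(5)[OF that] in \<open>simp add: has_real_derivative_iff_has_vector_derivative\<close>)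
    finally show ?thesis .
  qed
  have "solves_bvp I a b k \<psi> p"
    unfolding solves_bvp_def
  proof (intro conjI[of "smooth_fun I p"] conjI[of "_ \<longrightarrow> _"] ballI)
    show "I = Interval \<longrightarrow> p 0 = 0 \<and> p 1 = 0"
      using sol p(1) by (auto simp: bvp_def)
    fix s assume "s \<in> pts I"
    then show "- a * D I (D I p) s + b * (k s)\<^sup>2 * p s = b * k s * \<psi> s"
      using D2 a by simp
  qed (use p in auto)
  from this p(1) show thesis by (rule that)
qed

section \<open>Partial derivatives and primitives\<close>

lemma has_vector_derivative_along:
  assumes "\<And>x. x \<in> S \<Longrightarrow> (G has_derivative G' x) (at x within S)"
    and "\<And>y. y \<in> X \<Longrightarrow> p + y *\<^sub>R v \<in> S" and "y \<in> X"
  shows "((\<lambda>y. G (p + y *\<^sub>R v)) has_vector_derivative G' (p + y *\<^sub>R v) v) (at y within X)"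
proof -
  have 1: "((\<lambda>y. p + y *\<^sub>R v) has_vector_derivative v) (at y within X)"
    by (auto intro!: derivative_eq_intros simp: has_vector_derivative_def)
  have "(\<lambda>y. p + y *\<^sub>R v) ` X \<subseteq> S" using assms(2) by auto
  with assms(1)[OF assms(2)[OF assms(3)]]
  have "(G has_derivative G' (p + y *\<^sub>R v)) (at (p + y *\<^sub>R v) within (\<lambda>y. p + y *\<^sub>R v) ` X)"
    by (rule has_derivative_subset)
  from vector_derivative_diff_chain_within[OF 1 this] show ?thesis by (simp add: o_def)
qed

text \<open>Differentiating \<open>F y s' = F y c + integral {c..s'} (Fs y)\<close> under the
  integral sign shows that \<open>Fx\<close> is a primitive of \<open>Fsx x\<close>. This works for
  derivatives within \<open>X\<close>, in particular at the ends of the time interval.\<close>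

lemma mixed_partial:
  fixes F :: "real \<Rightarrow> real \<Rightarrow> 'b::banach"
  assumes X: "convex X" "x \<in> X" "at x within X \<noteq> bot" and cd: "c \<le> d"
    and Fs: "\<And>y s. y \<in> X \<Longrightarrow> s \<in> {c..d} \<Longrightarrow> (F y has_vector_derivative Fs y s) (at s within {c..d})"
    and Fsx: "\<And>y s. y \<in> X \<Longrightarrow> s \<in> {c..d} \<Longrightarrow> ((\<lambda>y. Fs y s) has_vector_derivative Fsx y s) (at y within X)"
    and Fx: "\<And>s. s \<in> {c..d} \<Longrightarrow> ((\<lambda>y. F y s) has_vector_derivative Fx s) (at x within X)"
    and cFs: "\<And>y. y \<in> X \<Longrightarrow> continuous_on {c..d} (Fs y)"
    and cFsx: "continuous_on (X \<times> {c..d}) (\<lambda>(y, s). Fsx y s)"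
    and s: "s \<in> {c..d}"
  shows "(Fx has_vector_derivative Fsx x s) (at s within {c..d})"
proof -
  have eq: "Fx s' = Fx c + integral {c..s'} (Fsx x)" if s': "s' \<in> {c..d}" for s'
  proof -
    have sub: "{c..s'} \<subseteq> {c..d}" using s' by auto
    have F_eq: "F y s' = F y c + integral {c..s'} (Fs y)" if "y \<in> X" for y
    proof -
      have "(Fs y has_integral (F y s' - F y c)) {c..s'}"
        by (rule fundamental_theorem_of_calculus)
          (use s' sub has_vector_derivative_within_subset[OF Fs[OF that]] in auto)
      then show ?thesis by (simp add: integral_unique)
    qed
    have "((\<lambda>y. integral (cbox c s') (Fs y)) has_vector_derivative integral (cbox c s') (Fsx x)) (at x within X)"
      by (rule leibniz_rule_vector_derivative)
        (use X sub Fsx in \<open>auto intro!: integrable_continuous_interval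
          continuous_on_subset[OF cFs] continuous_on_subset[OF cFsx]\<close>)
    then have "((\<lambda>y. F y c + integral {c..s'} (Fs y)) has_vector_derivative (Fx c + integral {c..s'} (Fsx x))) (at x within X)"
      using Fx[of c] cd by (auto intro!: derivative_eq_intros)
    then have "((\<lambda>y. F y s') has_vector_derivative (Fx c + integral {c..s'} (Fsx x))) (at x within X)"
      by (rule has_vector_derivative_transform[OF X(2), rotated]) (rule F_eq)
    from vector_derivative_unique_within[OF X(3) Fx[OF s'] this] show ?thesis .
  qed
  have "continuous_on {c..d} (\<lambda>s. (\<lambda>(y, s). Fsx y s) (x, s))"
    by (rule continuous_on_compose2[OF cFsx]) (use X in \<open>auto intro!: continuous_intros\<close>)
  then have "((\<lambda>s'. integral {c..s'} (Fsx x)) has_vector_derivative Fsx x s) (at s within {c..d})"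
    by (intro integral_has_vector_derivative s) simp
  then have "((\<lambda>s'. Fx c + integral {c..s'} (Fsx x)) has_vector_derivative Fsx x s) (at s within {c..d})"
    by (auto intro!: derivative_eq_intros)
  then show ?thesis
    by (rule has_vector_derivative_transform[OF s, rotated]) (rule eq)
qed

text \<open>\<open>mixed_partial\<close> integrates over a compact interval, whereas the circle is
  represented by the whole line.\<close>

lemma pts_localize:
  assumes "s \<in> pts I"
  obtains c d where "c < d" "s \<in> {c..d}" "{c..d} \<subseteq> pts I" "at s within pts I = at s within {c..d}"
proof (cases I)
  case Interval
  with assms that[of 0 1] show thesis by auto
next
  case Circle
  with that[of "s - 1" "s + 1"] show thesis by (auto simp: at_within_Icc_at)
qed

text \<open>For angles, often only \<open>cis\<close> of them can be compared:
  \<open>\<theta>\<close> at \<open>s + 1\<close> and at \<open>s\<close> for closed curves, or at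
  different \<open>\<epsilon>\<close> for fixed end curves. Equality of the derivatives follows from
  those of cosine and sine, since these never vanish together.\<close>

lemma cis_deriv_unique:
  fixes f g :: "real \<Rightarrow> real"
  assumes "(f has_real_derivative f') (at x within X)" "(g has_real_derivative g') (at x within X)"
    and "\<And>y. y \<in> X \<Longrightarrow> cis (f y) = cis (g y)" "x \<in> X" "at x within X \<noteq> bot"
  shows "f' = g'"
proof -
  have sc: "cos (f y) = cos (g y)" "sin (f y) = sin (g y)" if "y \<in> X" for y
    using assms(3)[OF that] by (auto simp: complex_eq_iff)
  have "((\<lambda>y. cos (f y)) has_real_derivative - sin (f x) * f') (at x within X)"
    "((\<lambda>y. sin (f y)) has_real_derivative cos (f x) * f') (at x within X)"
    using assms(1) by (auto intro!: derivative_eq_intros)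
  moreover have "((\<lambda>y. cos (f y)) has_real_derivative - sin (g x) * g') (at x within X)"
    by (rule has_real_derivative_transform[OF assms(4) sc(1)])
      (use assms(2) in \<open>auto intro!: derivative_eq_intros\<close>)
  moreover have "((\<lambda>y. sin (f y)) has_real_derivative cos (g x) * g') (at x within X)"
    by (rule has_real_derivative_transform[OF assms(4) sc(2)])
      (use assms(2) in \<open>auto intro!: derivative_eq_intros\<close>)
  ultimately have "- sin (f x) * f' = - sin (g x) * g'" "cos (f x) * f' = cos (g x) * g'"
    using has_field_derivative_unique[OF _ _ assms(5)] by blast+
  then have "sin (g x) * (f' - g') = 0" "cos (g x) * (f' - g') = 0"
    using sc[OF assms(4)] by (auto simp: algebra_simps)
  moreover have "sin (g x) \<noteq> 0 \<or> cos (g x) \<noteq> 0"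
    using sin_cos_squared_add[of "g x"] by (auto simp del: sin_cos_squared_add)
  ultimately show ?thesis by auto
qed

lemma FTC_pts:
  fixes f :: "real \<Rightarrow> 'a::euclidean_space"
  assumes f: "continuous_on (pts I) f" and s: "s \<in> pts I"
  shows "((\<lambda>u. LBINT y=ereal 0..ereal u. f y) has_vector_derivative f s) (at s within pts I)"
proof (cases I)
  case Interval
  with f s show ?thesis by (auto intro!: interval_integral_FTC2)
next
  case Circle
  define r where "r = \<bar>s\<bar> + 1"
  have "((\<lambda>u. LBINT y=ereal 0..ereal u. f y) has_vector_derivative f s) (at s within {- r..r})"
    by (rule interval_integral_FTC2) (use f Circle in \<open>auto simp: r_def intro: continuous_on_subset\<close>)
  moreover have "at s within {- r..r} = at s"
    by (rule at_within_Icc_at) (auto simp: r_def)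
  ultimately show ?thesis using Circle by simp
qed

lemma LBINT_pts:
  fixes f :: "real \<Rightarrow> real"
  assumes F: "\<And>s. s \<in> pts I \<Longrightarrow> (F has_real_derivative f s) (at s within pts I)"
    and f: "continuous_on (pts I) f" and s: "s \<in> pts I"
  shows "(LBINT y=ereal 0..ereal s. f y) = F s - F 0"
proof -
  have "{min 0 s..max 0 s} \<subseteq> pts I" using s by (cases I) auto
  note sub = this
  show ?thesis
  proof (rule interval_integral_FTC_finite)
    show "continuous_on {min 0 s..max 0 s} f" by (rule continuous_on_subset[OF f sub])
    fix x assume "min 0 s \<le> x" "x \<le> max 0 s"
    then have "x \<in> pts I" using sub by auto
    from DERIV_subset[OF F[OF this] sub]
    show "(F has_vector_derivative f x) (at x within {min 0 s..max 0 s})"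
      by (simp add: has_real_derivative_iff_has_vector_derivative)
  qed
qed

text \<open>\<open>pd_eps0\<close> at an arbitrary value of the parameter: differentiation under the
  integral sign takes place in a neighbourhood of 0.\<close>

definition pd_e :: "(real \<Rightarrow> real \<Rightarrow> real \<Rightarrow> 'b::real_normed_vector) \<Rightarrow> real \<Rightarrow> real \<Rightarrow> real \<Rightarrow> 'b" where
  "pd_e F e t s = vector_derivative (\<lambda>x. F x t s) (at e)"

lemma solves_bvp_cong:
  assumes "\<And>s. s \<in> pts I \<Longrightarrow> k s = k' s" "\<And>s. s \<in> pts I \<Longrightarrow> \<psi> s = \<psi>' s"
  shows "solves_bvp I a b k \<psi> p = solves_bvp I a b k' \<psi>' p"
  using assms by (simp add: solves_bvp_def)

text \<open>The equation for \<open>m\<close> is the auxiliary equation of the metric, for the field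
  \<open>\<gamma>_t\<close>, divided by \<open>b\<close>.\<close>

lemma solves_bvp_rescale:
  assumes "b \<noteq> 0"
  shows "solves_bvp I (a / b) 1 k \<psi> p = solves_bvp I a b k \<psi> p"
proof -
  have "- (a / b) * x + 1 * y = 1 * z \<longleftrightarrow> - a * x + b * y = b * z" for x y z :: real
    using assms by (simp add: field_simps)
  from this[of _ "(k _)\<^sup>2 * p _" "k _ * \<psi> _"] show ?thesis
    unfolding solves_bvp_def by (simp add: mult.assoc)
qed

section \<open>Variations of arc length parameterized curves\<close>

locale elastic_variation =
  fixes I :: curve_domain and a b T \<delta> :: real
    and \<gamma> :: "real \<Rightarrow> real \<Rightarrow> real \<Rightarrow> complex"
    and \<theta> :: "real \<Rightarrow> real \<Rightarrow> real \<Rightarrow> real"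
  assumes a: "a > 0" and b: "b > 0" and T: "T > 0" and \<delta>: "\<delta> > 0"
    and var: "variation I T \<delta> \<gamma> \<theta>"
begin

abbreviation "J \<equiv> {-\<delta><..<\<delta>}"

definition sm :: "(real \<Rightarrow> real \<Rightarrow> real \<Rightarrow> 'b::real_normed_vector) \<Rightarrow> bool" where
  "sm F \<longleftrightarrow> smooth_on (J \<times> {0..T} \<times> pts I) (\<lambda>(e, t, s). F e t s)"

text \<open>Kept apart from \<open>sm\<close> because the angle of a closed curve may gain a
  multiple of \<open>2 * pi\<close> per turn: \<open>\<theta>\<close> is only \<open>sm\<close>,
  while its partial derivatives are \<open>adm\<close>.\<close>

definition adm :: "(real \<Rightarrow> real \<Rightarrow> real \<Rightarrow> 'b::real_normed_vector) \<Rightarrow> bool" where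
  "adm F \<longleftrightarrow> sm F \<and> (\<forall>e\<in>J. \<forall>t\<in>{0..T}. descends I (F e t))"

lemma at_nontrivial:
  "t \<in> {0..T} \<Longrightarrow> at t within {0..T} \<noteq> bot"
  "e \<in> J \<Longrightarrow> at e within J \<noteq> bot"
  "s \<in> pts I \<Longrightarrow> at s within pts I \<noteq> bot"
proof -
  show "t \<in> {0..T} \<Longrightarrow> at t within {0..T} \<noteq> bot"
    using T by (simp add: trivial_limit_within islimpt_Icc)
  show "e \<in> J \<Longrightarrow> at e within J \<noteq> bot"
    by (simp add: at_within_open[of _ J])
  show "s \<in> pts I \<Longrightarrow> at s within pts I \<noteq> bot"
    by (cases I) (simp_all add: trivial_limit_within islimpt_Icc)
qed

lemma sm_partials:
  assumes F: "sm F"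
  shows "sm (pd_e F)" "sm (\<lambda>e. pd_t T (F e))" "sm (\<lambda>e. pd_s I (F e))"
    and "e \<in> J \<Longrightarrow> t \<in> {0..T} \<Longrightarrow> s \<in> pts I \<Longrightarrow> ((\<lambda>x. F x t s) has_vector_derivative pd_e F e t s) (at e)"
    and "e \<in> J \<Longrightarrow> t \<in> {0..T} \<Longrightarrow> s \<in> pts I \<Longrightarrow> ((\<lambda>x. F e x s) has_vector_derivative pd_t T (F e) t s) (at t within {0..T})"
    and "e \<in> J \<Longrightarrow> t \<in> {0..T} \<Longrightarrow> s \<in> pts I \<Longrightarrow> (F e t has_vector_derivative pd_s I (F e) t s) (at s within pts I)"
proof -
  let ?B = "J \<times> {0..T} \<times> pts I"
  have "thick ?B"
    using T by (intro thick_Times thick_pts thick_Icc thick_open) auto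
  from smooth_on_has_derivative[OF this F[unfolded sm_def]] obtain F' where
    F': "\<And>x. x \<in> ?B \<Longrightarrow> ((\<lambda>(e, t, s). F e t s) has_derivative F' x) (at x within ?B)"
    "\<And>v. smooth_on ?B (\<lambda>x. F' x v)" by blast
  note along = has_vector_derivative_along[OF F'(1)]
  have e: "((\<lambda>x. F x t s) has_vector_derivative F' (e, t, s) (1, 0, 0)) (at e)"
    if "e \<in> J" "t \<in> {0..T}" "s \<in> pts I" for e t s
    using along[of J "(0, t, s)" "(1, 0, 0)" e] that by (simp add: at_within_open[of e J])
  have t: "((\<lambda>x. F e x s) has_vector_derivative F' (e, t, s) (0, 1, 0)) (at t within {0..T})"
    if "e \<in> J" "t \<in> {0..T}" "s \<in> pts I" for e t s
    using along[of "{0..T}" "(e, 0, s)" "(0, 1, 0)" t] that by simp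
  have s: "(F e t has_vector_derivative F' (e, t, s) (0, 0, 1)) (at s within pts I)"
    if "e \<in> J" "t \<in> {0..T}" "s \<in> pts I" for e t s
    using along[of "pts I" "(e, t, 0)" "(0, 0, 1)" s] that by simp
  have e': "pd_e F e t s = F' (e, t, s) (1, 0, 0)" if "e \<in> J" "t \<in> {0..T}" "s \<in> pts I" for e t s
    unfolding pd_e_def using e[OF that] by (rule vector_derivative_at)
  have t': "pd_t T (F e) t s = F' (e, t, s) (0, 1, 0)" if "e \<in> J" "t \<in> {0..T}" "s \<in> pts I" for e t s
    unfolding pd_t_def using vector_derivative_within[OF at_nontrivial(1)[OF that(2)] t[OF that]] .
  have s': "pd_s I (F e) t s = F' (e, t, s) (0, 0, 1)" if "e \<in> J" "t \<in> {0..T}" "s \<in> pts I" for e t s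
    unfolding pd_s_def using s[OF that] that by (intro D_eqI)
  show "sm (pd_e F)" unfolding sm_def
    by (rule smooth_on_cong[OF _ F'(2)[of "(1, 0, 0)"]]) (use e' in auto)
  show "sm (\<lambda>e. pd_t T (F e))" unfolding sm_def
    by (rule smooth_on_cong[OF _ F'(2)[of "(0, 1, 0)"]]) (use t' in auto)
  show "sm (\<lambda>e. pd_s I (F e))" unfolding sm_def
    by (rule smooth_on_cong[OF _ F'(2)[of "(0, 0, 1)"]]) (use s' in auto)
  show "e \<in> J \<Longrightarrow> t \<in> {0..T} \<Longrightarrow> s \<in> pts I \<Longrightarrow> ((\<lambda>x. F x t s) has_vector_derivative pd_e F e t s) (at e)"
    using e e' by simp
  show "e \<in> J \<Longrightarrow> t \<in> {0..T} \<Longrightarrow> s \<in> pts I \<Longrightarrow> ((\<lambda>x. F e x s) has_vector_derivative pd_t T (F e) t s) (at t within {0..T})"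
    using t t' by simp
  show "e \<in> J \<Longrightarrow> t \<in> {0..T} \<Longrightarrow> s \<in> pts I \<Longrightarrow> (F e t has_vector_derivative pd_s I (F e) t s) (at s within pts I)"
    using s s' by simp
qed

lemma sm_continuous:
  assumes "sm F"
  shows "continuous_on (J \<times> {0..T} \<times> pts I) (\<lambda>(e, t, s). F e t s)"
  using assms smooth_on_imp_continuous by (auto simp: sm_def)

lemma sm_continuous_compose:
  assumes "sm F" "continuous_on S f" "continuous_on S g" "continuous_on S h"
    "\<And>x. x \<in> S \<Longrightarrow> f x \<in> J \<and> g x \<in> {0..T} \<and> h x \<in> pts I"
  shows "continuous_on S (\<lambda>x. F (f x) (g x) (h x))"
proof -
  have "continuous_on S (\<lambda>x. (\<lambda>(e, t, s). F e t s) (f x, g x, h x))"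
    by (rule continuous_on_compose2[OF sm_continuous[OF assms(1)]])
      (use assms in \<open>auto intro!: continuous_intros\<close>)
  then show ?thesis by simp
qed

lemma pd_t_pd_s:
  fixes F :: "real \<Rightarrow> real \<Rightarrow> real \<Rightarrow> 'b::banach"
  assumes F: "sm F" and e: "e \<in> J" and t: "t \<in> {0..T}" and s: "s \<in> pts I"
  shows "(pd_t T (F e) t has_vector_derivative pd_t T (pd_s I (F e)) t s) (at s within pts I)"
proof -
  note Fs = sm_partials(3)[OF F]
  obtain c d where cd: "c < d" "s \<in> {c..d}" "{c..d} \<subseteq> pts I" "at s within pts I = at s within {c..d}"
    by (rule pts_localize[OF s]) blast
  show ?thesis
    unfolding cd(4)
  proof (rule mixed_partial[where X = "{0..T}" and F = "F e" and Fs = "pd_s I (F e)" and Fsx = "pd_t T (pd_s I (F e))"])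
    show "\<And>y s. y \<in> {0..T} \<Longrightarrow> s \<in> {c..d} \<Longrightarrow> (F e y has_vector_derivative pd_s I (F e) y s) (at s within {c..d})"
      using sm_partials(6)[OF F e] cd(3) has_vector_derivative_within_subset by blast
    show "\<And>y s. y \<in> {0..T} \<Longrightarrow> s \<in> {c..d} \<Longrightarrow>
        ((\<lambda>y. pd_s I (F e) y s) has_vector_derivative pd_t T (pd_s I (F e)) y s) (at y within {0..T})"
      using sm_partials(5)[OF Fs e] cd(3) by blast
    show "\<And>s. s \<in> {c..d} \<Longrightarrow> ((\<lambda>y. F e y s) has_vector_derivative pd_t T (F e) t s) (at t within {0..T})"
      using sm_partials(5)[OF F e t] cd(3) by blast
    show "continuous_on {c..d} (pd_s I (F e) y)" if "y \<in> {0..T}" for y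
      by (rule sm_continuous_compose[OF Fs]) (use that e cd(3) in \<open>auto intro!: continuous_intros\<close>)
    show "continuous_on ({0..T} \<times> {c..d}) (\<lambda>(y, s). pd_t T (pd_s I (F e)) y s)"
      unfolding split_beta
      by (rule sm_continuous_compose[OF sm_partials(2)[OF Fs]]) (use e cd(3) in \<open>auto intro!: continuous_intros\<close>)
  qed (use t cd at_nontrivial(1) in auto)
qed

lemma pd_e_pd_s:
  fixes F :: "real \<Rightarrow> real \<Rightarrow> real \<Rightarrow> 'b::banach"
  assumes F: "sm F" and e: "e \<in> J" and t: "t \<in> {0..T}" and s: "s \<in> pts I"
  shows "(pd_e F e t has_vector_derivative pd_e (\<lambda>e. pd_s I (F e)) e t s) (at s within pts I)"
proof -
  note Fs = sm_partials(3)[OF F]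
  obtain c d where cd: "c < d" "s \<in> {c..d}" "{c..d} \<subseteq> pts I" "at s within pts I = at s within {c..d}"
    by (rule pts_localize[OF s]) blast
  show ?thesis
    unfolding cd(4)
  proof (rule mixed_partial[where X = J and F = "\<lambda>e. F e t" and Fs = "\<lambda>e. pd_s I (F e) t"
        and Fsx = "\<lambda>e. pd_e (\<lambda>e. pd_s I (F e)) e t"])
    show "\<And>y s. y \<in> J \<Longrightarrow> s \<in> {c..d} \<Longrightarrow> (F y t has_vector_derivative pd_s I (F y) t s) (at s within {c..d})"
      using sm_partials(6)[OF F _ t] cd(3) has_vector_derivative_within_subset by blast
    show "\<And>y s. y \<in> J \<Longrightarrow> s \<in> {c..d} \<Longrightarrow>
        ((\<lambda>y. pd_s I (F y) t s) has_vector_derivative pd_e (\<lambda>e. pd_s I (F e)) y t s) (at y within J)"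
      using sm_partials(4)[OF Fs _ t] cd(3) has_vector_derivative_at_within by blast
    show "\<And>s. s \<in> {c..d} \<Longrightarrow> ((\<lambda>y. F y t s) has_vector_derivative pd_e F e t s) (at e within J)"
      using sm_partials(4)[OF F e t] cd(3) has_vector_derivative_at_within by blast
    show "continuous_on {c..d} (pd_s I (F y) t)" if "y \<in> J" for y
      by (rule sm_continuous_compose[OF Fs]) (use that t cd(3) in \<open>auto intro!: continuous_intros\<close>)
    show "continuous_on (J \<times> {c..d}) (\<lambda>(y, s). pd_e (\<lambda>e. pd_s I (F e)) y t s)"
      unfolding split_beta
      by (rule sm_continuous_compose[OF sm_partials(1)[OF Fs]]) (use t cd(3) in \<open>auto intro!: continuous_intros\<close>)
  qed (use e cd at_nontrivial(2) in auto)
qed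

lemma pd_e_pd_t:
  fixes F :: "real \<Rightarrow> real \<Rightarrow> real \<Rightarrow> 'b::banach"
  assumes F: "sm F" and e: "e \<in> J" and t: "t \<in> {0..T}" and s: "s \<in> pts I"
  shows "((\<lambda>t. pd_e F e t s) has_vector_derivative pd_e (\<lambda>e. pd_t T (F e)) e t s) (at t within {0..T})"
proof -
  note Ft = sm_partials(2)[OF F]
  show ?thesis
  proof (rule mixed_partial[where X = J and F = "\<lambda>e t. F e t s" and Fs = "\<lambda>e t. pd_t T (F e) t s"
        and Fsx = "\<lambda>e t. pd_e (\<lambda>e. pd_t T (F e)) e t s"])
    show "\<And>y t. y \<in> J \<Longrightarrow> t \<in> {0..T} \<Longrightarrow> ((\<lambda>t. F y t s) has_vector_derivative pd_t T (F y) t s) (at t within {0..T})"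
      using sm_partials(5)[OF F _ _ s] by blast
    show "\<And>y t. y \<in> J \<Longrightarrow> t \<in> {0..T} \<Longrightarrow>
        ((\<lambda>y. pd_t T (F y) t s) has_vector_derivative pd_e (\<lambda>e. pd_t T (F e)) y t s) (at y within J)"
      using sm_partials(4)[OF Ft _ _ s] has_vector_derivative_at_within by blast
    show "\<And>t. t \<in> {0..T} \<Longrightarrow> ((\<lambda>y. F y t s) has_vector_derivative pd_e F e t s) (at e within J)"
      using sm_partials(4)[OF F e _ s] has_vector_derivative_at_within by blast
    show "continuous_on {0..T} (\<lambda>t. pd_t T (F y) t s)" if "y \<in> J" for y
      by (rule sm_continuous_compose[OF Ft]) (use that s in \<open>auto intro!: continuous_intros\<close>)
    show "continuous_on (J \<times> {0..T}) (\<lambda>(y, t). pd_e (\<lambda>e. pd_t T (F e)) y t s)"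
      unfolding split_beta
      by (rule sm_continuous_compose[OF sm_partials(1)[OF Ft]]) (use s in \<open>auto intro!: continuous_intros\<close>)
  qed (use e t T at_nontrivial(2) in auto)
qed

lemma adm_partials:
  assumes "adm F"
  shows "adm (pd_e F)" "adm (\<lambda>e. pd_t T (F e))" "adm (\<lambda>e. pd_s I (F e))"
proof -
  from assms have F: "sm F" and per: "\<And>e t. e \<in> J \<Longrightarrow> t \<in> {0..T} \<Longrightarrow> descends I (F e t)"
    by (auto simp: adm_def)
  have "descends I (pd_e F e t)" if et: "e \<in> J" "t \<in> {0..T}" for e t
  proof (cases I)
    case Circle
    have "pd_e F e t (s + 1) = pd_e F e t s" for s
    proof -
      have "((\<lambda>x. F x t (s + 1)) has_vector_derivative pd_e F e t (s + 1)) (at e within J)"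
        using sm_partials(4)[OF F et] Circle by (simp add: has_vector_derivative_at_within)
      then have "((\<lambda>x. F x t s) has_vector_derivative pd_e F e t (s + 1)) (at e within J)"
        by (rule has_vector_derivative_transform[OF et(1), rotated]) (use per[OF _ et(2)] Circle in auto)
      moreover have "((\<lambda>x. F x t s) has_vector_derivative pd_e F e t s) (at e within J)"
        using sm_partials(4)[OF F et] Circle by (simp add: has_vector_derivative_at_within)
      ultimately show ?thesis by (rule vector_derivative_unique_within[OF at_nontrivial(2)[OF et(1)]])
    qed
    then show ?thesis using Circle by simp
  qed simp
  then show "adm (pd_e F)" using sm_partials[OF F] by (simp add: adm_def)
  have "descends I (pd_t T (F e) t)" if et: "e \<in> J" "t \<in> {0..T}" for e t
  proof (cases I)
    case Circle
    have "pd_t T (F e) t (s + 1) = pd_t T (F e) t s" for s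
    proof -
      have "((\<lambda>x. F e x (s + 1)) has_vector_derivative pd_t T (F e) t (s + 1)) (at t within {0..T})"
        using sm_partials(5)[OF F et] Circle by simp
      then have "((\<lambda>x. F e x s) has_vector_derivative pd_t T (F e) t (s + 1)) (at t within {0..T})"
        by (rule has_vector_derivative_transform[OF et(2), rotated]) (use per[OF et(1)] Circle in auto)
      moreover have "((\<lambda>x. F e x s) has_vector_derivative pd_t T (F e) t s) (at t within {0..T})"
        using sm_partials(5)[OF F et] Circle by simp
      ultimately show ?thesis by (rule vector_derivative_unique_within[OF at_nontrivial(1)[OF et(2)]])
    qed
    then show ?thesis using Circle by simp
  qed simp
  then show "adm (\<lambda>e. pd_t T (F e))" using sm_partials[OF F] by (simp add: adm_def)
  have "descends I (pd_s I (F e) t)" if et: "e \<in> J" "t \<in> {0..T}" for e t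
    using descends_D[OF per[OF et]] by (simp add: pd_s_def[abs_def])
  then show "adm (\<lambda>e. pd_s I (F e))" using sm_partials[OF F] by (simp add: adm_def)
qed

lemma adm_sm: "adm F \<Longrightarrow> sm F"
  by (simp add: adm_def)

lemma adm_smooth_fun:
  assumes F: "adm F" and e: "e \<in> J" and t: "t \<in> {0..T}"
  shows "smooth_fun I (F e t)"
proof -
  have "smooth_on (pts I) (\<lambda>s. (\<lambda>(e, t, s). F e t s) ((e, t, 0) + (0, 0, s)))"
    by (rule smooth_on_affine[where S = "J \<times> {0..T} \<times> pts I" and L = "\<lambda>s. (0, 0, s)"])
      (use F e t in \<open>auto simp: adm_def sm_def intro!: bounded_linear_Pair bounded_linear_zero bounded_linear_ident\<close>)
  with F e t show ?thesis by (simp add: smooth_fun_def adm_def)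
qed

section \<open>The partial derivatives of the angle function\<close>

lemma sm_\<theta>: "sm \<theta>" and sm_\<gamma>: "sm \<gamma>"
  using var by (simp_all add: variation_def sm_def)

lemma curve:
  assumes "e \<in> J" "t \<in> {0..T}"
  shows "smooth_fun I (\<gamma> e t)" and "s \<in> pts I \<Longrightarrow> D I (\<gamma> e t) s = cis (\<theta> e t s)"
  using var assms by (auto simp: variation_def arclength_curves_def pd_s_def)

lemma cis_periodic:
  assumes "e \<in> J" "t \<in> {0..T}" "I = Circle"
  shows "cis (\<theta> e t (s + 1)) = cis (\<theta> e t s)"
  using descends_D[of I "\<gamma> e t"] curve[OF assms(1,2)] assms(3) by (simp add: smooth_fun_def)

text \<open>\<open>adm_partials\<close> requires a periodic function and so does not apply to
  \<open>\<theta>\<close>. The first derivatives are periodic because \<open>\<theta>\<close> at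
  \<open>s + 1\<close> and at \<open>s\<close> are angles of the same unit tangent.\<close>

lemma adm_\<theta>_partials:
  "adm (pd_e \<theta>)" "adm (\<lambda>e. pd_t T (\<theta> e))" "adm (\<lambda>e. pd_s I (\<theta> e))"
proof -
  note P = sm_partials[OF sm_\<theta>]
  have "descends I (pd_e \<theta> e t)" if et: "e \<in> J" "t \<in> {0..T}" for e t
  proof (cases I)
    case Circle
    have "pd_e \<theta> e t (s + 1) = pd_e \<theta> e t s" for s
      by (rule cis_deriv_unique[where X = J and x = e and f = "\<lambda>x. \<theta> x t (s + 1)" and g = "\<lambda>x. \<theta> x t s"])
        (use P(4)[OF et] et Circle cis_periodic[OF _ et(2) Circle] at_nontrivial(2) in
          \<open>auto simp: has_real_derivative_iff_has_vector_derivative has_vector_derivative_at_within\<close>)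
    then show ?thesis using Circle by simp
  qed simp
  then show "adm (pd_e \<theta>)" using P by (simp add: adm_def)
  have "descends I (pd_t T (\<theta> e) t)" if et: "e \<in> J" "t \<in> {0..T}" for e t
  proof (cases I)
    case Circle
    have "pd_t T (\<theta> e) t (s + 1) = pd_t T (\<theta> e) t s" for s
      by (rule cis_deriv_unique[where X = "{0..T}" and x = t and f = "\<lambda>x. \<theta> e x (s + 1)" and g = "\<lambda>x. \<theta> e x s"])
        (use P(5)[OF et] et Circle cis_periodic[OF et(1) _ Circle] at_nontrivial(1) in
          \<open>auto simp: has_real_derivative_iff_has_vector_derivative\<close>)
    then show ?thesis using Circle by simp
  qed simp
  then show "adm (\<lambda>e. pd_t T (\<theta> e))" using P by (simp add: adm_def)
  have "descends I (pd_s I (\<theta> e) t)" if et: "e \<in> J" "t \<in> {0..T}" for e t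
  proof (cases I)
    case Circle
    have d: "(\<theta> e t has_real_derivative pd_s I (\<theta> e) t s) (at s)" for s
      using P(6)[OF et] Circle by (simp add: has_real_derivative_iff_has_vector_derivative)
    have "pd_s I (\<theta> e) t (s + 1) = pd_s I (\<theta> e) t s" for s
      by (rule cis_deriv_unique[where X = UNIV and x = s and f = "\<lambda>x. \<theta> e t (x + 1)" and g = "\<theta> e t"])
        (use d cis_periodic[OF et Circle] in \<open>auto simp: DERIV_shift[symmetric]\<close>)
    then show ?thesis using Circle by simp
  qed simp
  then show "adm (\<lambda>e. pd_s I (\<theta> e))" using P by (simp add: adm_def)
qed

abbreviation "ths e \<equiv> pd_s I (\<theta> e)"
abbreviation "tht e \<equiv> pd_t T (\<theta> e)"
abbreviation "thv e \<equiv> pd_e \<theta> e"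
abbreviation "thss e \<equiv> pd_s I (ths e)"
abbreviation "thst e \<equiv> pd_t T (ths e)"
abbreviation "thtt e \<equiv> pd_t T (tht e)"
abbreviation "thse e \<equiv> pd_e ths e"
abbreviation "thte e \<equiv> pd_e tht e"

lemma adm_th:
  "adm thv" "adm tht" "adm ths" "adm thss" "adm thst" "adm thtt" "adm thse" "adm thte"
  using adm_\<theta>_partials adm_partials(1)[OF adm_\<theta>_partials(2)] adm_partials(1)[OF adm_\<theta>_partials(3)]
    adm_partials(2)[OF adm_\<theta>_partials(2)] adm_partials(2)[OF adm_\<theta>_partials(3)]
    adm_partials(3)[OF adm_\<theta>_partials(3)] by simp_all

lemmas th_cont = sm_continuous_compose[OF adm_sm[OF adm_th(1)]] sm_continuous_compose[OF adm_sm[OF adm_th(2)]]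
  sm_continuous_compose[OF adm_sm[OF adm_th(3)]] sm_continuous_compose[OF adm_sm[OF adm_th(4)]]
  sm_continuous_compose[OF adm_sm[OF adm_th(5)]] sm_continuous_compose[OF adm_sm[OF adm_th(6)]]
  sm_continuous_compose[OF adm_sm[OF adm_th(7)]] sm_continuous_compose[OF adm_sm[OF adm_th(8)]]

lemmas th_smooth = adm_smooth_fun[OF adm_th(1)] adm_smooth_fun[OF adm_th(2)] adm_smooth_fun[OF adm_th(3)]
  adm_smooth_fun[OF adm_th(4)] adm_smooth_fun[OF adm_th(5)] adm_smooth_fun[OF adm_th(6)]
  adm_smooth_fun[OF adm_th(7)] adm_smooth_fun[OF adm_th(8)]

lemma th_deriv:
  assumes "e \<in> J" "t \<in> {0..T}" "s \<in> pts I"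
  shows "(ths e t has_real_derivative thss e t s) (at s within pts I)"
    "(tht e t has_real_derivative thst e t s) (at s within pts I)"
    "(thv e t has_real_derivative thse e t s) (at s within pts I)"
    "((\<lambda>t. ths e t s) has_real_derivative thst e t s) (at t within {0..T})"
    "((\<lambda>t. tht e t s) has_real_derivative thtt e t s) (at t within {0..T})"
    "((\<lambda>t. thv e t s) has_real_derivative thte e t s) (at t within {0..T})"
    "((\<lambda>e. ths e t s) has_real_derivative thse e t s) (at e)"
    "((\<lambda>e. tht e t s) has_real_derivative thte e t s) (at e)"
    "((\<lambda>e. \<theta> e t s) has_real_derivative thv e t s) (at e)"
  unfolding has_real_derivative_iff_has_vector_derivative
  by (rule sm_partials(4-6)[OF adm_sm[OF adm_th(3)] assms] sm_partials(4-6)[OF adm_sm[OF adm_th(2)] assms]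
      pd_t_pd_s[OF sm_\<theta> assms] pd_e_pd_s[OF sm_\<theta> assms] pd_e_pd_t[OF sm_\<theta> assms]
      sm_partials(4-6)[OF sm_\<theta> assms])+

section \<open>Curvature and metric in terms of the angle function\<close>

lemma normal_eq:
  assumes "e \<in> J" "t \<in> {0..T}" "s \<in> pts I"
  shows "normal I (\<gamma> e t) s = \<i> * cis (\<theta> e t s)"
  using curve(2)[OF assms] by (simp add: normal_def)

lemma cis_deriv:
  fixes f :: "real \<Rightarrow> real"
  assumes "(f has_real_derivative f') (at x within X)"
  shows "((\<lambda>x. cis (f x)) has_vector_derivative f' *\<^sub>R (\<i> * cis (f x))) (at x within X)"
proof -
  have "((\<lambda>x. cis (f x)) has_derivative (\<lambda>t. (f' * t) *\<^sub>R (\<i> * cis (f x)))) (at x within X)"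
    by (rule has_derivative_cis) (use assms in \<open>simp add: has_field_derivative_def\<close>)
  then show ?thesis by (simp add: has_vector_derivative_def mult.commute[of f'] scaleR_scaleR[symmetric] del: scaleR_scaleR)
qed

lemma inner_normal: "(r *\<^sub>R (\<i> * cis x)) \<bullet> (\<i> * cis x) = r"
proof -
  have "(\<i> * cis x) \<bullet> (\<i> * cis x) = (norm (\<i> * cis x))\<^sup>2" by (rule power2_norm_eq_inner[symmetric])
  then show ?thesis by (simp add: norm_mult)
qed

lemma curvature_eq:
  assumes "e \<in> J" "t \<in> {0..T}" "s \<in> pts I"
  shows "curvature I (\<gamma> e t) s = ths e t s"
proof -
  have "D I (D I (\<gamma> e t)) s = D I (\<lambda>s. cis (\<theta> e t s)) s"
    by (rule D_cong[OF assms(3) curve(2)[OF assms(1,2)]])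
  also have "\<dots> = ths e t s *\<^sub>R (\<i> * cis (\<theta> e t s))"
    using sm_partials(6)[OF sm_\<theta> assms]
    by (intro D_eqI assms cis_deriv) (simp add: has_real_derivative_iff_has_vector_derivative)
  finally show ?thesis
    unfolding curvature_def normal_eq[OF assms] by (simp only: inner_normal)
qed

text \<open>A closed curve has to turn by at least one radian, which makes the periodic problem
  uniformly coercive.\<close>

lemma closed_coercive:
  assumes et: "e \<in> J" "t \<in> {0..T}" and C: "I = Circle"
  shows "1 \<le> integral {0..1} (\<lambda>s. (ths e t s)\<^sup>2)"
proof (rule ccontr)
  assume "\<not> 1 \<le> integral {0..1} (\<lambda>s. (ths e t s)\<^sup>2)"
  then have less: "integral {0..1} (\<lambda>s. (ths e t s)\<^sup>2) < 1" by simp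
  have d: "(\<theta> e t has_real_derivative ths e t s) (at s within {0..1})" for s
    using sm_partials(6)[OF sm_\<theta> et, of s] C
    by (simp add: has_real_derivative_iff_has_vector_derivative has_vector_derivative_at_within)
  have ct: "continuous_on {0..1} (ths e t)"
    by (rule smooth_fun_continuous_on[OF th_smooth(3)[OF et]])
  have close: "\<bar>\<theta> e t s - \<theta> e t 0\<bar> \<le> 1" if "s \<in> {0..1}" for s
  proof -
    have "(\<theta> e t s - \<theta> e t 0)\<^sup>2 \<le> integral {0..1} (\<lambda>s. (ths e t s)\<^sup>2)"
      by (rule sq_diff_le_integral_deriv[OF d ct that]) simp
    with less have "(\<theta> e t s - \<theta> e t 0)\<^sup>2 \<le> 1" by simp
    then show ?thesis by (simp add: abs_square_le_1)
  qed
  have "(\<gamma> e t has_vector_derivative cis (\<theta> e t s)) (at s within {0..1})" for s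
    using smooth_fun_D(2)[OF curve(1)[OF et]] curve(2)[OF et] C
    by (auto simp: has_vector_derivative_at_within)
  then have "((\<lambda>s. cis (\<theta> e t s)) has_integral (\<gamma> e t 1 - \<gamma> e t 0)) {0..1}"
    by (intro fundamental_theorem_of_calculus) auto
  moreover have "\<gamma> e t 1 = \<gamma> e t 0"
    using curve(1)[OF et] C by (auto simp: smooth_fun_def dest: spec[of _ 0])
  ultimately have "((\<lambda>s. cis (\<theta> e t s)) has_integral 0) {0..1}" by simp
  \<comment> \<open>After rotation by the initial angle the tangent stays within one radian of the
    real axis. Its real part is then at least \<open>cos 1\<close>, hence at least 1/2, although its
    integral vanishes because the curve closes up.\<close>
  then have "((\<lambda>s. cis (- \<theta> e t 0) * cis (\<theta> e t s)) has_integral cis (- \<theta> e t 0) * 0) {0..1}"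
    by (rule has_integral_mult_right)
  then have "((\<lambda>s. cis (\<theta> e t s - \<theta> e t 0)) has_integral 0) {0..1}"
    by (simp add: cis_mult)
  then have "((\<lambda>s. Re (cis (\<theta> e t s - \<theta> e t 0))) has_integral Re 0) {0..1}"
    by (rule has_integral_linear[OF _ bounded_linear_Re, unfolded o_def])
  then have int: "((\<lambda>s. cos (\<theta> e t s - \<theta> e t 0)) has_integral 0) {0..1}" by simp
  have pos: "cos (\<theta> e t s - \<theta> e t 0) \<ge> 1 / 2" if "s \<in> {0..1}" for s
  proof -
    have "cos 1 \<le> cos \<bar>\<theta> e t s - \<theta> e t 0\<bar>"
      using close[OF that] pi_gt3 by (intro cos_monotone_0_pi_le) auto
    moreover have "cos (pi / 3) \<le> cos (1::real)"
      using pi_gt3 by (intro cos_monotone_0_pi_le) auto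
    ultimately show ?thesis by (simp add: cos_60)
  qed
  have "((\<lambda>s::real. 1 / 2 :: real) has_integral 1 / 2) {0..1}"
    using has_integral_const_real[of "1 / 2 :: real" 0 1] by simp
  from has_integral_le[OF this int pos] show False by simp
qed

text \<open>On the circle \<open>b\<close> can serve as the constant \<open>Q\<close> of the
  estimates, for all \<open>e\<close> and \<open>t\<close> at once. The parameter lemmas rest on
  this uniformity.\<close>

lemma q_props:
  assumes et: "e \<in> J" "t \<in> {0..T}"
  shows "continuous_on {0..1} (\<lambda>s. b * (ths e t s)\<^sup>2)" "0 \<le> b * (ths e t s)\<^sup>2"
    "I = Circle \<Longrightarrow> b \<le> integral {0..1} (\<lambda>s. b * (ths e t s)\<^sup>2)"
    "I = Circle \<Longrightarrow> 0 < integral {0..1} (\<lambda>s. b * (ths e t s)\<^sup>2)"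
proof -
  show "continuous_on {0..1} (\<lambda>s. b * (ths e t s)\<^sup>2)"
    by (intro continuous_intros smooth_fun_continuous_on[OF th_smooth(3)[OF et]])
  show "0 \<le> b * (ths e t s)\<^sup>2" using b by simp
  assume "I = Circle"
  from closed_coercive[OF et this] b have "b * 1 \<le> b * integral {0..1} (\<lambda>s. (ths e t s)\<^sup>2)"
    by (intro mult_left_mono) auto
  then show 1: "b \<le> integral {0..1} (\<lambda>s. b * (ths e t s)\<^sup>2)" by simp
  with b show "0 < integral {0..1} (\<lambda>s. b * (ths e t s)\<^sup>2)" by linarith
qed

lemma solves_bvp_exists:
  assumes et: "e \<in> J" "t \<in> {0..T}" and \<psi>: "smooth_fun I \<psi>"
  obtains p where "solves_bvp I a b (ths e t) \<psi> p"
proof -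
  have "smooth_fun I (\<lambda>s. b * ths e t s * \<psi> s)"
    by (intro smooth_fun_intros \<psi> th_smooth et)
  then have "continuous_on {0..1} (\<lambda>s. b * ths e t s * \<psi> s)" by (rule smooth_fun_continuous_on)
  from bvp_exists[OF a this q_props(1,2)[OF et] q_props(4)[OF et]]
  obtain u u' where "bvp I a (\<lambda>s. b * (ths e t s)\<^sup>2) (\<lambda>s. b * ths e t s * \<psi> s) u u'"
    by blast
  from solves_bvp_of_bvp[OF this a th_smooth(3)[OF et] \<psi>] that show thesis by blast
qed

lemma solves_bvp_unique:
  assumes et: "e \<in> J" "t \<in> {0..T}"
    and p: "solves_bvp I a b (ths e t) \<psi> p" "solves_bvp I a b (ths e t) \<psi> p'" and s: "s \<in> pts I"
  shows "p s = p' s"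
proof -
  have eq: "p r = p' r" if "r \<in> {0..1}" for r
    using bvp_unique(1)[OF solves_bvp_imp_bvp[OF p(1) a] solves_bvp_imp_bvp[OF p(2) a] a q_props(1,2)[OF et] q_props(4)[OF et] that] .
  obtain r where r: "r \<in> {0..1}" "\<And>f :: real \<Rightarrow> real. descends I f \<Longrightarrow> f s = f r"
    using pts_reduce[OF s] by blast
  have "descends I p" "descends I p'"
    using p by (auto simp: solves_bvp_def smooth_fun_def)
  with r(2)[of p] r(2)[of p'] eq[OF r(1)] show ?thesis by simp
qed

text \<open>\<open>SOME\<close> picks a solution for functions that agree with
  \<open>ths e t\<close> and \<open>\<psi>\<close> on \<open>pts I\<close> only. Uniqueness on
  \<open>pts I\<close> allows replacing it by any known solution \<open>p\<close>.\<close>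

lemma metric_eq:
  assumes et: "e \<in> J" "t \<in> {0..T}"
    and w: "\<And>s. s \<in> pts I \<Longrightarrow> (w has_vector_derivative \<phi> s *\<^sub>R (\<i> * cis (\<theta> e t s))) (at s within pts I)"
    and z: "\<And>s. s \<in> pts I \<Longrightarrow> (z has_vector_derivative \<psi> s *\<^sub>R (\<i> * cis (\<theta> e t s))) (at s within pts I)"
    and p: "solves_bvp I a b (ths e t) \<psi> p"
  shows "elastic_metric I a b (\<gamma> e t) w z = integral {0..1} (\<lambda>s. b * \<phi> s * (\<psi> s - ths e t s * p s))"
proof -
  define k where "k = curvature I (\<gamma> e t)"
  define \<Phi> where "\<Phi> = (\<lambda>s. D I w s \<bullet> normal I (\<gamma> e t) s)"
  define \<Psi> where "\<Psi> = (\<lambda>s. D I z s \<bullet> normal I (\<gamma> e t) s)"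
  define p' where "p' = (SOME p. solves_bvp I a b k \<Psi> p)"
  have k: "k s = ths e t s" if "s \<in> pts I" for s
    using curvature_eq[OF et that] by (simp add: k_def)
  have \<Phi>: "\<Phi> s = \<phi> s" if "s \<in> pts I" for s
    unfolding \<Phi>_def normal_eq[OF et that] D_eqI[OF that w[OF that]] by (rule inner_normal)
  have \<Psi>: "\<Psi> s = \<psi> s" if "s \<in> pts I" for s
    unfolding \<Psi>_def normal_eq[OF et that] D_eqI[OF that z[OF that]] by (rule inner_normal)
  have "solves_bvp I a b k \<Psi> p" using p solves_bvp_cong[of I k "ths e t" \<Psi> \<psi> a b p, OF k \<Psi>] by simp
  then have "solves_bvp I a b k \<Psi> p'" unfolding p'_def by (rule someI[where P = "solves_bvp I a b k \<Psi>"])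
  then have p': "solves_bvp I a b (ths e t) \<psi> p'"
    using solves_bvp_cong[of I k "ths e t" \<Psi> \<psi> a b p', OF k \<Psi>] by simp
  have "elastic_metric I a b (\<gamma> e t) w z = integral {0..1} (\<lambda>s. b * \<Phi> s * (\<Psi> s - k s * p' s))"
    by (simp add: elastic_metric_def Let_def k_def \<Phi>_def \<Psi>_def p'_def)
  also have "\<dots> = integral {0..1} (\<lambda>s. b * \<phi> s * (\<psi> s - ths e t s * p s))"
  proof (rule integral_cong)
    fix s :: real assume "s \<in> {0..1}"
    then have s: "s \<in> pts I" using Icc_subset_pts by blast
    show "b * \<Phi> s * (\<Psi> s - k s * p' s) = b * \<phi> s * (\<psi> s - ths e t s * p s)"
      using k[OF s] \<Phi>[OF s] \<Psi>[OF s] solves_bvp_unique[OF et p' p s] by simp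
  qed
  finally show ?thesis .
qed

lemma zero_in_J: "0 \<in> J"
  using \<delta> by simp

text \<open>By symmetry of mixed partial derivatives the \<open>s\<close>-derivative of the velocity
  is the \<open>t\<close>-derivative of the unit tangent \<open>cis \<theta>\<close>.\<close>

lemma pd_t_curve:
  assumes et: "e \<in> J" "t \<in> {0..T}" and s: "s \<in> pts I"
  shows "(pd_t T (\<gamma> e) t has_vector_derivative tht e t s *\<^sub>R (\<i> * cis (\<theta> e t s))) (at s within pts I)"
proof -
  have "((\<lambda>t. cis (\<theta> e t s)) has_vector_derivative tht e t s *\<^sub>R (\<i> * cis (\<theta> e t s))) (at t within {0..T})"
    using sm_partials(5)[OF sm_\<theta> et s]
    by (intro cis_deriv) (simp add: has_real_derivative_iff_has_vector_derivative)
  then have "((\<lambda>t. pd_s I (\<gamma> e) t s) has_vector_derivative tht e t s *\<^sub>R (\<i> * cis (\<theta> e t s))) (at t within {0..T})"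
    by (rule has_vector_derivative_transform[OF et(2), rotated]) (simp only: pd_s_def curve(2)[OF et(1) _ s])
  then have "pd_t T (pd_s I (\<gamma> e)) t s = tht e t s *\<^sub>R (\<i> * cis (\<theta> e t s))"
    unfolding pd_t_def[of _ "pd_s I (\<gamma> e)"] by (rule vector_derivative_within[OF at_nontrivial(1)[OF et(2)]])
  with pd_t_pd_s[OF sm_\<gamma> et s] show ?thesis by simp
qed

lemma pd_e_curve:
  assumes et: "e \<in> J" "t \<in> {0..T}" and s: "s \<in> pts I"
  shows "(pd_e \<gamma> e t has_vector_derivative thv e t s *\<^sub>R (\<i> * cis (\<theta> e t s))) (at s within pts I)"
proof -
  have "((\<lambda>e. cis (\<theta> e t s)) has_vector_derivative thv e t s *\<^sub>R (\<i> * cis (\<theta> e t s))) (at e within J)"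
    using th_deriv(9)[OF et s] by (intro cis_deriv) (rule has_field_derivative_at_within)
  then have "((\<lambda>e. pd_s I (\<gamma> e) t s) has_vector_derivative thv e t s *\<^sub>R (\<i> * cis (\<theta> e t s))) (at e within J)"
    by (rule has_vector_derivative_transform[OF et(1), rotated]) (simp only: pd_s_def curve(2)[OF _ et(2) s])
  then have "((\<lambda>e. pd_s I (\<gamma> e) t s) has_vector_derivative thv e t s *\<^sub>R (\<i> * cis (\<theta> e t s))) (at e)"
    using at_within_open[of e J] et(1) by simp
  then have "pd_e (\<lambda>e. pd_s I (\<gamma> e)) e t s = thv e t s *\<^sub>R (\<i> * cis (\<theta> e t s))"
    unfolding pd_e_def[of "\<lambda>e. pd_s I (\<gamma> e)"] by (rule vector_derivative_at)
  with pd_e_pd_s[OF sm_\<gamma> et s] show ?thesis by simp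
qed

text \<open>At the two end times the curves agree up to translation, so \<open>cis \<theta>\<close>
  does not depend on \<open>e\<close>. Then \<open>\<theta>\<close> has the same derivative in
  \<open>e\<close> as the constant angle at \<open>e = 0\<close>.\<close>

lemma the_boundary:
  assumes t: "t = 0 \<or> t = T" and e: "e \<in> J" and s: "s \<in> pts I"
  shows "thv e t s = 0"
proof -
  have t': "t \<in> {0..T}" using t T by auto
  have cis_eq: "cis (\<theta> e t s) = cis (\<theta> 0 t s)" if e: "e \<in> J" for e
  proof -
    from var t e obtain z where z: "\<And>s. s \<in> pts I \<Longrightarrow> \<gamma> e t s = \<gamma> 0 t s + z"
      unfolding variation_def by blast
    have "((\<lambda>s. \<gamma> 0 t s + z) has_vector_derivative cis (\<theta> 0 t s)) (at s within pts I)"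
      using smooth_fun_D(2)[OF curve(1)[OF zero_in_J t'] s] curve(2)[OF zero_in_J t' s]
      by (auto intro!: derivative_eq_intros)
    then have "(\<gamma> e t has_vector_derivative cis (\<theta> 0 t s)) (at s within pts I)"
      by (rule has_vector_derivative_transform[OF s, rotated]) (use z in auto)
    from D_eqI[OF s this] show ?thesis using curve(2)[OF e t' s] by simp
  qed
  show ?thesis
  proof (rule cis_deriv_unique[OF _ DERIV_const cis_eq e at_nontrivial(2)[OF e]])
    show "((\<lambda>x. \<theta> x t s) has_real_derivative thv e t s) (at e within J)"
      using th_deriv(9)[OF e t' s] by (rule has_field_derivative_at_within)
  qed
qed

end

section \<open>The gradient\<close>

context elastic_variation
begin

lemma is_m_solves:
  assumes "is_m I T a b (\<theta> 0) m" "t \<in> {0..T}"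
  shows "solves_bvp I a b (ths 0 t) (tht 0 t) (m t)"
  using assms b by (simp add: is_m_def solves_bvp_rescale)

lemma is_m_smooth:
  assumes "is_m I T a b (\<theta> 0) m" "t \<in> {0..T}"
  shows "smooth_fun I (m t)"
  using is_m_solves[OF assms] by (simp add: solves_bvp_def)

lemma is_m_exists: "\<exists>m. is_m I T a b (\<theta> 0) m"
proof -
  have "\<forall>t\<in>{0..T}. \<exists>p. solves_bvp I (a / b) 1 (ths 0 t) (tht 0 t) p"
  proof
    fix t assume t: "t \<in> {0..T}"
    obtain p where "solves_bvp I a b (ths 0 t) (tht 0 t) p"
      using solves_bvp_exists[OF zero_in_J t th_smooth(2)[OF zero_in_J t]] by blast
    then show "\<exists>p. solves_bvp I (a / b) 1 (ths 0 t) (tht 0 t) p"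
      using b by (auto simp: solves_bvp_rescale)
  qed
  then show ?thesis unfolding is_m_def by (rule bchoice)
qed

text \<open>The \<open>t\<close>-derivative of the equation for \<open>m\<close>: the source is
  \<open>(b \<theta>_s \<theta>_t)_t\<close> minus \<open>(b \<theta>_s^2)_t m\<close>, the term in
  which the derivative falls on the potential.\<close>

lemma linearized_solution:
  assumes m: "is_m I T a b (\<theta> 0) m" and t: "t \<in> {0..T}"
  obtains p p' where "smooth_fun I p" "smooth_fun I p'"
    "\<forall>s\<in>pts I. (p has_real_derivative p' s) (at s within pts I)"
    "\<forall>s\<in>pts I. (p' has_real_derivative (b * (ths 0 t s)\<^sup>2 * p s
        - (b * (thst 0 t s * tht 0 t s + ths 0 t s * thtt 0 t s) - 2 * b * ths 0 t s * thst 0 t s * m t s)) / a)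
        (at s within pts I)"
    "bvp I a (\<lambda>s. b * (ths 0 t s)\<^sup>2)
        (\<lambda>s. b * (thst 0 t s * tht 0 t s + ths 0 t s * thtt 0 t s) - 2 * b * ths 0 t s * thst 0 t s * m t s) p p'"
proof -
  note z = zero_in_J
  define f where "f = (\<lambda>s. b * (thst 0 t s * tht 0 t s + ths 0 t s * thtt 0 t s) - 2 * b * ths 0 t s * thst 0 t s * m t s)"
  have f: "smooth_fun I f"
    unfolding f_def by (intro smooth_fun_intros th_smooth z t is_m_smooth[OF m])
  have q: "smooth_fun I (\<lambda>s. b * (ths 0 t s)\<^sup>2)"
    by (intro smooth_fun_intros th_smooth z t)
  obtain u u' where u: "bvp I a (\<lambda>s. b * (ths 0 t s)\<^sup>2) f u u'"
    using bvp_exists[OF a smooth_fun_continuous_on[OF f] q_props(1,2)[OF z t] q_props(4)[OF z t]] by blast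
  from bvp_extend[OF u q f] obtain p p' where p: "\<And>s. s \<in> {0..1} \<Longrightarrow> p s = u s" "\<And>s. s \<in> {0..1} \<Longrightarrow> p' s = u' s"
    "smooth_fun I p" "smooth_fun I p'"
    "\<And>s. s \<in> pts I \<Longrightarrow> (p has_real_derivative p' s) (at s within pts I)"
    "\<And>s. s \<in> pts I \<Longrightarrow> (p' has_real_derivative (b * (ths 0 t s)\<^sup>2 * p s - f s) / a) (at s within pts I)"
    by blast
  have "bvp I a (\<lambda>s. b * (ths 0 t s)\<^sup>2) f p p'"
    unfolding bvp_def
  proof (intro conjI ballI)
    fix s :: real assume "s \<in> {0..1}"
    then have s: "s \<in> pts I" using Icc_subset_pts by blast
    show "(p has_real_derivative p' s) (at s within {0..1})"
      "(p' has_real_derivative (b * (ths 0 t s)\<^sup>2 * p s - f s) / a) (at s within {0..1})"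
      using DERIV_subset[OF p(5)[OF s] Icc_subset_pts] DERIV_subset[OF p(6)[OF s] Icc_subset_pts] .
  next
    show "if I = Interval then p 0 = 0 \<and> p 1 = 0 else p 0 = p 1 \<and> p' 0 = p' 1"
      using u p(1)[of 0] p(1)[of 1] p(2)[of 0] p(2)[of 1] unfolding bvp_def by auto
  qed
  with p show thesis unfolding f_def by (intro that) blast+
qed

end

text \<open>\<open>v\<close> solves the equation of \<open>m\<close> differentiated formally in \<open>t\<close>, and turns out
  to be \<open>m\<^sub>t\<close>.\<close>

locale elastic_solution = elastic_variation +
  fixes m v v' :: "real \<Rightarrow> real \<Rightarrow> real"
  assumes m: "is_m I T a b (\<theta> 0) m"
    and v_smooth: "t \<in> {0..T} \<Longrightarrow> smooth_fun I (v t)" "t \<in> {0..T} \<Longrightarrow> smooth_fun I (v' t)"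
    and v_deriv: "t \<in> {0..T} \<Longrightarrow> s \<in> pts I \<Longrightarrow> (v t has_real_derivative v' t s) (at s within pts I)"
    and v'_deriv: "t \<in> {0..T} \<Longrightarrow> s \<in> pts I \<Longrightarrow> (v' t has_real_derivative (b * (ths 0 t s)\<^sup>2 * v t s
        - (b * (thst 0 t s * tht 0 t s + ths 0 t s * thtt 0 t s) - 2 * b * ths 0 t s * thst 0 t s * m t s)) / a)
        (at s within pts I)"
    and v_bvp: "t \<in> {0..T} \<Longrightarrow> bvp I a (\<lambda>s. b * (ths 0 t s)\<^sup>2)
        (\<lambda>s. b * (thst 0 t s * tht 0 t s + ths 0 t s * thtt 0 t s) - 2 * b * ths 0 t s * thst 0 t s * m t s)
        (v t) (v' t)"
begin

section \<open>Dependence of \<open>m\<close> on time\<close>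

abbreviation "m' t \<equiv> pd_s I m t"

lemmas m_solves = is_m_solves[OF m]
lemmas m_smooth = is_m_smooth[OF m]

lemma m_bvp:
  assumes "t \<in> {0..T}"
  shows "bvp I a (\<lambda>s. b * (ths 0 t s)\<^sup>2) (\<lambda>s. b * ths 0 t s * tht 0 t s) (m t) (m' t)"
  using solves_bvp_imp_bvp[OF m_solves[OF assms] a] by (simp add: pd_s_def[abs_def])

lemma m'_smooth:
  assumes "t \<in> {0..T}"
  shows "smooth_fun I (m' t)"
  using smooth_fun_D(1)[OF m_smooth[OF assms]] by (simp add: pd_s_def[abs_def])

lemma m_deriv:
  assumes t: "t \<in> {0..T}" and s: "s \<in> pts I"
  shows "(m t has_real_derivative m' t s) (at s within pts I)"
    and "(m' t has_real_derivative (b * (ths 0 t s)\<^sup>2 * m t s - b * ths 0 t s * tht 0 t s) / a) (at s within pts I)"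
proof -
  show "(m t has_real_derivative m' t s) (at s within pts I)"
    using smooth_fun_D(2)[OF m_smooth[OF t] s]
    by (simp add: has_real_derivative_iff_has_vector_derivative pd_s_def)
  have "(m' t has_vector_derivative D I (m' t) s) (at s within pts I)"
    by (rule smooth_fun_D(2)[OF m'_smooth[OF t] s])
  moreover have "D I (m' t) s = (b * (ths 0 t s)\<^sup>2 * m t s - b * ths 0 t s * tht 0 t s) / a"
    using m_solves[OF t] s a by (auto simp: solves_bvp_def pd_s_def[abs_def] field_simps)
  ultimately show "(m' t has_real_derivative (b * (ths 0 t s)\<^sup>2 * m t s - b * ths 0 t s * tht 0 t s) / a) (at s within pts I)"
    by (simp add: has_real_derivative_iff_has_vector_derivative)
qed

lemma th0_cont:
  "continuous_on ({0..T} \<times> {0..1}) (\<lambda>x. ths 0 (fst x) (snd x))"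
  "continuous_on ({0..T} \<times> {0..1}) (\<lambda>x. tht 0 (fst x) (snd x))"
  "continuous_on ({0..T} \<times> {0..1}) (\<lambda>x. thv 0 (fst x) (snd x))"
  "continuous_on ({0..T} \<times> {0..1}) (\<lambda>x. thst 0 (fst x) (snd x))"
  "continuous_on ({0..T} \<times> {0..1}) (\<lambda>x. thtt 0 (fst x) (snd x))"
  "continuous_on ({0..T} \<times> {0..1}) (\<lambda>x. thse 0 (fst x) (snd x))"
  "continuous_on ({0..T} \<times> {0..1}) (\<lambda>x. thte 0 (fst x) (snd x))"
  by (rule th_cont; use zero_in_J in \<open>auto intro!: continuous_intros subsetD[OF Icc_subset_pts]\<close>)+

lemma q_cont: "continuous_on ({0..T} \<times> {0..1}) (\<lambda>(t, s). b * (ths 0 t s)\<^sup>2)"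
  and f_cont: "continuous_on ({0..T} \<times> {0..1}) (\<lambda>(t, s). b * ths 0 t s * tht 0 t s)"
  and qt_cont: "continuous_on ({0..T} \<times> {0..1}) (\<lambda>(t, s). 2 * b * ths 0 t s * thst 0 t s)"
  and ft_cont: "continuous_on ({0..T} \<times> {0..1}) (\<lambda>(t, s). b * (thst 0 t s * tht 0 t s + ths 0 t s * thtt 0 t s))"
  unfolding split_beta by (intro continuous_intros th0_cont)+

lemma m_cont: "continuous_on ({0..T} \<times> {0..1}) (\<lambda>(t, s). m t s)"
  by (rule bvp_continuous_param[OF a compact_Icc q_cont _ f_cont b q_props(3)[OF zero_in_J] m_bvp])
    (use b in auto)

lemma v_cont: "continuous_on ({0..T} \<times> {0..1}) (\<lambda>(t, s). v t s)"
proof (rule bvp_continuous_param[OF a compact_Icc q_cont _ _ b q_props(3)[OF zero_in_J] v_bvp])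
  show "continuous_on ({0..T} \<times> {0..1}) (\<lambda>(t, s). b * (thst 0 t s * tht 0 t s + ths 0 t s * thtt 0 t s)
      - 2 * b * ths 0 t s * thst 0 t s * m t s)"
    using m_cont unfolding split_beta by (intro continuous_intros th0_cont)
qed (use b in auto)

text \<open>\<open>bvp_differentiable_param\<close> works on the unit interval. A point of the
  circle is moved there by periodicity, to the same \<open>r\<close> for all times.\<close>

lemma m_t_deriv:
  assumes t: "t \<in> {0..T}" and s: "s \<in> pts I"
  shows "((\<lambda>t. m t s) has_real_derivative v t s) (at t within {0..T})"
proof -
  obtain r where r: "r \<in> {0..1}" "\<And>f :: real \<Rightarrow> real. descends I f \<Longrightarrow> f s = f r"
    using pts_reduce[OF s] by blast
  have ms: "m t s = m t r" "v t s = v t r" if "t \<in> {0..T}" for t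
    using m_smooth[OF that] v_smooth(1)[OF that] by (auto simp: smooth_fun_def intro!: r(2))
  have pts: "s \<in> pts I" if "s \<in> {0..1}" for s using that Icc_subset_pts by blast
  have "((\<lambda>t. m t r) has_real_derivative v t r) (at t within {0..T})"
  proof (rule bvp_differentiable_param[OF a q_cont _ f_cont qt_cont _ ft_cont _ b q_props(3)[OF zero_in_J] m_bvp v_bvp t r(1)])
    fix t s :: real assume t: "t \<in> {0..T}" and s: "s \<in> {0..1}"
    note d = th_deriv(4,5)[OF zero_in_J t pts[OF s]]
    show "((\<lambda>t. b * (ths 0 t s)\<^sup>2) has_real_derivative 2 * b * ths 0 t s * thst 0 t s) (at t within {0..T})"
      using d by (auto intro!: derivative_eq_intros)
    show "((\<lambda>t. b * ths 0 t s * tht 0 t s) has_real_derivative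
        b * (thst 0 t s * tht 0 t s + ths 0 t s * thtt 0 t s)) (at t within {0..T})"
      using d by (auto intro!: derivative_eq_intros simp: algebra_simps)
  qed (use b in auto)
  then have "((\<lambda>t. m t r) has_real_derivative v t s) (at t within {0..T})" using ms t by simp
  then show ?thesis by (rule has_real_derivative_transform[OF t, rotated]) (rule ms)
qed

lemma pd_t_m:
  assumes t: "t \<in> {0..T}" and s: "s \<in> pts I"
  shows "pd_t T m t s = v t s"
  unfolding pd_t_def using m_t_deriv[OF assms]
  by (intro vector_derivative_within[OF at_nontrivial(1)[OF t]])
    (simp add: has_real_derivative_iff_has_vector_derivative)

abbreviation "X \<equiv> xi I T b (\<theta> 0) m"

lemma xi_eq:
  assumes t: "t \<in> {0..T}" and s: "s \<in> pts I"
  shows "X t s = b * (- thtt 0 t s + (thst 0 t s * m t s + ths 0 t s * v t s)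
    + (thst 0 t s * m t s + tht 0 t s * m' t s)
    - (thss 0 t s * (m t s)\<^sup>2 + 2 * ths 0 t s * m t s * m' t s))"
proof -
  note d = th_deriv[OF zero_in_J t s]
  have "((\<lambda>t. ths 0 t s * m t s) has_real_derivative thst 0 t s * m t s + ths 0 t s * v t s) (at t within {0..T})"
    using d(4) m_t_deriv[OF t s] by (auto intro!: derivative_eq_intros)
  then have 1: "pd_t T (\<lambda>t s. ths 0 t s * m t s) t s = thst 0 t s * m t s + ths 0 t s * v t s"
    unfolding pd_t_def[of _ "\<lambda>t s. ths 0 t s * m t s"]
    by (intro vector_derivative_within[OF at_nontrivial(1)[OF t]])
      (simp add: has_real_derivative_iff_has_vector_derivative)
  have "((\<lambda>s. tht 0 t s * m t s) has_real_derivative thst 0 t s * m t s + tht 0 t s * m' t s) (at s within pts I)"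
    using d(2) m_deriv[OF t s] by (auto intro!: derivative_eq_intros)
  then have 2: "pd_s I (\<lambda>t s. tht 0 t s * m t s) t s = thst 0 t s * m t s + tht 0 t s * m' t s"
    unfolding pd_s_def[of _ "\<lambda>t s. tht 0 t s * m t s"]
    by (intro D_eqI s) (simp add: has_real_derivative_iff_has_vector_derivative)
  have "((\<lambda>s. ths 0 t s * (m t s)\<^sup>2) has_real_derivative
      thss 0 t s * (m t s)\<^sup>2 + 2 * ths 0 t s * m t s * m' t s) (at s within pts I)"
    using d(1) m_deriv[OF t s] by (auto intro!: derivative_eq_intros)
  then have 3: "pd_s I (\<lambda>t s. ths 0 t s * (m t s)\<^sup>2) t s =
      thss 0 t s * (m t s)\<^sup>2 + 2 * ths 0 t s * m t s * m' t s"
    unfolding pd_s_def[of _ "\<lambda>t s. ths 0 t s * (m t s)\<^sup>2"]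
    by (intro D_eqI s) (simp add: has_real_derivative_iff_has_vector_derivative)
  show ?thesis unfolding xi_def 1 2 3 by simp
qed

lemma xi_smooth:
  assumes t: "t \<in> {0..T}"
  shows "smooth_fun I (X t)"
proof (rule smooth_fun_cong)
  show "smooth_fun I (\<lambda>s. b * (- thtt 0 t s + (thst 0 t s * m t s + ths 0 t s * v t s)
    + (thst 0 t s * m t s + tht 0 t s * m' t s)
    - (thss 0 t s * (m t s)\<^sup>2 + 2 * ths 0 t s * m t s * m' t s)))"
    by (intro smooth_fun_intros th_smooth zero_in_J t m_smooth v_smooth m'_smooth)
qed (simp add: xi_eq[OF t])

section \<open>Primitives of the product of \<open>\<theta>_s\<close> and
  \<open>\<xi>\<close>\<close>

definition "R t s = (m' t s)\<^sup>2 + b / a * (ths 0 t s)\<^sup>2 * (m t s)\<^sup>2 - b / a * (tht 0 t s)\<^sup>2"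

definition "K t s = (LBINT x=ereal 0..ereal s. R t x)"

text \<open>The primitive of \<open>\<theta>_s \<xi>\<close>, with \<open>v'\<close> in the role of
  \<open>m_st\<close>. It is built from smooth functions that descend to the circle, so there
  \<open>\<theta>_s \<xi>\<close> has mean zero; this is the solvability condition for
  \<open>- a h'' = \<theta>_s \<xi>\<close>.\<close>

definition "H t s = a * v' t s - a / 2 * R t s"

lemma R_smooth: "t \<in> {0..T} \<Longrightarrow> smooth_fun I (R t)"
  unfolding R_def[abs_def] by (intro smooth_fun_intros th_smooth zero_in_J m_smooth m'_smooth)

lemma smooth_fun_continuous_pts: "smooth_fun I f \<Longrightarrow> continuous_on (pts I) f"
  by (auto simp: smooth_fun_def intro: smooth_on_imp_continuous)

lemma K_deriv:
  assumes "t \<in> {0..T}" "s \<in> pts I"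
  shows "(K t has_real_derivative R t s) (at s within pts I)"
  unfolding K_def[abs_def] has_real_derivative_iff_has_vector_derivative
  by (rule FTC_pts[OF smooth_fun_continuous_pts[OF R_smooth[OF assms(1)]] assms(2)])

lemma K_0: "K t 0 = 0"
  unfolding K_def by (rule interval_integral_endpoints_same)

text \<open>\<open>a v_ss\<close>, taken from the differentiated equation, accounts for all terms of
  \<open>\<theta>_s \<xi>\<close> with \<open>\<theta>_tt\<close> or \<open>v\<close>. What remains
  is \<open>b (\<theta>_t \<theta>_st + \<theta>_s \<theta>_t m_s - \<theta>_s \<theta>_ss m^2 - 2
  \<theta>_s^2 m m_s)\<close>, and this is \<open>- a / 2 * R_s\<close> by the equation for
  \<open>m\<close>.\<close>

lemma H_deriv:
  assumes t: "t \<in> {0..T}" and s: "s \<in> pts I"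
  shows "(H t has_real_derivative ths 0 t s * X t s) (at s within pts I)"
proof -
  \<comment> \<open>Here \<open>k\<close>, \<open>kt\<close>, \<open>ks\<close> stand for
    \<open>\<theta>_s\<close> and its derivatives, \<open>h\<close> and \<open>ht\<close> for
    \<open>\<theta>_t\<close> and \<open>\<theta>_tt\<close>, \<open>n\<close> and \<open>n'\<close>
    for \<open>m\<close> and \<open>m_s\<close>, and \<open>w\<close> for \<open>v\<close>.\<close>
  have alg: "a * ((b * k\<^sup>2 * w - (b * (kt * h + k * ht) - 2 * b * k * kt * n)) / a)
      - a / 2 * (2 * n' * ((b * k\<^sup>2 * n - b * k * h) / a)
        + b / a * (2 * k * ks * n\<^sup>2 + 2 * k\<^sup>2 * n * n') - b / a * (2 * h * kt))
    = k * (b * (- ht + (kt * n + k * w) + (kt * n + h * n') - (ks * n\<^sup>2 + 2 * k * n * n')))"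
    for k kt ks h ht n n' w :: real
    using a by (simp add: field_simps power2_eq_square)
  note d = th_deriv[OF zero_in_J t s]
  have R: "((\<lambda>s. (m' t s)\<^sup>2 + c * (ths 0 t s)\<^sup>2 * (m t s)\<^sup>2 - c * (tht 0 t s)\<^sup>2) has_real_derivative
      2 * m' t s * ((b * (ths 0 t s)\<^sup>2 * m t s - b * ths 0 t s * tht 0 t s) / a)
      + c * (2 * ths 0 t s * thss 0 t s * (m t s)\<^sup>2 + 2 * (ths 0 t s)\<^sup>2 * m t s * m' t s)
      - c * (2 * tht 0 t s * thst 0 t s)) (at s within pts I)" for c
    using d(1,2) m_deriv[OF t s] by (auto intro!: derivative_eq_intros simp: algebra_simps)
  have "(R t has_real_derivative 2 * m' t s * ((b * (ths 0 t s)\<^sup>2 * m t s - b * ths 0 t s * tht 0 t s) / a)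
      + b / a * (2 * ths 0 t s * thss 0 t s * (m t s)\<^sup>2 + 2 * (ths 0 t s)\<^sup>2 * m t s * m' t s)
      - b / a * (2 * tht 0 t s * thst 0 t s)) (at s within pts I)"
    unfolding R_def[abs_def] by (rule R)
  from DERIV_diff[OF DERIV_cmult[OF v'_deriv[OF t s], of a] DERIV_cmult[OF this, of "a / 2"]]
  show ?thesis unfolding H_def[abs_def] xi_eq[OF t s] alg .
qed

lemma v_boundary:
  assumes "t \<in> {0..T}"
  shows "v t 1 = v t 0" "I = Interval \<Longrightarrow> v t 0 = 0"
  using v_bvp[OF assms] by (auto simp: bvp_def split: if_splits)

text \<open>The inner integral is \<open>H t x - H t 0\<close>, and \<open>a v - a / 2 * K\<close>
  is a primitive of \<open>H\<close>.\<close>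

lemma double_int_eq:
  assumes t: "t \<in> {0..T}" and s: "s \<in> pts I"
  shows "double_int (\<lambda>y. ths 0 t y * X t y) s = a * (v t s - v t 0) - a / 2 * K t s - s * H t 0"
proof -
  have kx: "continuous_on (pts I) (\<lambda>y. ths 0 t y * X t y)"
    by (intro smooth_fun_continuous_pts smooth_fun_mult th_smooth zero_in_J t xi_smooth)
  have H: "continuous_on (pts I) (\<lambda>x. H t x - H t 0)"
    unfolding H_def[abs_def]
    by (intro smooth_fun_continuous_pts smooth_fun_intros v_smooth R_smooth t)
  have "double_int (\<lambda>y. ths 0 t y * X t y) s = (LBINT x=ereal 0..ereal s. H t x - H t 0)"
    unfolding double_int_def
  proof (rule interval_integral_cong)
    fix x assume "x \<in> einterval (min (ereal 0) (ereal s)) (max (ereal 0) (ereal s))"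
    then have "x \<in> {min 0 s..max 0 s}"
      by (auto simp: einterval_def min_def max_def split: if_splits)
    then have x: "x \<in> pts I" using s by (cases I) auto
    show "(LBINT y=ereal 0..ereal x. ths 0 t y * X t y) = H t x - H t 0"
      by (rule LBINT_pts[OF H_deriv[OF t] kx x])
  qed
  also have "\<dots> = (a * v t s - a / 2 * K t s - s * H t 0) - (a * v t 0 - a / 2 * K t 0 - 0 * H t 0)"
  proof (rule LBINT_pts[OF _ H s])
    fix s assume s: "s \<in> pts I"
    show "((\<lambda>s. a * v t s - a / 2 * K t s - s * H t 0) has_real_derivative H t s - H t 0) (at s within pts I)"
      using v_deriv[OF t s] K_deriv[OF t s] by (auto intro!: derivative_eq_intros simp: H_def)
  qed
  finally show ?thesis by (simp add: K_0 algebra_simps)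
qed

text \<open>The solution of \<open>- a h'' = \<theta>_s \<xi>\<close> that vanishes at 0 and 1: the
  double integral divided by \<open>- a\<close>, with the linear term added that makes it vanish at
  1. For the interval it is the field \<open>h\<close> of the gradient, for the circle it is one
  choice of it.\<close>

definition "P t s = - (v t s - v t 0) + 1 / 2 * (K t s - s * K t 1)"

definition "P' t s = - (1 / a * H t s) - 1 / 2 * K t 1"

lemma one_in_pts: "1 \<in> pts I" "0 \<in> pts I"
  by (cases I; simp)+

abbreviation "\<beta>\<^sub>\<xi> \<equiv> beta_xi I T a b (\<theta> 0) m"

text \<open>The contributions of \<open>H t 0\<close> to the two double integrals cancel, and
  \<open>v t 1 = v t 0\<close> by the boundary conditions.\<close>

lemma beta_xi_eq:
  assumes t: "t \<in> {0..T}" and s: "s \<in> pts I"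
  shows "\<beta>\<^sub>\<xi> t s = 1 / b * X t s + ths 0 t s * P t s"
proof -
  have "1 / a * k * (a * x - a / 2 * y - z * h) = k * x - k * y / 2 - k * z * h / a" for k x y z h
    using a by (simp add: field_simps)
  from this[of "ths 0 t s" "v t s - v t 0" "K t s" s "H t 0"] this[of "s * ths 0 t s" 0 "K t 1" 1 "H t 0"]
  show ?thesis
    unfolding beta_xi_def double_int_eq[OF t s] double_int_eq[OF t one_in_pts(1)] v_boundary(1)[OF t] P_def
    by (simp add: algebra_simps)
qed

lemma P_deriv:
  assumes t: "t \<in> {0..T}" and s: "s \<in> pts I"
  shows "(P t has_real_derivative P' t s) (at s within pts I)"
    "(P' t has_real_derivative - (1 / a * (ths 0 t s * X t s))) (at s within pts I)"
proof -
  show "(P t has_real_derivative P' t s) (at s within pts I)"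
    unfolding P_def[abs_def] P'_def H_def using v_deriv[OF t s] K_deriv[OF t s] a
    by (auto intro!: derivative_eq_intros simp: field_simps)
  show "(P' t has_real_derivative - (1 / a * (ths 0 t s * X t s))) (at s within pts I)"
    unfolding P'_def[abs_def]
    using DERIV_diff[OF DERIV_minus[OF DERIV_cmult[OF H_deriv[OF t s], of "1 / a"]] DERIV_const[of "1 / 2 * K t 1"]]
    by simp
qed

lemma P_boundary: "P t 0 = 0" "t \<in> {0..T} \<Longrightarrow> P t 1 = 0"
  by (simp_all add: P_def K_0 v_boundary(1))

lemma P_smooth:
  assumes t: "t \<in> {0..T}"
  shows "smooth_fun I (P t)" "smooth_fun I (P' t)"
proof -
  show P': "smooth_fun I (P' t)"
    unfolding P'_def[abs_def] H_def
    by (intro smooth_fun_intros v_smooth R_smooth t)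
  have "smooth_on (pts I) (P t)"
    by (rule smooth_on_antiderivative[OF P_deriv(1)[OF t]]) (use P' in \<open>simp_all add: smooth_fun_def\<close>)
  moreover have "descends I (P t)"
  proof (cases I)
    case Circle
    have d: "(P t has_real_derivative P' t s) (at s)" for s using P_deriv(1)[OF t] Circle by simp
    \<comment> \<open>Since \<open>P'\<close> is periodic, the increment of \<open>P\<close> over a
      period is constant in \<open>s\<close>; it equals \<open>P t 1 - P t 0 = 0\<close>.\<close>
    have "((\<lambda>s. P t (s + 1) - P t s) has_real_derivative P' t (s + 1) - P' t s) (at s)" for s
      by (intro DERIV_diff d) (simp add: DERIV_shift[symmetric] d)
    moreover have "P' t (s + 1) = P' t s" for s using P' Circle by (simp add: smooth_fun_def)
    ultimately have "\<forall>s. ((\<lambda>s. P t (s + 1) - P t s) has_real_derivative 0) (at s)" by simp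
    then have "P t (s + 1) - P t s = P t (0 + 1) - P t 0" for s by (rule DERIV_isconst_all)
    then show ?thesis using Circle P_boundary t by simp
  qed simp
  ultimately show "smooth_fun I (P t)" by (simp add: smooth_fun_def)
qed

text \<open>The two formulas differ by \<open>v t 0 * \<theta>_s\<close>, where \<open>v\<close> is
  \<open>m_t\<close>; this vanishes for the interval. The function \<open>C\<close> enters because
  the Green identity for \<open>m\<close> tested with \<open>m\<close> itself gives
  \<open>K t 1 = b / a * C\<close>.\<close>

lemma formulas_agree: "same_field I T (\<theta> 0) (beta_m I T a b (\<theta> 0) m) \<beta>\<^sub>\<xi>"
  unfolding same_field_def
proof (intro ballI exI[of _ "- v t 0" for t] conjI impI)
  fix t assume t: "t \<in> {0..T}"
  show "I = Interval \<Longrightarrow> - v t 0 = 0" using v_boundary(2)[OF t] by simp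
  fix s assume s: "s \<in> pts I"
  have K1: "K t 1 = integral {0..1} (R t)"
    unfolding K_def
    using borel_integrable_atLeastAtMost'[OF smooth_fun_continuous_on[OF R_smooth[OF t]]]
    by (intro interval_integral_eq_integral) auto
  have i: "continuous_on {0..1} (\<lambda>s. ths 0 t s * tht 0 t s * m t s)" "continuous_on {0..1} (\<lambda>s. (tht 0 t s)\<^sup>2)"
    by (intro smooth_fun_continuous_on[of I] smooth_fun_intros th_smooth zero_in_J t m_smooth)+
  have "((\<lambda>s. b / a * (ths 0 t s * tht 0 t s * m t s - (tht 0 t s)\<^sup>2)) has_integral b / a * C_fun I T (\<theta> 0) m t) {0..1}"
    unfolding C_fun_def using i
    by (intro has_integral_mult_right has_integral_diff integrable_integral integrable_continuous_interval)
  moreover have "((\<lambda>s. 1 / a * (a * (m' t s * m' t s) + (b * (ths 0 t s)\<^sup>2 * m t s - b * ths 0 t s * tht 0 t s) * m t s))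
      has_integral 1 / a * 0) {0..1}"
    using bvp_green[OF m_bvp[OF t] m_bvp[OF t]] a by (intro has_integral_mult_right) auto
  ultimately have "((\<lambda>s. 1 / a * (a * (m' t s * m' t s) + (b * (ths 0 t s)\<^sup>2 * m t s - b * ths 0 t s * tht 0 t s) * m t s)
      + b / a * (ths 0 t s * tht 0 t s * m t s - (tht 0 t s)\<^sup>2)) has_integral 1 / a * 0 + b / a * C_fun I T (\<theta> 0) m t) {0..1}"
    by (intro has_integral_add)
  moreover have "1 / a * (a * (m' t s * m' t s) + (b * (ths 0 t s)\<^sup>2 * m t s - b * ths 0 t s * tht 0 t s) * m t s)
      + b / a * (ths 0 t s * tht 0 t s * m t s - (tht 0 t s)\<^sup>2) = R t s" for s
    unfolding R_def using a by (simp add: field_simps power2_eq_square)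
  ultimately have "K t 1 = b / a * C_fun I T (\<theta> 0) m t"
    unfolding K1 by (simp add: integral_unique)
  moreover have "beta_m I T a b (\<theta> 0) m t s = 1 / b * X t s - ths 0 t s * v t s
      - b / (2 * a) * C_fun I T (\<theta> 0) m t * s * ths 0 t s + 1 / 2 * ths 0 t s * K t s"
    unfolding beta_m_def K_def R_def pd_t_m[OF t s] ..
  ultimately show "beta_m I T a b (\<theta> 0) m t s = \<beta>\<^sub>\<xi> t s + - v t 0 * ths 0 t s"
    unfolding beta_xi_eq[OF t s] P_def by (simp add: algebra_simps)
qed

text \<open>Adding a constant \<open>c\<close> to \<open>P\<close> changes the left hand side by
  \<open>b \<theta>_s^2 c\<close>, which is matched by the summand \<open>c \<theta>_s\<close> of
  \<open>\<beta>\<close>.\<close>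

lemma P_solves:
  assumes t: "t \<in> {0..T}" and c: "I = Interval \<Longrightarrow> c = 0"
    and \<beta>: "\<And>s. s \<in> pts I \<Longrightarrow> \<beta> s = \<beta>\<^sub>\<xi> t s + c * ths 0 t s"
  shows "solves_bvp I a b (ths 0 t) \<beta> (\<lambda>s. P t s + c)"
  unfolding solves_bvp_def
proof (intro conjI[of "smooth_fun I (\<lambda>s. P t s + c)"] conjI[of "_ \<longrightarrow> _"] ballI)
  show "smooth_fun I (\<lambda>s. P t s + c)" by (intro smooth_fun_intros P_smooth t)
  show "I = Interval \<longrightarrow> P t 0 + c = 0 \<and> P t 1 + c = 0" using P_boundary t c by auto
  fix s assume s: "s \<in> pts I"
  have 1: "D I (\<lambda>s. P t s + c) s = P' t s" if "s \<in> pts I" for s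
    by (rule D_eqI[OF that]) (use P_deriv(1)[OF t that] in
      \<open>auto intro!: derivative_eq_intros simp: has_real_derivative_iff_has_vector_derivative\<close>)
  have "D I (D I (\<lambda>s. P t s + c)) s = D I (P' t) s" by (rule D_cong[OF s 1])
  also have "\<dots> = - (1 / a * (ths 0 t s * X t s))"
    by (rule D_eqI[OF s]) (use P_deriv(2)[OF t s] in \<open>simp add: has_real_derivative_iff_has_vector_derivative\<close>)
  finally have 2: "D I (D I (\<lambda>s. P t s + c)) s = - (1 / a * (ths 0 t s * X t s))" .
  show "- a * D I (D I (\<lambda>s. P t s + c)) s + b * (ths 0 t s)\<^sup>2 * (P t s + c) = b * ths 0 t s * \<beta> s"
    unfolding 2 \<beta>[OF s] beta_xi_eq[OF t s] using a b by (simp add: field_simps power2_eq_square)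
qed

section \<open>The fields that represent the first variation\<close>

lemma tangent_field_iff:
  assumes t: "t \<in> {0..T}"
  shows "tangent_field I (\<gamma> 0 t) \<phi> w \<longleftrightarrow> smooth_fun I \<phi> \<and>
    (\<forall>s\<in>pts I. (w has_vector_derivative \<phi> s *\<^sub>R (\<i> * cis (\<theta> 0 t s))) (at s within pts I))"
  using normal_eq[OF zero_in_J t] by (auto simp: tangent_field_def)

text \<open>The condition at a single time. Different times do not interact, so a gradient along the
  whole path is obtained by a choice at each time.\<close>

definition gradient_at :: "real \<Rightarrow> (real \<Rightarrow> complex) \<Rightarrow> bool" where
  "gradient_at t w \<longleftrightarrow> (\<exists>\<beta>. tangent_field I (\<gamma> 0 t) \<beta> w) \<and>
     (\<forall>f z. tangent_field I (\<gamma> 0 t) f z \<longrightarrow>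
        integral {0..1} (\<lambda>s. f s * X t s) = elastic_metric I a b (\<gamma> 0 t) z w)"

lemma antiderivative_pts:
  fixes f :: "real \<Rightarrow> complex"
  assumes "continuous_on (pts I) f"
  obtains F where "\<And>s. s \<in> pts I \<Longrightarrow> (F has_vector_derivative f s) (at s within pts I)"
  using FTC_pts[OF assms] that by blast

lemma normal_cont:
  assumes t: "t \<in> {0..T}"
  shows "continuous_on (pts I) (\<lambda>s. \<i> * cis (\<theta> 0 t s))"
proof -
  have "continuous_on (pts I) (\<theta> 0 t)"
    by (rule sm_continuous_compose[OF sm_\<theta>]) (use t zero_in_J in \<open>auto intro!: continuous_intros\<close>)
  then show ?thesis by (intro continuous_intros)
qed

lemma gradient_at_if:
  assumes t: "t \<in> {0..T}" and c: "I = Interval \<Longrightarrow> c = 0"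
    and \<beta>: "\<And>s. s \<in> pts I \<Longrightarrow> \<beta> s = \<beta>\<^sub>\<xi> t s + c * ths 0 t s"
    and w: "\<And>s. s \<in> pts I \<Longrightarrow> (w has_vector_derivative \<beta> s *\<^sub>R (\<i> * cis (\<theta> 0 t s))) (at s within pts I)"
  shows "gradient_at t w"
proof -
  have \<beta>_eq: "\<beta> s = 1 / b * X t s + ths 0 t s * (P t s + c)" if "s \<in> pts I" for s
    using \<beta>[OF that] beta_xi_eq[OF t that] by (simp add: algebra_simps)
  have "smooth_fun I (\<lambda>s. 1 / b * X t s + ths 0 t s * (P t s + c))"
    by (intro smooth_fun_intros th_smooth zero_in_J t xi_smooth P_smooth)
  then have "smooth_fun I \<beta>"
    by (rule smooth_fun_cong) (simp add: \<beta>_eq)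
  with w have "tangent_field I (\<gamma> 0 t) \<beta> w" by (simp add: tangent_field_iff[OF t])
  moreover have "integral {0..1} (\<lambda>s. f s * X t s) = elastic_metric I a b (\<gamma> 0 t) z w"
    if "tangent_field I (\<gamma> 0 t) f z" for f z
  proof -
    have "elastic_metric I a b (\<gamma> 0 t) z w = integral {0..1} (\<lambda>s. b * f s * (\<beta> s - ths 0 t s * (P t s + c)))"
      by (rule metric_eq[OF zero_in_J t _ w P_solves[OF t c \<beta>]])
        (use that in \<open>auto simp: tangent_field_iff[OF t]\<close>)
    also have "\<dots> = integral {0..1} (\<lambda>s. f s * X t s)"
    proof (rule integral_cong)
      fix s :: real assume "s \<in> {0..1}"
      then have "s \<in> pts I" using Icc_subset_pts by blast
      from \<beta>_eq[OF this] show "b * f s * (\<beta> s - ths 0 t s * (P t s + c)) = f s * X t s"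
        using b by simp
    qed
    finally show ?thesis by simp
  qed
  ultimately show ?thesis unfolding gradient_at_def by blast
qed

text \<open>Testing with the defect \<open>\<xi> - b (\<beta> - \<theta>_s r)\<close> shows that it
  vanishes, where \<open>r\<close> is the auxiliary function of \<open>\<beta>\<close>. Then
  \<open>r\<close> and \<open>P\<close> solve the same equation without zero order term, so they
  differ by a constant.\<close>

lemma gradient_at_only_if:
  assumes t: "t \<in> {0..T}" and grad: "gradient_at t w"
  obtains \<beta> c where "I = Interval \<Longrightarrow> c = 0"
    "\<And>s. s \<in> pts I \<Longrightarrow> \<beta> s = \<beta>\<^sub>\<xi> t s + c * ths 0 t s"
    "\<And>s. s \<in> pts I \<Longrightarrow> (w has_vector_derivative \<beta> s *\<^sub>R (\<i> * cis (\<theta> 0 t s))) (at s within pts I)"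
proof -
  note z = zero_in_J
  from grad obtain \<beta> where \<beta>: "tangent_field I (\<gamma> 0 t) \<beta> w"
    and rep: "\<And>f z. tangent_field I (\<gamma> 0 t) f z \<Longrightarrow>
        integral {0..1} (\<lambda>s. f s * X t s) = elastic_metric I a b (\<gamma> 0 t) z w"
    unfolding gradient_at_def by blast
  from \<beta> have \<beta>_smooth: "smooth_fun I \<beta>"
    and w: "\<And>s. s \<in> pts I \<Longrightarrow> (w has_vector_derivative \<beta> s *\<^sub>R (\<i> * cis (\<theta> 0 t s))) (at s within pts I)"
    by (auto simp: tangent_field_iff[OF t])
  obtain r where r: "solves_bvp I a b (ths 0 t) \<beta> r"
    by (rule solves_bvp_exists[OF z t \<beta>_smooth])
  have r_smooth: "smooth_fun I r" using r by (simp add: solves_bvp_def)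
  \<comment> \<open>The field with derivative \<open>g n\<close> is an admissible test field
    although it need not close up, since no closure constraint is imposed on tangent fields.\<close>
  define g where "g s = X t s - b * (\<beta> s - ths 0 t s * r s)" for s
  have g: "smooth_fun I g"
    unfolding g_def[abs_def]
    by (intro smooth_fun_intros th_smooth z t xi_smooth r_smooth \<beta>_smooth)
  have "continuous_on (pts I) (\<lambda>s. g s *\<^sub>R (\<i> * cis (\<theta> 0 t s)))"
    by (intro continuous_on_scaleR smooth_fun_continuous_pts[OF g] normal_cont t)
  then obtain y where y: "\<And>s. s \<in> pts I \<Longrightarrow> (y has_vector_derivative g s *\<^sub>R (\<i> * cis (\<theta> 0 t s))) (at s within pts I)"
    by (rule antiderivative_pts) blast
  have cont: "continuous_on {0..1} (\<lambda>s. g s * X t s)"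
    "continuous_on {0..1} (\<lambda>s. b * g s * (\<beta> s - ths 0 t s * r s))" "continuous_on {0..1} (\<lambda>s. (g s)\<^sup>2)"
    by (intro smooth_fun_continuous_on[of I] smooth_fun_intros g th_smooth z t xi_smooth r_smooth \<beta>_smooth)+
  have "integral {0..1} (\<lambda>s. g s * X t s) = elastic_metric I a b (\<gamma> 0 t) y w"
    by (rule rep) (use g y in \<open>simp add: tangent_field_iff[OF t]\<close>)
  also have "\<dots> = integral {0..1} (\<lambda>s. b * g s * (\<beta> s - ths 0 t s * r s))"
    by (rule metric_eq[OF z t y w r])
  finally have "integral {0..1} (\<lambda>s. g s * X t s - b * g s * (\<beta> s - ths 0 t s * r s)) = 0"
    using cont by (simp add: integral_diff integrable_continuous_interval)
  moreover have "g s * X t s - b * g s * (\<beta> s - ths 0 t s * r s) = (g s)\<^sup>2" for s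
    by (simp add: g_def power2_eq_square algebra_simps)
  ultimately have "integral {0..1} (\<lambda>s. (g s)\<^sup>2) = 0" by simp
  then have g0: "g s = 0" if "s \<in> {0..1}" for s
    using integral_eq_0_iff[OF cont(3)] that by simp
  have pts: "s \<in> pts I" if "s \<in> {0..1}" for s using that Icc_subset_pts by blast
  have \<beta>_eq: "\<beta> s = 1 / b * X t s + ths 0 t s * r s" if "s \<in> {0..1}" for s
    using g0[OF that] b by (simp add: g_def field_simps)
  note R = solves_bvp_imp_bvp[OF r a]
  have P0: "solves_bvp I a b (ths 0 t) \<beta>\<^sub>\<xi>' (\<lambda>s. P t s + 0)" if "\<beta>\<^sub>\<xi>' = \<beta>\<^sub>\<xi> t" for \<beta>\<^sub>\<xi>'
    by (rule P_solves[OF t]) (use that in auto)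
  note P0 = solves_bvp_imp_bvp[OF P0[OF refl] a]
  have R': "bvp I a (\<lambda>s. 0) (\<lambda>s. ths 0 t s * X t s) r (D I r)"
  proof (rule bvp_cong[OF R])
    fix s :: real assume s: "s \<in> {0..1}"
    show "b * (ths 0 t s)\<^sup>2 * r s - b * ths 0 t s * \<beta> s = 0 * r s - ths 0 t s * X t s"
      unfolding \<beta>_eq[OF s] using b by (simp add: field_simps power2_eq_square)
  qed
  have P0': "bvp I a (\<lambda>s. 0) (\<lambda>s. ths 0 t s * X t s) (\<lambda>s. P t s + 0) (D I (\<lambda>s. P t s + 0))"
  proof (rule bvp_cong[OF P0])
    fix s :: real assume s: "s \<in> {0..1}"
    show "b * (ths 0 t s)\<^sup>2 * (P t s + 0) - b * ths 0 t s * \<beta>\<^sub>\<xi> t s = 0 * (P t s + 0) - ths 0 t s * X t s"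
      unfolding beta_xi_eq[OF t pts[OF s]] using b by (simp add: field_simps power2_eq_square)
  qed
  \<comment> \<open>With potential zero the energy identity only gives \<open>d' = 0\<close>. On the
    interval the boundary value removes the constant, on the circle it remains as
    \<open>c\<close>.\<close>
  define d where "d s = r s - P t s" for s
  obtain d' where d: "bvp I a (\<lambda>s. 0) (\<lambda>s. 0) d d'"
    using bvp_diff[OF R' P0'] by (simp add: d_def[abs_def])
  from bvp_green[OF d d] a have "((\<lambda>s. a * (d' s)\<^sup>2) has_integral 0) {0..1}"
    by (simp add: power2_eq_square)
  then have "((\<lambda>s. 1 / a * (a * (d' s)\<^sup>2)) has_integral 1 / a * 0) {0..1}"
    by (rule has_integral_mult_right)
  then have "integral {0..1} (\<lambda>s. (d' s)\<^sup>2) = 0" using a by (simp add: integral_unique)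
  then have le: "(d s - d 0)\<^sup>2 \<le> 0" if "s \<in> {0..1}" for s
    using sq_diff_le_integral_deriv[of d d' s 0] d bvp_continuous(2)[OF d] that by (simp add: bvp_def)
  have d0: "d s = d 0" if "s \<in> {0..1}" for s using le[OF that] by simp
  show thesis
  proof (rule that[OF _ _ w])
    show "I = Interval \<Longrightarrow> d 0 = 0" using d by (simp add: bvp_def)
    fix s assume s: "s \<in> pts I"
    \<comment> \<open>The formula for \<open>\<beta>\<close> is known on the unit interval so far.
      Written with \<open>P\<close> instead of the double integrals, both sides visibly descend to
      the circle.\<close>
    define h where "h s = \<beta> s - (1 / b * X t s + ths 0 t s * (P t s + d 0))" for s
    have "smooth_fun I h"
      unfolding h_def[abs_def]
      by (intro smooth_fun_intros th_smooth z t xi_smooth P_smooth \<beta>_smooth)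
    then have per: "descends I h" by (simp add: smooth_fun_def)
    obtain x where x: "x \<in> {0..1}" "\<And>f :: real \<Rightarrow> real. descends I f \<Longrightarrow> f s = f x"
      using pts_reduce[OF s] by blast
    have "h s = h x" by (rule x(2)[OF per])
    also have "h x = 0"
      using \<beta>_eq[OF x(1)] d0[OF x(1)] unfolding h_def d_def[of x] by (simp add: algebra_simps)
    finally show "\<beta> s = \<beta>\<^sub>\<xi> t s + d 0 * ths 0 t s"
      unfolding beta_xi_eq[OF t s] h_def by (simp add: algebra_simps)
  qed
qed

lemma is_gradient_iff: "is_gradient I T a b (\<gamma> 0) X W \<longleftrightarrow> (\<forall>t\<in>{0..T}. gradient_at t (W t))"
  by (simp add: is_gradient_def gradient_at_def)

lemma normal_Complex: "\<i> * cis x = Complex (- sin x) (cos x)"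
  by (simp add: complex_eq_iff)

lemma gradient_formula:
  "is_gradient I T a b (\<gamma> 0) X W \<longleftrightarrow>
    (\<exists>\<beta>. same_field I T (\<theta> 0) \<beta> \<beta>\<^sub>\<xi> \<and>
      (\<forall>t\<in>{0..T}. \<forall>s\<in>pts I.
         (W t has_vector_derivative
            \<beta> t s *\<^sub>R Complex (- sin (\<theta> 0 t s)) (cos (\<theta> 0 t s))) (at s within pts I)))"
  (is "?L = ?R")
proof
  assume ?L
  then have "\<forall>t\<in>{0..T}. \<exists>\<beta>. (\<exists>c. (I = Interval \<longrightarrow> c = 0) \<and> (\<forall>s\<in>pts I. \<beta> s = \<beta>\<^sub>\<xi> t s + c * ths 0 t s)) \<and>
      (\<forall>s\<in>pts I. (W t has_vector_derivative \<beta> s *\<^sub>R Complex (- sin (\<theta> 0 t s)) (cos (\<theta> 0 t s))) (at s within pts I))"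
    unfolding is_gradient_iff using gradient_at_only_if unfolding normal_Complex by metis
  from bchoice[OF this] show ?R unfolding same_field_def by blast
next
  assume ?R
  then obtain \<beta> where \<beta>: "same_field I T (\<theta> 0) \<beta> \<beta>\<^sub>\<xi>" "\<And>t s. t \<in> {0..T} \<Longrightarrow> s \<in> pts I \<Longrightarrow>
         (W t has_vector_derivative
            \<beta> t s *\<^sub>R Complex (- sin (\<theta> 0 t s)) (cos (\<theta> 0 t s))) (at s within pts I)" by blast
  show ?L unfolding is_gradient_iff
  proof
    fix t assume t: "t \<in> {0..T}"
    with \<beta>(1) obtain c where "I = Interval \<longrightarrow> c = 0" "\<forall>s\<in>pts I. \<beta> t s = \<beta>\<^sub>\<xi> t s + c * ths 0 t s"
      unfolding same_field_def by blast
    with \<beta>(2)[OF t] show "gradient_at t (W t)"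
      by (intro gradient_at_if[OF t, of c "\<beta> t"]) (auto simp: normal_Complex)
  qed
qed

lemma gradient_exists: "\<exists>W. is_gradient I T a b (\<gamma> 0) X W"
proof -
  have "\<forall>t\<in>{0..T}. \<exists>w. gradient_at t w"
  proof
    fix t assume t: "t \<in> {0..T}"
    have "smooth_fun I (\<lambda>s. 1 / b * X t s + ths 0 t s * P t s)"
      by (intro smooth_fun_intros th_smooth zero_in_J t xi_smooth P_smooth)
    then have "smooth_fun I (\<beta>\<^sub>\<xi> t)" by (rule smooth_fun_cong) (simp add: beta_xi_eq[OF t])
    then have "continuous_on (pts I) (\<lambda>s. \<beta>\<^sub>\<xi> t s *\<^sub>R (\<i> * cis (\<theta> 0 t s)))"
      by (intro continuous_on_scaleR smooth_fun_continuous_pts normal_cont t)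
    then obtain w where "\<And>s. s \<in> pts I \<Longrightarrow> (w has_vector_derivative \<beta>\<^sub>\<xi> t s *\<^sub>R (\<i> * cis (\<theta> 0 t s))) (at s within pts I)"
      by (rule antiderivative_pts) blast
    then have "gradient_at t w" by (intro gradient_at_if[OF t, of 0 "\<beta>\<^sub>\<xi> t"]) auto
    then show "\<exists>w. gradient_at t w" by blast
  qed
  from bchoice[OF this] show ?thesis by (simp add: is_gradient_iff)
qed

lemma gradient_pairing:
  assumes W: "is_gradient I T a b (\<gamma> 0) X W" and t: "t \<in> {0..T}"
  shows "elastic_metric I a b (\<gamma> 0 t) (pd_eps0 \<gamma> t) (W t) = integral {0..1} (\<lambda>s. pd_eps0 \<theta> t s * X t s)"
proof -
  have "pd_eps0 \<gamma> = pd_e \<gamma> 0" "pd_eps0 \<theta> = thv 0"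
    by (simp_all add: pd_eps0_def pd_e_def fun_eq_iff)
  moreover have "tangent_field I (\<gamma> 0 t) (thv 0 t) (pd_e \<gamma> 0 t)"
    using pd_e_curve[OF zero_in_J t] th_smooth(1)[OF zero_in_J t] by (simp add: tangent_field_iff[OF t])
  ultimately show ?thesis
    using W t by (simp add: is_gradient_iff gradient_at_def)
qed

end

section \<open>The first variation of the energy\<close>

context elastic_variation
begin

lemma energy_eq:
  assumes e: "e \<in> J" and M: "\<And>t. t \<in> {0..T} \<Longrightarrow> solves_bvp I a b (ths e t) (tht e t) (M t)"
  shows "energy I T a b (\<gamma> e) =
    1/2 * integral {0..T} (\<lambda>t. integral {0..1} (\<lambda>s. b * tht e t s * (tht e t s - ths e t s * M t s)))"
proof -
  have "elastic_metric I a b (\<gamma> e t) (pd_t T (\<gamma> e) t) (pd_t T (\<gamma> e) t) =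
      integral {0..1} (\<lambda>s. b * tht e t s * (tht e t s - ths e t s * M t s))" if t: "t \<in> {0..T}" for t
    by (rule metric_eq[OF e t pd_t_curve[OF e t] pd_t_curve[OF e t] M[OF t]])
  then have "integral {0..T} (\<lambda>t. elastic_metric I a b (\<gamma> e t) (pd_t T (\<gamma> e) t) (pd_t T (\<gamma> e) t)) =
      integral {0..T} (\<lambda>t. integral {0..1} (\<lambda>s. b * tht e t s * (tht e t s - ths e t s * M t s)))"
    by (rule integral_cong)
  then show ?thesis by (simp add: energy_def)
qed

text \<open>The Leibniz rule is used twice, over \<open>s\<close> at fixed \<open>t\<close> and then
  over \<open>t\<close>. In between, the derivative of the auxiliary solution is eliminated, so that
  continuity in \<open>(e, t)\<close> is needed for the solution only.\<close>

lemma energy_has_derivative: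
  fixes m :: "real \<Rightarrow> real \<Rightarrow> real"
  assumes m: "is_m I T a b (\<theta> 0) m"
  shows "((\<lambda>e. energy I T a b (\<gamma> e)) has_real_derivative
    integral {0..T} (\<lambda>t. integral {0..1} (\<lambda>s. b * (tht 0 t s - ths 0 t s * m t s) *
      (thte 0 t s - thse 0 t s * m t s)))) (at 0)"
proof -
  \<comment> \<open>A compact neighbourhood of 0 inside the open interval \<open>J\<close>; the
    parameter lemmas rest on compactness.\<close>
  define U where "U = {-\<delta>/2..\<delta>/2}"
  have UJ: "e \<in> J" if "e \<in> U" for e using that \<delta> by (auto simp: U_def)
  have pts: "s \<in> pts I" if "s \<in> {0..1}" for s using that Icc_subset_pts by blast
  have "\<forall>p\<in>U \<times> {0..T}. \<exists>r. solves_bvp I a b (ths (fst p) (snd p)) (tht (fst p) (snd p)) r"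
  proof
    fix p assume "p \<in> U \<times> {0..T}"
    then have et: "fst p \<in> J" "snd p \<in> {0..T}" using UJ by auto
    show "\<exists>r. solves_bvp I a b (ths (fst p) (snd p)) (tht (fst p) (snd p)) r"
      using solves_bvp_exists[OF et th_smooth(2)[OF et]] by blast
  qed
  from bchoice[OF this] obtain M0 where
    M0: "\<And>p. p \<in> U \<times> {0..T} \<Longrightarrow> solves_bvp I a b (ths (fst p) (snd p)) (tht (fst p) (snd p)) (M0 p)"
    by blast
  define M where "M e t = M0 (e, t)" for e t
  have M: "solves_bvp I a b (ths e t) (tht e t) (M e t)" if "e \<in> U" "t \<in> {0..T}" for e t
    using M0[of "(e, t)"] that by (simp add: M_def)
  note Mbvp = solves_bvp_imp_bvp[OF M a]
  have Mcont0: "continuous_on {0..1} (M e t)" if "e \<in> U" "t \<in> {0..T}" for e t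
    using bvp_continuous(1)[OF Mbvp[OF that]] .
  let ?S = "(U \<times> {0..T}) \<times> {0..1::real}"
  have c3: "continuous_on ?S (\<lambda>x. ths (fst (fst x)) (snd (fst x)) (snd x))"
    "continuous_on ?S (\<lambda>x. tht (fst (fst x)) (snd (fst x)) (snd x))"
    "continuous_on ?S (\<lambda>x. thse (fst (fst x)) (snd (fst x)) (snd x))"
    "continuous_on ?S (\<lambda>x. thte (fst (fst x)) (snd (fst x)) (snd x))"
    by (rule th_cont; use UJ pts in \<open>auto intro!: continuous_intros\<close>)+
  \<comment> \<open>The solutions were chosen separately for each \<open>(e, t)\<close>; their joint
    continuity comes from the uniform bound and serves the outer integral over
    \<open>t\<close>.\<close>
  have "continuous_on ?S (\<lambda>(p, s). M (fst p) (snd p) s)"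
  proof (rule bvp_continuous_param[where P = "U \<times> {0..T}" and Q = b and I = I and a = a
        and q = "\<lambda>p s. b * (ths (fst p) (snd p) s)\<^sup>2"
        and f = "\<lambda>p s. b * ths (fst p) (snd p) s * tht (fst p) (snd p) s"
        and u' = "\<lambda>p. D I (M (fst p) (snd p))"])
    show "compact (U \<times> {0..T})" unfolding U_def by (intro compact_Times compact_Icc)
    show "continuous_on ?S (\<lambda>(p, s). b * (ths (fst p) (snd p) s)\<^sup>2)"
      "continuous_on ?S (\<lambda>(p, s). b * ths (fst p) (snd p) s * tht (fst p) (snd p) s)"
      unfolding split_beta by (intro continuous_intros c3)+
  qed (use a b UJ q_props(3) Mbvp in auto)
  then have cM: "continuous_on ?S (\<lambda>x. M (fst (fst x)) (snd (fst x)) (snd x))"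
    by (simp add: split_beta)
  define G where "G e t = integral {0..1} (\<lambda>s. b * tht e t s * (tht e t s - ths e t s * M e t s))" for e t
  define A where "A e t = integral {0..1} (\<lambda>s. b * (tht e t s - ths e t s * M e t s) *
      (thte e t s - thse e t s * M e t s))" for e t
  have G_deriv: "((\<lambda>e. G e t) has_real_derivative 2 * A e t) (at e within U)"
    if e: "e \<in> U" and t: "t \<in> {0..T}" for e t
  proof -
    define q where "q = (\<lambda>e s. b * (ths e t s)\<^sup>2)"
    define f where "f = (\<lambda>e s. b * ths e t s * tht e t s)"
    define qe where "qe = (\<lambda>e s. 2 * b * ths e t s * thse e t s)"
    define fe where "fe = (\<lambda>e s. b * (thse e t s * tht e t s + ths e t s * thte e t s))"
    have c2: "continuous_on (U \<times> {0..1}) (\<lambda>x. ths (fst x) t (snd x))"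
      "continuous_on (U \<times> {0..1}) (\<lambda>x. tht (fst x) t (snd x))"
      "continuous_on (U \<times> {0..1}) (\<lambda>x. thse (fst x) t (snd x))"
      "continuous_on (U \<times> {0..1}) (\<lambda>x. thte (fst x) t (snd x))"
      by (rule th_cont; use UJ pts t in \<open>auto intro!: continuous_intros\<close>)+
    have "continuous_on (U \<times> {0..1}) (\<lambda>x. ((fst x, t), snd x))" by (intro continuous_intros)
    moreover have "(\<lambda>x. ((fst x, t), snd x)) ` (U \<times> {0..1}) \<subseteq> ?S" using t by auto
    ultimately have cMe: "continuous_on (U \<times> {0..1}) (\<lambda>x. M (fst x) t (snd x))"
      using continuous_on_compose2[OF cM] by fastforce
    have conts: "continuous_on (U \<times> {0..1}) (\<lambda>(e, s). q e s)" "continuous_on (U \<times> {0..1}) (\<lambda>(e, s). f e s)"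
      "continuous_on (U \<times> {0..1}) (\<lambda>(e, s). qe e s)" "continuous_on (U \<times> {0..1}) (\<lambda>(e, s). fe e s)"
      "continuous_on (U \<times> {0..1}) (\<lambda>(e, s). fe e s - qe e s * M e t s)"
      unfolding q_def f_def qe_def fe_def split_beta by (intro continuous_intros c2 cMe)+
    have q_pos: "0 \<le> q e s" for e s using b by (simp add: q_def)
    have q_int: "b \<le> integral {0..1} (q e)" if "e \<in> U" "I = Circle" for e
      unfolding q_def by (rule q_props(3)[OF UJ[OF that(1)] t that(2)])
    have Mb: "bvp I a (q e) (f e) (M e t) (D I (M e t))" if "e \<in> U" for e
      unfolding q_def f_def by (rule Mbvp[OF that t])
    have "\<forall>e\<in>U. \<exists>V. \<exists>V'. bvp I a (q e) (\<lambda>s. fe e s - qe e s * M e t s) V V'"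
    proof
      fix e assume e: "e \<in> U"
      obtain V V' where "bvp I a (q e) (\<lambda>s. fe e s - qe e s * M e t s) V V'"
      proof (rule bvp_exists[OF a])
        show "continuous_on {0..1} (\<lambda>s. fe e s - qe e s * M e t s)" "continuous_on {0..1} (q e)"
          using continuous_on_slice[OF conts(5) e] continuous_on_slice[OF conts(1) e] .
        show "I = Circle \<Longrightarrow> 0 < integral {0..1} (q e)" using q_int[OF e] b by linarith
      qed (use q_pos in auto)
      then show "\<exists>V. \<exists>V'. bvp I a (q e) (\<lambda>s. fe e s - qe e s * M e t s) V V'" by blast
    qed
    from bchoice[OF this] obtain V where "\<forall>e\<in>U. \<exists>V'. bvp I a (q e) (\<lambda>s. fe e s - qe e s * M e t s) (V e) V'"
      by blast
    from bchoice[OF this] obtain V' where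
      V: "\<And>e. e \<in> U \<Longrightarrow> bvp I a (q e) (\<lambda>s. fe e s - qe e s * M e t s) (V e) (V' e)" by blast
    \<comment> \<open>\<open>V\<close> is going to be the \<open>e\<close>-derivative of
      \<open>M\<close>; its continuity in \<open>(e, s)\<close> is what the inner Leibniz rule asks
      for.\<close>
    have cV: "continuous_on (U \<times> {0..1}) (\<lambda>(e, s). V e s)"
      by (rule bvp_continuous_param[OF a _ conts(1) q_pos conts(5) b q_int V]) (simp_all add: U_def)
    have d: "((\<lambda>e. ths e t s) has_real_derivative thse e t s) (at e within U)"
      "((\<lambda>e. tht e t s) has_real_derivative thte e t s) (at e within U)"
      if "e \<in> U" "s \<in> {0..1}" for e s
      using th_deriv(7,8)[OF UJ[OF that(1)] t pts[OF that(2)]] by (auto intro: has_field_derivative_at_within)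
    have M_deriv: "((\<lambda>e. M e t s) has_real_derivative V e s) (at e within U)"
      if e: "e \<in> U" and s: "s \<in> {0..1}" for e s
    proof (rule bvp_differentiable_param[where l = "- \<delta> / 2" and r = "\<delta> / 2" and q = q and f = f and qd = qe and fd = fe and Q = b and I = I and a = a
          and v = V and v' = V' and s = s and u = "\<lambda>e. M e t" and u' = "\<lambda>e. D I (M e t)", folded U_def])
      fix e s assume e: "e \<in> U" and s: "s \<in> {0..1::real}"
      show "((\<lambda>e. q e s) has_real_derivative qe e s) (at e within U)"
        unfolding q_def qe_def using d[OF e s] by (auto intro!: derivative_eq_intros)
      show "((\<lambda>e. f e s) has_real_derivative fe e s) (at e within U)"
        unfolding f_def fe_def using d[OF e s] by (auto intro!: derivative_eq_intros simp: algebra_simps)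
    qed (use a b conts q_pos q_int Mb V e s in auto)
    define g where "g = (\<lambda>e s. b * thte e t s * (tht e t s - ths e t s * M e t s) +
        b * tht e t s * (thte e t s - (thse e t s * M e t s + ths e t s * V e s)))"
    have cg: "continuous_on (U \<times> {0..1}) (\<lambda>(e, s). g e s)"
      using cV unfolding g_def split_beta by (intro continuous_intros c2 cMe)
    have cG: "continuous_on (U \<times> {0..1}) (\<lambda>(e, s). b * tht e t s * (tht e t s - ths e t s * M e t s))"
      unfolding split_beta by (intro continuous_intros c2 cMe)
    have cA: "continuous_on (U \<times> {0..1}) (\<lambda>(e, s). b * (tht e t s - ths e t s * M e t s) * (thte e t s - thse e t s * M e t s))"
      unfolding split_beta by (intro continuous_intros c2 cMe)
    have "((\<lambda>e. integral (cbox 0 1) (\<lambda>s. b * tht e t s * (tht e t s - ths e t s * M e t s)))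
        has_real_derivative integral (cbox 0 1) (g e)) (at e within U)"
    proof (rule leibniz_rule_field_derivative)
      fix e s assume e: "e \<in> U" and s: "s \<in> cbox 0 (1::real)"
      then have s: "s \<in> {0..1}" by simp
      show "((\<lambda>e. b * tht e t s * (tht e t s - ths e t s * M e t s)) has_real_derivative g e s) (at e within U)"
        unfolding g_def using d[OF e s] M_deriv[OF e s]
        by (auto intro!: derivative_eq_intros simp: algebra_simps)
    next
      fix e assume e: "e \<in> U"
      show "(\<lambda>s. b * tht e t s * (tht e t s - ths e t s * M e t s)) integrable_on cbox 0 1"
        using continuous_on_slice[OF cG e] by (simp add: integrable_continuous_interval)
    qed (use cg e in \<open>auto simp: U_def\<close>)
    \<comment> \<open>\<open>g\<close> contains \<open>- f V\<close>. Symmetry trades the integral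
      of \<open>f V\<close> for that of \<open>(fe - qe M) M\<close>, which is free of derivatives
      of \<open>M\<close>, and the result is twice a product. The factor 2 cancels the 1/2 of the
      energy.\<close>
    moreover have "integral {0..1} (g e) = 2 * A e t"
    proof -
      have "(g e has_integral integral {0..1} (g e)) {0..1}"
        using continuous_on_slice[OF cg e] by (intro integrable_integral integrable_continuous_interval)
      from has_integral_add[OF this bvp_symmetric[OF Mb[OF e] V[OF e]]] a
      have "((\<lambda>s. g e s + (f e s * V e s - (fe e s - qe e s * M e t s) * M e t s)) has_integral
          integral {0..1} (g e)) {0..1}" by simp
      moreover have "g e s + (f e s * V e s - (fe e s - qe e s * M e t s) * M e t s) =
          2 * (b * (tht e t s - ths e t s * M e t s) * (thte e t s - thse e t s * M e t s))" for s
        by (simp add: g_def f_def fe_def qe_def algebra_simps)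
      ultimately have "((\<lambda>s. 2 * (b * (tht e t s - ths e t s * M e t s) * (thte e t s - thse e t s * M e t s)))
          has_integral integral {0..1} (g e)) {0..1}" by simp
      from integral_unique[OF this] show ?thesis by (simp add: A_def)
    qed
    ultimately show ?thesis by (simp add: G_def)
  qed
  have GA_cont: "continuous_on (U \<times> {0..T}) (\<lambda>(e, t). G e t)" "continuous_on (U \<times> {0..T}) (\<lambda>(e, t). A e t)"
  proof -
    have "continuous_on (U \<times> {0..T}) (\<lambda>p. integral (cbox 0 1) (\<lambda>s. b * tht (fst p) (snd p) s *
        (tht (fst p) (snd p) s - ths (fst p) (snd p) s * M (fst p) (snd p) s)))"
      by (rule integral_continuous_on_param) (unfold split_beta box_real, intro continuous_intros c3 cM)
    then show "continuous_on (U \<times> {0..T}) (\<lambda>(e, t). G e t)" by (simp add: split_beta G_def)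
    have "continuous_on (U \<times> {0..T}) (\<lambda>p. integral (cbox 0 1) (\<lambda>s. b *
        (tht (fst p) (snd p) s - ths (fst p) (snd p) s * M (fst p) (snd p) s) *
        (thte (fst p) (snd p) s - thse (fst p) (snd p) s * M (fst p) (snd p) s)))"
      by (rule integral_continuous_on_param) (unfold split_beta box_real, intro continuous_intros c3 cM)
    then show "continuous_on (U \<times> {0..T}) (\<lambda>(e, t). A e t)" by (simp add: split_beta A_def)
  qed
  have U0: "0 \<in> U" using \<delta> by (simp add: U_def)
  have "((\<lambda>e. integral (cbox 0 T) (\<lambda>t. G e t)) has_real_derivative integral (cbox 0 T) (\<lambda>t. 2 * A 0 t)) (at 0 within U)"
  proof (rule leibniz_rule_field_derivative[where fx = "\<lambda>e t. 2 * A e t"])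
    show "continuous_on (U \<times> cbox 0 T) (\<lambda>(e, t). 2 * A e t)"
      using GA_cont(2) unfolding split_beta box_real by (intro continuous_intros)
    fix e assume e: "e \<in> U"
    show "G e integrable_on cbox 0 T"
      using continuous_on_slice[OF GA_cont(1) e] by (simp add: integrable_continuous_interval)
  qed (use G_deriv U0 in \<open>auto simp: U_def\<close>)
  from DERIV_cmult[OF this, of "1 / 2"]
  have "((\<lambda>e. 1 / 2 * integral {0..T} (\<lambda>t. G e t)) has_real_derivative integral {0..T} (\<lambda>t. A 0 t)) (at 0 within U)"
    by simp
  then have "((\<lambda>e. energy I T a b (\<gamma> e)) has_real_derivative integral {0..T} (\<lambda>t. A 0 t)) (at 0 within U)"
    by (rule has_real_derivative_transform[OF U0, rotated])
      (unfold G_def, rule energy_eq[OF UJ M])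
  moreover have "at 0 within U = at 0"
    unfolding U_def by (rule at_within_Icc_at) (use \<delta> in auto)
  moreover have "integral {0..T} (\<lambda>t. A 0 t) = integral {0..T} (\<lambda>t. integral {0..1} (\<lambda>s. b * (tht 0 t s - ths 0 t s * m t s) *
      (thte 0 t s - thse 0 t s * m t s)))"
    unfolding A_def
  proof (intro integral_cong)
    fix t s assume t: "t \<in> {0..T}" and s: "s \<in> {0..1::real}"
    \<comment> \<open>The chosen family and the given \<open>m\<close> agree by uniqueness.\<close>
    have "M 0 t s = m t s"
      by (rule solves_bvp_unique[OF zero_in_J t M[OF U0 t] is_m_solves[OF m t] pts[OF s]])
    then show "b * (tht 0 t s - ths 0 t s * M 0 t s) * (thte 0 t s - thse 0 t s * M 0 t s) =
        b * (tht 0 t s - ths 0 t s * m t s) * (thte 0 t s - thse 0 t s * m t s)" by simp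
  qed
  ultimately show ?thesis by simp
qed

end

context elastic_solution
begin

text \<open>With \<open>w = \<theta>_t - \<theta>_s m\<close> one has
  \<open>\<xi> = b (- w_t + (w m)_s)\<close>: the first summand comes from integrating by parts in
  \<open>t\<close>, the second from \<open>s\<close>. In \<open>t\<close> only the inner integral
  \<open>B\<close> is differentiated, so the order of integration is never exchanged.\<close>

lemma first_variation:
  "integral {0..T} (\<lambda>t. integral {0..1} (\<lambda>s. b * (tht 0 t s - ths 0 t s * m t s) *
      (thte 0 t s - thse 0 t s * m t s))) =
   integral {0..T} (\<lambda>t. integral {0..1} (\<lambda>s. thv 0 t s * X t s))"
proof -
  define w where "w t s = tht 0 t s - ths 0 t s * m t s" for t s
  define wt where "wt t s = thtt 0 t s - (thst 0 t s * m t s + ths 0 t s * v t s)" for t s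
  define A where "A t = integral {0..1} (\<lambda>s. b * w t s * (thte 0 t s - thse 0 t s * m t s))" for t
  define B where "B t = integral {0..1} (\<lambda>s. b * w t s * thv 0 t s)" for t
  define B' where "B' t = integral {0..1} (\<lambda>s. b * (wt t s * thv 0 t s + w t s * thte 0 t s))" for t
  have pts: "s \<in> pts I" if "s \<in> {0..1}" for s using that Icc_subset_pts by blast
  note mv = m_cont[unfolded split_beta] v_cont[unfolded split_beta]
  have cA: "continuous_on ({0..T} \<times> {0..1}) (\<lambda>(t, s). b * w t s * (thte 0 t s - thse 0 t s * m t s))"
    and cB: "continuous_on ({0..T} \<times> {0..1}) (\<lambda>(t, s). b * w t s * thv 0 t s)"
    and cB': "continuous_on ({0..T} \<times> {0..1}) (\<lambda>(t, s). b * (wt t s * thv 0 t s + w t s * thte 0 t s))"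
    unfolding split_beta w_def wt_def by (intro continuous_intros th0_cont mv)+
  have A: "continuous_on {0..T} A"
    using integral_continuous_on_param[of "{0..T}" 0 1 "\<lambda>t s. b * w t s * (thte 0 t s - thse 0 t s * m t s)"] cA
    by (simp add: A_def[abs_def])
  have B': "continuous_on {0..T} B'"
    using integral_continuous_on_param[of "{0..T}" 0 1 "\<lambda>t s. b * (wt t s * thv 0 t s + w t s * thte 0 t s)"] cB'
    by (simp add: B'_def[abs_def])
  have B_deriv: "(B has_real_derivative B' t) (at t within {0..T})" if t: "t \<in> {0..T}" for t
  proof -
    have "((\<lambda>t. integral (cbox 0 1) (\<lambda>s. b * w t s * thv 0 t s)) has_real_derivative
        integral (cbox 0 1) (\<lambda>s. b * (wt t s * thv 0 t s + w t s * thte 0 t s))) (at t within {0..T})"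
    proof (rule leibniz_rule_field_derivative)
      fix t s assume t: "t \<in> {0..T}" and s: "s \<in> cbox 0 (1::real)"
      then have "s \<in> pts I" using pts by simp
      note d = th_deriv(4-6)[OF zero_in_J t this] m_t_deriv[OF t this]
      show "((\<lambda>t. b * w t s * thv 0 t s) has_real_derivative b * (wt t s * thv 0 t s + w t s * thte 0 t s)) (at t within {0..T})"
        unfolding w_def wt_def using d by (auto intro!: derivative_eq_intros simp: algebra_simps)
    next
      fix t assume t: "t \<in> {0..T}"
      show "(\<lambda>s. b * w t s * thv 0 t s) integrable_on cbox 0 1"
        using continuous_on_slice[OF cB t] by (simp add: integrable_continuous_interval)
    qed (use cB' t in auto)
    then show ?thesis by (simp add: B_def[abs_def] B'_def)
  qed
  \<comment> \<open>The boundary term of the integration by parts in \<open>t\<close>; it vanishes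
    because the variation fixes both end curves modulo translations.\<close>
  have "B t = 0" if "t = 0 \<or> t = T" for t
  proof -
    have "integral {0..1} (\<lambda>s. b * w t s * thv 0 t s) = integral {0..1} (\<lambda>s::real. 0)"
      by (rule integral_cong) (use the_boundary[OF that zero_in_J pts] in simp)
    then show ?thesis by (simp add: B_def)
  qed
  moreover have "(B' has_integral B T - B 0) {0..T}"
    by (rule fundamental_theorem_of_calculus)
      (use T B_deriv in \<open>auto simp: has_real_derivative_iff_has_vector_derivative\<close>)
  ultimately have "integral {0..T} B' = 0" by (simp add: integral_unique)
  moreover have "integral {0..T} (\<lambda>t. A t - B' t) = integral {0..T} A - integral {0..T} B'"
    using A B' by (intro integral_diff integrable_continuous_interval)
  moreover have "integral {0..T} (\<lambda>t. integral {0..1} (\<lambda>s. thv 0 t s * X t s)) = integral {0..T} (\<lambda>t. A t - B' t)"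
  proof (rule integral_cong)
    fix t assume t: "t \<in> {0..T}"
    define g where "g s = b * w t s * (thte 0 t s - thse 0 t s * m t s)
        - b * (wt t s * thv 0 t s + w t s * thte 0 t s) - thv 0 t s * X t s" for s
    \<comment> \<open>The boundary term of the integration by parts in \<open>s\<close>; it vanishes
      with \<open>m\<close> on the interval and by periodicity on the circle.\<close>
    define F where "F s = - b * w t s * m t s * thv 0 t s" for s
    have "(g has_integral F 1 - F 0) {0..1}"
    proof (rule has_integral_of_deriv)
      fix s :: real assume "s \<in> {0..1}"
      then have s: "s \<in> pts I" by (rule pts)
      note d = th_deriv(1-3)[OF zero_in_J t s] m_deriv(1)[OF t s]
      have "(F has_real_derivative g s) (at s within pts I)"
        unfolding F_def[abs_def] g_def w_def wt_def xi_eq[OF t s] using d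
        by (auto intro!: derivative_eq_intros simp: algebra_simps power2_eq_square)
      then show "(F has_real_derivative g s) (at s within {0..1})"
        by (rule DERIV_subset[OF _ Icc_subset_pts])
    qed
    moreover have "F 1 - F 0 = 0"
    proof (cases I)
      case Interval
      with m_bvp[OF t] have "m t 0 = 0" "m t 1 = 0" by (simp_all add: bvp_def)
      then show ?thesis by (simp add: F_def)
    next
      case Circle
      have "smooth_fun I F"
        unfolding F_def[abs_def] w_def
        by (intro smooth_fun_intros th_smooth zero_in_J t m_smooth)
      then have "\<forall>s. F (s + 1) = F s" using Circle by (simp add: smooth_fun_def)
      from spec[OF this, of 0] show ?thesis by simp
    qed
    ultimately have g: "(g has_integral 0) {0..1}" by simp
    have "((\<lambda>s. b * w t s * (thte 0 t s - thse 0 t s * m t s) - b * (wt t s * thv 0 t s + w t s * thte 0 t s) - g s)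
        has_integral A t - B' t - 0) {0..1}"
      unfolding A_def B'_def using continuous_on_slice[OF cA t] continuous_on_slice[OF cB' t]
      by (intro has_integral_diff integrable_integral integrable_continuous_interval g)
    then show "integral {0..1} (\<lambda>s. thv 0 t s * X t s) = A t - B' t"
      by (simp add: g_def integral_unique)
  qed
  ultimately have "integral {0..T} A = integral {0..T} (\<lambda>t. integral {0..1} (\<lambda>s. thv 0 t s * X t s))"
    by simp
  then show ?thesis by (simp add: A_def[abs_def] w_def)
qed

lemma energy_derivative:
  "((\<lambda>e. energy I T a b (\<gamma> e)) has_real_derivative
     integral {0..T} (\<lambda>t. integral {0..1} (\<lambda>s. pd_eps0 \<theta> t s * X t s))) (at 0)"
proof -
  have "pd_eps0 \<theta> = thv 0" by (simp add: pd_eps0_def pd_e_def fun_eq_iff)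
  then show ?thesis using energy_has_derivative[OF m] first_variation by simp
qed

end

theorem theorem3p5:
  fixes I :: curve_domain
    and a b T \<delta> :: real
    and \<gamma> :: "real \<Rightarrow> real \<Rightarrow> real \<Rightarrow> complex"
    and \<theta> :: "real \<Rightarrow> real \<Rightarrow> real \<Rightarrow> real"
  assumes "a > 0" and "b > 0" and "T > 0" and "\<delta> > 0"
    and "variation I T \<delta> \<gamma> \<theta>"
  shows
    "(\<exists>m. is_m I T a b (\<theta> 0) m) \<and>
     (\<forall>m m'. is_m I T a b (\<theta> 0) m \<and> is_m I T a b (\<theta> 0) m' \<longrightarrow>
        (\<forall>t\<in>{0..T}. \<forall>s\<in>pts I. m t s = m' t s)) \<and>
     (\<forall>m. is_m I T a b (\<theta> 0) m \<longrightarrow>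
        ((\<lambda>\<epsilon>. energy I T a b (\<gamma> \<epsilon>)) has_real_derivative
           integral {0..T} (\<lambda>t. integral {0..1} (\<lambda>s. pd_eps0 \<theta> t s * xi I T b (\<theta> 0) m t s))) (at 0) \<and>
        (\<exists>W. is_gradient I T a b (\<gamma> 0) (xi I T b (\<theta> 0) m) W) \<and>
        (\<forall>W. is_gradient I T a b (\<gamma> 0) (xi I T b (\<theta> 0) m) W \<longrightarrow>
           ((\<lambda>\<epsilon>. energy I T a b (\<gamma> \<epsilon>)) has_real_derivative
              integral {0..T} (\<lambda>t. elastic_metric I a b (\<gamma> 0 t) (pd_eps0 \<gamma> t) (W t))) (at 0)) \<and>
        (\<forall>W. is_gradient I T a b (\<gamma> 0) (xi I T b (\<theta> 0) m) W \<longleftrightarrow>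
           (\<exists>\<beta>. same_field I T (\<theta> 0) \<beta> (beta_xi I T a b (\<theta> 0) m) \<and>
              (\<forall>t\<in>{0..T}. \<forall>s\<in>pts I.
                 (W t has_vector_derivative
                    \<beta> t s *\<^sub>R Complex (- sin (\<theta> 0 t s)) (cos (\<theta> 0 t s))) (at s within pts I)))) \<and>
        same_field I T (\<theta> 0) (beta_m I T a b (\<theta> 0) m) (beta_xi I T a b (\<theta> 0) m))"
proof -
  interpret elastic_variation I a b T \<delta> \<gamma> \<theta>
    by unfold_locales (use assms in auto)
  show ?thesis
  proof (intro conjI allI impI)
    show "\<exists>m. is_m I T a b (\<theta> 0) m" by (rule is_m_exists)
  next
    fix m m' assume "is_m I T a b (\<theta> 0) m \<and> is_m I T a b (\<theta> 0) m'"
    then show "\<forall>t\<in>{0..T}. \<forall>s\<in>pts I. m t s = m' t s"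
      using solves_bvp_unique[OF zero_in_J] is_m_solves by blast
  next
    fix m assume m: "is_m I T a b (\<theta> 0) m"
    \<comment> \<open>The linearized solutions exist at each time separately; \<open>lin\<close>
      bundles their properties, so that two choices produce the families \<open>v\<close> and
      \<open>v'\<close> for the locale. Their regularity in \<open>t\<close> is proved there and
      need not be arranged by the choice.\<close>
    define lin where "lin t p p' \<longleftrightarrow> smooth_fun I p \<and> smooth_fun I p' \<and>
      (\<forall>s\<in>pts I. (p has_real_derivative p' s) (at s within pts I)) \<and>
      (\<forall>s\<in>pts I. (p' has_real_derivative (b * (ths 0 t s)\<^sup>2 * p s
        - (b * (thst 0 t s * tht 0 t s + ths 0 t s * thtt 0 t s) - 2 * b * ths 0 t s * thst 0 t s * m t s)) / a)
        (at s within pts I)) \<and>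
      bvp I a (\<lambda>s. b * (ths 0 t s)\<^sup>2)
        (\<lambda>s. b * (thst 0 t s * tht 0 t s + ths 0 t s * thtt 0 t s) - 2 * b * ths 0 t s * thst 0 t s * m t s) p p'"
      for t p p'
    have "\<forall>t\<in>{0..T}. \<exists>p. \<exists>p'. lin t p p'"
    proof
      fix t assume t: "t \<in> {0..T}"
      show "\<exists>p. \<exists>p'. lin t p p'"
        by (rule linearized_solution[OF m t]) (unfold lin_def, blast)
    qed
    from bchoice[OF this] obtain v where "\<forall>t\<in>{0..T}. \<exists>p'. lin t (v t) p'" by blast
    from bchoice[OF this] obtain v' where "\<forall>t\<in>{0..T}. lin t (v t) (v' t)" by blast
    then interpret elastic_solution I a b T \<delta> \<gamma> \<theta> m v v'
      by unfold_locales (use m in \<open>auto simp: lin_def\<close>)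
    show "((\<lambda>\<epsilon>. energy I T a b (\<gamma> \<epsilon>)) has_real_derivative
        integral {0..T} (\<lambda>t. integral {0..1} (\<lambda>s. pd_eps0 \<theta> t s * xi I T b (\<theta> 0) m t s))) (at 0)"
      by (rule energy_derivative)
    show "\<exists>W. is_gradient I T a b (\<gamma> 0) (xi I T b (\<theta> 0) m) W" by (rule gradient_exists)
    show "same_field I T (\<theta> 0) (beta_m I T a b (\<theta> 0) m) (beta_xi I T a b (\<theta> 0) m)"
      by (rule formulas_agree)
    fix W
    show "is_gradient I T a b (\<gamma> 0) (xi I T b (\<theta> 0) m) W \<longleftrightarrow>
      (\<exists>\<beta>. same_field I T (\<theta> 0) \<beta> (beta_xi I T a b (\<theta> 0) m) \<and>
        (\<forall>t\<in>{0..T}. \<forall>s\<in>pts I.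
           (W t has_vector_derivative
              \<beta> t s *\<^sub>R Complex (- sin (\<theta> 0 t s)) (cos (\<theta> 0 t s))) (at s within pts I)))"
      by (rule gradient_formula)
    assume "is_gradient I T a b (\<gamma> 0) (xi I T b (\<theta> 0) m) W"
    then have "integral {0..T} (\<lambda>t. elastic_metric I a b (\<gamma> 0 t) (pd_eps0 \<gamma> t) (W t)) =
        integral {0..T} (\<lambda>t. integral {0..1} (\<lambda>s. pd_eps0 \<theta> t s * xi I T b (\<theta> 0) m t s))"
      by (intro integral_cong gradient_pairing)
    then show "((\<lambda>\<epsilon>. energy I T a b (\<gamma> \<epsilon>)) has_real_derivative
        integral {0..T} (\<lambda>t. elastic_metric I a b (\<gamma> 0 t) (pd_eps0 \<gamma> t) (W t))) (at 0)"
      using energy_derivative by simp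
  qed
qed

end
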